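(* Let $q$ be any power of a prime $p$ and let $U=U(q)$ be as in the context. For $j\in\{1,\dots,12\}$ write $X_j=X_{\alpha_j}$. Every $\chi\in\operatorname{Irr}(U)$ lies in exactly one of the following classes, and the classes have the stated numbers of characters and degrees: \begin{enumerate} \item $X_{12}\not\subseteq\ker\chi$: exactly $q^3(q-1)$ characters, all of degree $q^4$. \item $X_{12}\subseteq\ker\chi$, $X_{11}\not\subseteq\ker\chi$: exactly $q^4(q-1)$ characters, all of degree $q^3$. \item $X_{11}X_{12}\subseteq\ker\chi$ and $X_8,X_9,X_{10}\not\subseteq\ker\chi$: if $q$ is odd, exactly $q(q-1)^3$ characters, all of degree $q^3$; if $q$ is even, exactly $(q-1)^3$ characters of degree $q^3$ and exactly $4(q-1)^4$ characters of degree $q^3/2$, and no others. \item For each of the three choices $\{i,j,k\}=\{8,9,10\}$ with $i<j$: $X_kX_{11}X_{12}\subseteq\ker\chi$ and $X_i,X_j\not\subseteq\ker\chi$: exactly $(q-1)^3$ characters of degree $q^3$ and exactly $q^2(q-1)^2$ characters of degree $q^2$, and no others. \item For each $i\in\{8,9,10\}$: $X_j\subseteq\ker\chi$ for all $j\in\{8,9,10,11,12\}\setminus\{i\}$ and $X_i\not\subseteq\ker\chi$: exactly $(q-1)^2$ characters of degree $q^3$ and exactly $q^2(q-1)$ characters of degree $q^2$, and no others. \item $X_j\subseteq\ker\chi$ for $j=8,\dots,12$ and $X_5,X_6,X_7\not\subseteq\ker\chi$: exactly $q^2(q-1)^3$ characters, all of degree $q$. \item For each choice $\{i,j,k\}=\{5,6,7\}$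 with $i<j$: $X_j'\subseteq\ker\chi$ for $j'\in\{k,8,9,10,11,12\}$ and $X_i,X_j\not\subseteq\ker\chi$: exactly $q^2(q-1)^2$ characters, all of degree $q$. \item For each $i\in\{5,6,7\}$: $X_j\subseteq\ker\chi$ for all $j\in\{5,\dots,12\}\setminus\{i\}$ and $X_i\not\subseteq\ker\chi$: exactly $q^2(q-1)$ characters, all of degree $q$. \item $X_j\subseteq\ker\chi$ for all $j=5,\dots,12$: exactly $q^4$ characters, all linear (degree $1$). \end{enumerate}
   Context: Let $q$ be a power of a prime $p$ and $\mathbb{F}_q$ the field with $q$ elements. Let $\Phi$ be a root system of type $D_4$ with simple roots $\alpha_1,\alpha_2,\alpha_3,\alpha_4$, where $\alpha_3$ is the central node of the Dynkin diagram (so $\alpha_1,\alpha_2,\alpha_4$ are pairwise orthogonal and each is joined to $\alpha_3$). The positive roots are $\alpha_1,\dots,\alpha_4$ and $\alpha_5=\alpha_1+\alpha_3$, $\alpha_6=\alpha_2+\alpha_3$, $\alpha_7=\alpha_3+\alpha_4$, $\alpha_8=\alpha_1+\alpha_2+\alpha_3$, $\alpha_9=\alpha_1+\alpha_3+\alpha_4$, $\alpha_{10}=\alpha_2+\alpha_3+\alpha_4$, $\alpha_{11}=\alpha_1+\alpha_2+\alpha_3+\alpha_4$, $\alpha_{12}=\alpha_1+\alpha_2+2\alpha_3+\alpha_4$. Let $U=U(q)$ be the Sylow $p$-subgroup (maximal unipotent subgroup generated by positive root elements) of the Chevalley group $D_4(q)$, generated by root elements $x_i(t)=x_{\alpha_i}(t)$,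 $i=1,\dots,12$, $t\in\mathbb{F}_q$. Concretely: $x_i(t)x_i(u)=x_i(t+u)$; every element of $U$ is uniquely $x_1(d_1)x_2(d_2)\cdots x_{12}(d_{12})$ with $d_i\in\mathbb{F}_q$, so $|U|=q^{12}$; and with $[a,b]=a^{-1}b^{-1}ab$ the commutators are $[x_1(t),x_3(u)]=x_5(tu)$, $[x_1(t),x_6(u)]=x_8(-tu)$, $[x_1(t),x_7(u)]=x_9(tu)$, $[x_1(t),x_{10}(u)]=x_{11}(-tu)$, $[x_2(t),x_3(u)]=x_6(tu)$, $[x_2(t),x_5(u)]=x_8(-tu)$, $[x_2(t),x_7(u)]=x_{10}(tu)$, $[x_2(t),x_9(u)]=x_{11}(-tu)$, $[x_3(t),x_4(u)]=x_7(tu)$, $[x_3(t),x_{11}(u)]=x_{12}(-tu)$, $[x_4(t),x_5(u)]=x_9(-tu)$, $[x_4(t),x_6(u)]=x_{10}(-tu)$, $[x_4(t),x_8(u)]=x_{11}(-tu)$, $[x_5(t),x_{10}(u)]=x_{12}(-tu)$, $[x_6(t),x_9(u)]=x_{12}(-tu)$, $[x_7(t),x_8(u)]=x_{12}(tu)$, and all other $[x_i(t),x_j(u)]$ with $i<j$ equal $1$. The root subgroup is $X_{\alpha_i}=\{x_i(t):t\in\mathbb{F}_q\}\cong(\mathbb{F}_q,+)$. $\operatorname{Irr}(U)$ denotes the set of complex irreducible characters of $U$. *)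

theory Defs
  imports "HOL-Algebra.Group" "HOL-Algebra.Coset" "Jordan_Normal_Form.Matrix"
begin

definition is_rep :: "('g, 'b) monoid_scheme \<Rightarrow> nat \<Rightarrow> ('g \<Rightarrow> complex mat) \<Rightarrow> bool" where
  "is_rep G n \<rho> \<longleftrightarrow>
     (\<forall>g\<in>carrier G. \<rho> g \<in> carrier_mat n n) \<and>
     (\<forall>g\<in>carrier G. \<forall>h\<in>carrier G. \<rho> (g \<otimes>\<^bsub>G\<^esub> h) = \<rho> g * \<rho> h) \<and>
     \<rho> \<one>\<^bsub>G\<^esub> = 1\<^sub>m n"

definition invariant_subspace ::
  "('g, 'b) monoid_scheme \<Rightarrow> nat \<Rightarrow> ('g \<Rightarrow> complex mat) \<Rightarrow> complex vec set \<Rightarrow> bool" where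
  "invariant_subspace G n \<rho> W \<longleftrightarrow>
     W \<subseteq> carrier_vec n \<and> 0\<^sub>v n \<in> W \<and>
     (\<forall>v\<in>W. \<forall>w\<in>W. v + w \<in> W) \<and>
     (\<forall>c. \<forall>v\<in>W. c \<cdot>\<^sub>v v \<in> W) \<and>
     (\<forall>g\<in>carrier G. \<forall>v\<in>W. \<rho> g *\<^sub>v v \<in> W)"

definition irred_rep :: "('g, 'b) monoid_scheme \<Rightarrow> nat \<Rightarrow> ('g \<Rightarrow> complex mat) \<Rightarrow> bool" where
  "irred_rep G n \<rho> \<longleftrightarrow> 0 < n \<and> is_rep G n \<rho> \<and>
     (\<forall>W. invariant_subspace G n \<rho> W \<longrightarrow> W = {0\<^sub>v n} \<or> W = carrier_vec n)"

definition mat_trace :: "complex mat \<Rightarrow> complex" where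
  "mat_trace A = (\<Sum>i<dim_row A. A $$ (i, i))"

definition Irr :: "('g, 'b) monoid_scheme \<Rightarrow> ('g \<Rightarrow> complex) set" where
  "Irr G = {\<chi>. \<exists>n \<rho>. irred_rep G n \<rho> \<and>
              \<chi> = (\<lambda>g. if g \<in> carrier G then mat_trace (\<rho> g) else 0)}"

definition char_ker :: "('g, 'b) monoid_scheme \<Rightarrow> ('g \<Rightarrow> complex) \<Rightarrow> 'g set" where
  "char_ker G \<chi> = {g \<in> carrier G. \<chi> g = \<chi> \<one>\<^bsub>G\<^esub>}"

definition char_deg :: "('g, 'b) monoid_scheme \<Rightarrow> ('g \<Rightarrow> complex) \<Rightarrow> complex" where
  "char_deg G \<chi> = \<chi> \<one>\<^bsub>G\<^esub>"

definition commutator :: "('g, 'b) monoid_scheme \<Rightarrow> 'g \<Rightarrow> 'g \<Rightarrow> 'g" where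
  "commutator G a b = inv\<^bsub>G\<^esub> a \<otimes>\<^bsub>G\<^esub> inv\<^bsub>G\<^esub> b \<otimes>\<^bsub>G\<^esub> a \<otimes>\<^bsub>G\<^esub> b"

text \<open>D4_comm i j = Some (k, s) means [x_i(t), x_j(u)] = x_k(s t u); None means the commutator is 1.\<close>
definition D4_comm :: "nat \<Rightarrow> nat \<Rightarrow> (nat \<times> int) option" where
  "D4_comm i j = map_of
    [((1, 3), (5, 1)),
     ((1, 6), (8, -1)),
     ((1, 7), (9, 1)),
     ((1, 10), (11, -1)),
     ((2, 3), (6, 1)),
     ((2, 5), (8, -1)),
     ((2, 7), (10, 1)),
     ((2, 9), (11, -1)),
     ((3, 4), (7, 1)),
     ((3, 11), (12, -1)),
     ((4, 5), (9, -1)),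
     ((4, 6), (10, -1)),
     ((4, 8), (11, -1)),
     ((5, 10), (12, -1)),
     ((6, 9), (12, -1)),
     ((7, 8), (12, 1))]
    (i, j)"

text \<open>G with root elements x_1..x_12 over the finite field 'f is (a copy of) the Sylow p-subgroup U(q) of D4(q).\<close>
definition is_UD4 :: "('g, 'b) monoid_scheme \<Rightarrow> (nat \<Rightarrow> 'f::field \<Rightarrow> 'g) \<Rightarrow> bool" where
  "is_UD4 G x \<longleftrightarrow> group G \<and>
     (\<forall>i\<in>{1..12}. \<forall>t. x i t \<in> carrier G) \<and>
     (\<forall>i\<in>{1..12}. \<forall>t u. x i t \<otimes>\<^bsub>G\<^esub> x i u = x i (t + u)) \<and>
     (\<forall>i j t u. 1 \<le> i \<longrightarrow> i < j \<longrightarrow> j \<le> 12 \<longrightarrow>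
        commutator G (x i t) (x j u) =
          (case D4_comm i j of None \<Rightarrow> \<one>\<^bsub>G\<^esub>
                             | Some (k, s) \<Rightarrow> x k (of_int s * t * u))) \<and>
     bij_betw (\<lambda>ds. foldr (\<lambda>i acc. x i (ds ! (i - 1)) \<otimes>\<^bsub>G\<^esub> acc) [1..<13] \<one>\<^bsub>G\<^esub>)
              {ds. length ds = 12} (carrier G)"

definition Xr :: "(nat \<Rightarrow> 'f \<Rightarrow> 'g) \<Rightarrow> nat \<Rightarrow> 'g set" where
  "Xr x j = range (x j)"

definition in_ker :: "('g, 'b) monoid_scheme \<Rightarrow> (nat \<Rightarrow> 'f \<Rightarrow> 'g) \<Rightarrow> ('g \<Rightarrow> complex) \<Rightarrow> nat \<Rightarrow> bool" where
  "in_ker G x \<chi> j \<longleftrightarrow> Xr x j \<subseteq> char_ker G \<chi>"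

definition cls1 where "cls1 G x \<chi> \<longleftrightarrow> \<not> in_ker G x \<chi> 12"
definition cls2 where "cls2 G x \<chi> \<longleftrightarrow> in_ker G x \<chi> 12 \<and> \<not> in_ker G x \<chi> 11"
definition cls3 where "cls3 G x \<chi> \<longleftrightarrow>
   Xr x 11 <#>\<^bsub>G\<^esub> Xr x 12 \<subseteq> char_ker G \<chi> \<and>
   \<not> in_ker G x \<chi> 8 \<and> \<not> in_ker G x \<chi> 9 \<and> \<not> in_ker G x \<chi> 10"
definition cls4 where "cls4 G x \<chi> i j k \<longleftrightarrow>
   Xr x k <#>\<^bsub>G\<^esub> Xr x 11 <#>\<^bsub>G\<^esub> Xr x 12 \<subseteq> char_ker G \<chi> \<and>
   \<not> in_ker G x \<chi> i \<and> \<not> in_ker G x \<chi> j"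
definition cls5 where "cls5 G x \<chi> i \<longleftrightarrow>
   (\<forall>j\<in>{8..12} - {i}. in_ker G x \<chi> j) \<and> \<not> in_ker G x \<chi> i"
definition cls6 where "cls6 G x \<chi> \<longleftrightarrow>
   (\<forall>j\<in>{8..12}. in_ker G x \<chi> j) \<and>
   \<not> in_ker G x \<chi> 5 \<and> \<not> in_ker G x \<chi> 6 \<and> \<not> in_ker G x \<chi> 7"
definition cls7 where "cls7 G x \<chi> i j k \<longleftrightarrow>
   (\<forall>j'\<in>{k, 8, 9, 10, 11, 12}. in_ker G x \<chi> j') \<and>
   \<not> in_ker G x \<chi> i \<and> \<not> in_ker G x \<chi> j"
definition cls8 where "cls8 G x \<chi> i \<longleftrightarrow>
   (\<forall>j\<in>{5..12} - {i}. in_ker G x \<chi> j) \<and> \<not> in_ker G x \<chi> i"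
definition cls9 where "cls9 G x \<chi> \<longleftrightarrow> (\<forall>j\<in>{5..12}. in_ker G x \<chi> j)"

definition thm41_classes ::
  "('g, 'b) monoid_scheme \<Rightarrow> (nat \<Rightarrow> 'f \<Rightarrow> 'g) \<Rightarrow> (('g \<Rightarrow> complex) \<Rightarrow> bool) list" where
  "thm41_classes G x =
     [cls1 G x, cls2 G x, cls3 G x,
      (\<lambda>\<chi>. cls4 G x \<chi> 8 9 10), (\<lambda>\<chi>. cls4 G x \<chi> 8 10 9), (\<lambda>\<chi>. cls4 G x \<chi> 9 10 8),
      (\<lambda>\<chi>. cls5 G x \<chi> 8), (\<lambda>\<chi>. cls5 G x \<chi> 9), (\<lambda>\<chi>. cls5 G x \<chi> 10),
      cls6 G x,
      (\<lambda>\<chi>. cls7 G x \<chi> 5 6 7), (\<lambda>\<chi>. cls7 G x \<chi> 5 7 6), (\<lambda>\<chi>. cls7 G x \<chi> 6 7 5),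
      (\<lambda>\<chi>. cls8 G x \<chi> 5), (\<lambda>\<chi>. cls8 G x \<chi> 6), (\<lambda>\<chi>. cls8 G x \<chi> 7),
      cls9 G x]"

end

theory Submission
  imports Defs "HOL-Library.Product_Plus"
begin

text \<open>
  Every irreducible representation is induced from a linear character of a subgroup \<open>A\<close> which is the full
  stabiliser of its own restriction to a subgroup \<open>N \<subseteq> A\<close> normal in \<open>U\<close>. Under this condition the induced
  representation is irreducible, its character determines the linear character up to conjugacy, and an
  irreducible representation with a different character is annihilated by the averages of that linear
  character.

  Modulo \<open>X\<^sub>1\<^sub>2\<close> the group is a semidirect product of the abelian groups \<open>S = X\<^sub>1 X\<^sub>2 X\<^sub>4\<close> and
  \<open>V = X\<^sub>3 X\<^sub>5 \<dots> X\<^sub>1\<^sub>1\<close>, so its characters are given by pairs of an \<open>S\<close>-orbit of a character \<open>a\<close> of \<open>V\<close>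
  and a character of the stabiliser of \<open>a\<close>; there are \<open>|Q| m\<^sup>2 / |S|\<close> of them, all of degree \<open>|S| / m\<close>, over a
  union \<open>Q\<close> of orbits on which the stabiliser has order \<open>m\<close>. The remaining characters are induced from
  \<open>A = X\<^sub>1 X\<^sub>2 X\<^sub>4 X\<^sub>8 \<dots> X\<^sub>1\<^sub>2\<close> with \<open>N = X\<^sub>8 \<dots> X\<^sub>1\<^sub>2\<close>. No others exist: summing the averages over both
  families gives a nonzero multiple of the value at the identity. The dependence on the parity of \<open>q\<close>
  comes from the linear system for the stabiliser, whose determinant is \<open>2 a\<^sub>8 a\<^sub>9 a\<^sub>1\<^sub>0\<close>.
\<close>

section \<open>Schur's lemma\<close>

text \<open>The split at X_12 is forced by the commutators. Within V X_12 the only nontrivial ones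
  pair 3 with 11, 5 with 10, 6 with 9 and 7 with 8, and all of them land in X_12. Modulo X_12 they
  vanish, so V becomes abelian. A nontrivial character of X_12 turns them into a perfect pairing
  instead: V X_12 behaves like a Heisenberg group, and X_8 ... X_11 is a maximal isotropic half of
  it, whence the degree q^4. The count |Q| m^2 / |S| is the number |Q| m of linear characters (a
  choice of a and of a character of its stabiliser) divided by the orbit length |S| / m. For q even
  and a_8, a_9, a_10 nonzero, the linear system has a line of solutions. The remaining equation is
  quadratic on this line and leaves one or two points, whence the degrees q^3 and q^3/2; the 4 in
  the count is m^2 for m = 2. \<open>Irr\<close> consists of trace functions, so two representations
  count as one when their traces agree, and Schur's lemma is stated for traces.\<close>

lemma mat_trace_comm:
  assumes "A \<in> carrier_mat m n" "B \<in> carrier_mat n m"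
  shows "mat_trace (A * B) = mat_trace (B * A)"
proof -
  have "mat_trace (A * B) = (\<Sum>i<m. \<Sum>j<n. A $$ (i, j) * B $$ (j, i))"
    using assms by (simp add: mat_trace_def scalar_prod_def lessThan_atLeast0)
  also have "\<dots> = (\<Sum>j<n. \<Sum>i<m. B $$ (j, i) * A $$ (i, j))"
    by (subst sum.swap) (simp add: mult.commute)
  also have "\<dots> = mat_trace (B * A)"
    using assms by (simp add: mat_trace_def scalar_prod_def lessThan_atLeast0)
  finally show ?thesis .
qed

lemma mult_mat_vec_unit:
  fixes A :: "'a :: semiring_1 mat"
  assumes "A \<in> carrier_mat m n" "j < n"
  shows "A *\<^sub>v unit_vec n j = col A j"
  using assms by (intro eq_vecI) (auto simp: scalar_prod_right_unit)

text \<open>Kernel and image of \<open>T\<close> are invariant subspaces, so irreducibility on both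
  sides makes \<open>T\<close> bijective. Its inverse is built as a matrix, and cyclicity of the
  trace finishes. The sizes m and n are not assumed to be equal.\<close>

theorem schur_trace_eq:
  assumes \<sigma>: "irred_rep G n \<sigma>" and \<rho>: "irred_rep G m \<rho>"
    and T: "T \<in> carrier_mat m n" "T \<noteq> 0\<^sub>m m n"
    and inter: "\<And>g. g \<in> carrier G \<Longrightarrow> T * \<sigma> g = \<rho> g * T"
    and g: "g \<in> carrier G"
  shows "mat_trace (\<sigma> g) = mat_trace (\<rho> g)"
proof -
  have s: "\<sigma> h \<in> carrier_mat n n" and r: "\<rho> h \<in> carrier_mat m m" if "h \<in> carrier G" for h
    using \<sigma> \<rho> that by (auto simp: irred_rep_def is_rep_def)
  have comm: "T *\<^sub>v (\<sigma> h *\<^sub>v v) = \<rho> h *\<^sub>v (T *\<^sub>v v)" if "h \<in> carrier G" "v \<in> carrier_vec n" for h v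
    using that inter[OF that(1)]
      assoc_mult_mat_vec[OF T(1) s[OF that(1)] that(2)] assoc_mult_mat_vec[OF r[OF that(1)] T(1) that(2)]
    by simp
  define K where "K = {v \<in> carrier_vec n. T *\<^sub>v v = 0\<^sub>v m}"
  define R where "R = (\<lambda>v. T *\<^sub>v v) ` carrier_vec n"
  have r0: "\<rho> h *\<^sub>v 0\<^sub>v m = 0\<^sub>v m" if "h \<in> carrier G" for h
    using r[OF that] by (intro eq_vecI) auto
  have "invariant_subspace G n \<sigma> K"
    unfolding invariant_subspace_def K_def using T(1) comm s r r0
    by (auto simp: mult_add_distrib_mat_vec mult_mat_vec intro: mult_mat_vec_carrier)
  then have K: "K = {0\<^sub>v n} \<or> K = carrier_vec n" using \<sigma> by (simp add: irred_rep_def)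
  have "invariant_subspace G m \<rho> R"
    unfolding invariant_subspace_def
  proof (intro conjI ballI allI)
    show "R \<subseteq> carrier_vec m" using T(1) by (auto simp: R_def)
    show "0\<^sub>v m \<in> R" unfolding R_def using T(1) by (intro image_eqI[of _ _ "0\<^sub>v n"]) auto
  next
    fix v w assume "v \<in> R" "w \<in> R"
    then obtain v' w' where "v' \<in> carrier_vec n" "w' \<in> carrier_vec n" "v = T *\<^sub>v v'" "w = T *\<^sub>v w'"
      by (auto simp: R_def)
    then show "v + w \<in> R" unfolding R_def using T(1)
      by (intro image_eqI[of _ _ "v' + w'"]) (auto simp: mult_add_distrib_mat_vec)
  next
    fix c v assume "v \<in> R"
    then obtain v' where "v' \<in> carrier_vec n" "v = T *\<^sub>v v'" by (auto simp: R_def)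
    then show "c \<cdot>\<^sub>v v \<in> R" unfolding R_def using T(1)
      by (intro image_eqI[of _ _ "c \<cdot>\<^sub>v v'"]) (auto simp: mult_mat_vec)
  next
    fix h v assume h: "h \<in> carrier G" and "v \<in> R"
    then obtain v' where "v' \<in> carrier_vec n" "v = T *\<^sub>v v'" by (auto simp: R_def)
    then show "\<rho> h *\<^sub>v v \<in> R" unfolding R_def using s[OF h] comm[OF h]
      by (intro image_eqI[of _ _ "\<sigma> h *\<^sub>v v'"]) auto
  qed
  then have R: "R = {0\<^sub>v m} \<or> R = carrier_vec m" using \<rho> by (simp add: irred_rep_def)
  have "\<exists>i j. i < m \<and> j < n \<and> T $$ (i, j) \<noteq> 0"
  proof (rule ccontr)
    assume "\<not> ?thesis"
    then have "T = 0\<^sub>m m n" using T(1) by (intro eq_matI) auto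
    then show False using T(2) by simp
  qed
  then obtain i j where ij: "i < m" "j < n" "T $$ (i, j) \<noteq> 0" by blast
  have nz: "T *\<^sub>v unit_vec n j \<noteq> 0\<^sub>v m"
  proof
    assume "T *\<^sub>v unit_vec n j = 0\<^sub>v m"
    then have "col T j $ i = 0" using mult_mat_vec_unit[OF T(1) ij(2)] ij by simp
    then show False using ij T(1) by simp
  qed
  have "unit_vec n j \<notin> K" using nz by (simp add: K_def)
  then have "K \<noteq> carrier_vec n" by (metis unit_vec_carrier)
  with K have inj: "v = 0\<^sub>v n" if "v \<in> carrier_vec n" "T *\<^sub>v v = 0\<^sub>v m" for v
    using that unfolding K_def by blast
  have "T *\<^sub>v unit_vec n j \<in> R" unfolding R_def by (rule imageI) simp
  then have "R \<noteq> {0\<^sub>v m}" using nz by (metis singletonD)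
  with R have Rall: "R = carrier_vec m" by simp
  have "\<exists>v. v \<in> carrier_vec n \<and> T *\<^sub>v v = unit_vec m k" for k
  proof -
    have "unit_vec m k \<in> R" using Rall by simp
    then show ?thesis unfolding R_def by (metis imageE)
  qed
  \<comment> \<open>\<open>f k\<close> is a preimage of the k-th unit vector; these vectors become
    the columns of a right inverse.\<close>
  then obtain f where f: "\<And>k. f k \<in> carrier_vec n" "\<And>k. T *\<^sub>v f k = unit_vec m k" by metis
  define B where "B = mat n m (\<lambda>(a, k). f k $ a)"
  have B: "B \<in> carrier_mat n m" by (simp add: B_def)
  have colB: "col B k = f k" if "k < m" for k
    using f(1)[of k] that unfolding B_def by (intro eq_vecI) auto
  have TB: "T * B = 1\<^sub>m m"
  proof (intro eq_matI)
    fix a k assume "a < dim_row (1\<^sub>m m :: complex mat)" "k < dim_col (1\<^sub>m m :: complex mat)"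
    then have ak: "a < m" "k < m" by auto
    have "(T * B) $$ (a, k) = (T *\<^sub>v col B k) $ a" using ak T(1) B by simp
    also have "\<dots> = 1\<^sub>m m $$ (a, k)" using ak by (simp add: colB f(2))
    finally show "(T * B) $$ (a, k) = 1\<^sub>m m $$ (a, k)" .
  qed (use T(1) B in auto)
  \<comment> \<open>Injectivity turns the right inverse into a left one: \<open>T\<close> sends the
    difference between a column of \<open>B * T\<close> and the unit vector to zero.\<close>
  have BT: "B * T = 1\<^sub>m n"
  proof -
    have BTc: "B * T \<in> carrier_mat n n" using B T(1) by simp
    have "col (B * T) k = unit_vec n k" if k: "k < n" for k
    proof -
      let ?w = "col (B * T) k - unit_vec n k"
      have c: "col (B * T) k \<in> carrier_vec n" using BTc k by (simp add: carrier_vecI)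
      have "T *\<^sub>v col (B * T) k = col (T * (B * T)) k"
        using col_mult2[OF T(1) BTc k] by simp
      also have "T * (B * T) = T" using assoc_mult_mat[OF T(1) B T(1)] TB T(1) by simp
      finally have "T *\<^sub>v ?w = 0\<^sub>v m"
        using T(1) k c by (auto simp: mult_minus_distrib_mat_vec mult_mat_vec_unit intro!: eq_vecI)
      then have "?w = 0\<^sub>v n" by (intro inj) (use c in auto)
      then show ?thesis
      proof (intro eq_vecI)
        fix i assume "i < dim_vec (unit_vec n k :: complex vec)"
        then have i: "i < n" by simp
        then have "?w $ i = 0" using \<open>?w = 0\<^sub>v n\<close> by simp
        moreover have "?w $ i = col (B * T) k $ i - unit_vec n k $ i"
          using i by (intro index_minus_vec) simp
        ultimately show "col (B * T) k $ i = unit_vec n k $ i" by (metis eq_iff_diff_eq_0)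
      qed (use B in simp)
    qed
    then show ?thesis using BTc by (intro mat_col_eqI) auto
  qed
  have "mat_trace (\<sigma> g) = mat_trace (B * T * \<sigma> g)" using BT s[OF g] by simp
  also have "\<dots> = mat_trace (B * (\<rho> g * T))" using inter[OF g] assoc_mult_mat[OF B T(1) s[OF g]] by simp
  also have "\<dots> = mat_trace (\<rho> g * T * B)"
    using B T(1) r[OF g] by (intro mat_trace_comm) auto
  also have "\<dots> = mat_trace (\<rho> g)" using assoc_mult_mat[OF r[OF g] T(1) B] r[OF g] TB by simp
  finally show ?thesis .
qed

section \<open>Induction of linear characters\<close>

text \<open>Frobenius' formula. \<open>L\<close> carries its subgroup along as its support, so the
  order of the support is the normalising factor.\<close>

definition ind_char :: "('g, 'b) monoid_scheme \<Rightarrow> ('g \<Rightarrow> complex) \<Rightarrow> 'g \<Rightarrow> complex" where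
  "ind_char G L x = (if x \<in> carrier G then
     (\<Sum>g\<in>carrier G. L (g \<otimes>\<^bsub>G\<^esub> x \<otimes>\<^bsub>G\<^esub> inv\<^bsub>G\<^esub> g)) / of_nat (card {g \<in> carrier G. L g \<noteq> 0}) else 0)"

text \<open>The invariance argument behind the orthogonality relations below: reindexing multiplies
  the sum by a factor other than 1.\<close>

lemma sum_eq_0_if_scaled:
  fixes f :: "'a \<Rightarrow> complex"
  assumes "bij_betw h A A" "\<And>x. x \<in> A \<Longrightarrow> f (h x) = c * f x" "c \<noteq> 1"
  shows "sum f A = 0"
proof -
  have "sum f A = (\<Sum>x\<in>A. f (h x))" using sum.reindex_bij_betw[OF assms(1), of f] by simp
  also have "\<dots> = c * sum f A" using assms(2) by (simp add: sum_distrib_left)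
  finally show ?thesis using assms(3) by (simp add: algebra_simps)
qed

text \<open>\<open>L\<close> is a linear character of the subgroup \<open>A\<close>, extended by zero.\<close>

locale mono_datum = group G for G (structure) +
  fixes N :: "'a set" and L :: "'a \<Rightarrow> complex"
  assumes fin: "finite (carrier G)"
    and nrm: "N \<lhd> G"
    and L_mult: "\<lbrakk>g \<in> carrier G; h \<in> carrier G; L g \<noteq> 0; L h \<noteq> 0\<rbrakk> \<Longrightarrow> L (g \<otimes> h) = L g * L h"
    and L_inv: "\<lbrakk>g \<in> carrier G; L g \<noteq> 0\<rbrakk> \<Longrightarrow> L (inv g) = cnj (L g)"
    and N_supp: "n \<in> N \<Longrightarrow> L n \<noteq> 0"
    and stab: "\<lbrakk>g \<in> carrier G; \<And>n. n \<in> N \<Longrightarrow> L (g \<otimes> n \<otimes> inv g) = L n\<rbrakk> \<Longrightarrow> L g \<noteq> 0"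
begin

abbreviation A where "A \<equiv> {g \<in> carrier G. L g \<noteq> 0}"

lemma N_subgroup: "subgroup N G"
  by (rule normal_imp_subgroup[OF nrm])

lemma N_sub: "n \<in> N \<Longrightarrow> n \<in> carrier G"
  by (rule subgroup.mem_carrier[OF N_subgroup])

lemma N_conj: "\<lbrakk>n \<in> N; g \<in> carrier G\<rbrakk> \<Longrightarrow> g \<otimes> n \<otimes> inv g \<in> N"
  by (rule normal.inv_op_closed2[OF nrm])

lemma N_mult: "\<lbrakk>n \<in> N; m \<in> N\<rbrakk> \<Longrightarrow> n \<otimes> m \<in> N"
  by (rule subgroup.m_closed[OF N_subgroup])

lemma finN: "finite N" using finite_subset[OF _ fin] N_sub by blast

lemma one_N: "\<one> \<in> N" by (rule subgroup.one_closed[OF N_subgroup])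

lemma N_pos: "card N > 0" using finN one_N by (auto simp: card_gt_0_iff)

lemma L_one: "L \<one> = 1"
proof -
  have "L \<one> * L \<one> = L \<one>" "L \<one> \<noteq> 0" using L_mult[of \<one> \<one>] N_supp[OF one_N] by auto
  then show ?thesis by simp
qed

lemma L_cnj: "\<lbrakk>g \<in> carrier G; L g \<noteq> 0\<rbrakk> \<Longrightarrow> L g * cnj (L g) = 1"
  using L_mult[of g "inv g"] L_inv[of g] L_one by (auto simp: r_inv)

lemma L_norm: "\<lbrakk>g \<in> carrier G; L g \<noteq> 0\<rbrakk> \<Longrightarrow> norm (L g) = 1"
  using L_cnj[of g] by (metis complex_mod_cnj norm_mult norm_one real_sqrt_abs real_sqrt_mult_self
      abs_norm_cancel power2_eq_square real_sqrt_eq_1_iff)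

lemma A_subgroup: "subgroup A G"
proof (rule subgroupI)
  show "A \<noteq> {}" using L_one by auto
  show "inv a \<in> A" if "a \<in> A" for a using that L_inv[of a] by auto
  show "a \<otimes> b \<in> A" if "a \<in> A" "b \<in> A" for a b using that L_mult[of a b] by auto
qed auto

text \<open>Multiplicativity survives when g is outside \<open>A\<close>: then a g is outside
  \<open>A\<close> as well, because \<open>A\<close> is a subgroup, and both sides are zero.\<close>

lemma L_left: "\<lbrakk>a \<in> A; g \<in> carrier G\<rbrakk> \<Longrightarrow> L (a \<otimes> g) = L a * L g"
proof (cases "L g = 0")
  case True
  assume a: "a \<in> A" "g \<in> carrier G"
  have "L (a \<otimes> g) = 0"
  proof (rule ccontr)
    assume "L (a \<otimes> g) \<noteq> 0"
    then have "L (inv a \<otimes> (a \<otimes> g)) = L (inv a) * L (a \<otimes> g)" using a L_inv[of a] by (intro L_mult) auto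
    then have "L g \<noteq> 0" using a \<open>L (a \<otimes> g) \<noteq> 0\<close> L_inv[of a] by (auto simp: m_assoc[symmetric])
    with True show False by simp
  qed
  with True show ?thesis by simp
qed (use L_mult in auto)

lemma L_inv_all: "g \<in> carrier G \<Longrightarrow> L (inv g) = cnj (L g)"
  using L_inv[of g] L_inv[of "inv g"] by (cases "L g = 0"; cases "L (inv g) = 0") auto

lemma L_right:
  assumes "a \<in> A" "g \<in> carrier G"
  shows "L (g \<otimes> a) = L g * L a"
proof -
  have "L (inv a \<otimes> inv g) = L (inv a) * L (inv g)" using assms L_inv[of a] by (intro L_left) auto
  then have "cnj (L (g \<otimes> a)) = cnj (L g * L a)"
    using assms L_inv_all[of "g \<otimes> a"] by (simp add: inv_mult_group L_inv_all mult.commute)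
  then show ?thesis by (simp only: complex_cnj_cancel_iff)
qed

lemma L_conj: "\<lbrakk>a \<in> A; g \<in> carrier G\<rbrakk> \<Longrightarrow> L (a \<otimes> g \<otimes> inv a) = L g"
  using L_left[of a "g"] L_right[of "inv a" "a \<otimes> g"] L_inv[of a] L_cnj[of a] by auto

lemma A_pos: "card A > 0"
  using fin L_one by (auto simp: card_gt_0_iff intro!: exI[of _ \<one>])

lemma L_N_mult: "\<lbrakk>n \<in> N; k \<in> N\<rbrakk> \<Longrightarrow> L (n \<otimes> k) = L n * L k"
  using N_supp by (intro L_mult) (auto dest: N_sub)

lemma L_conj_N_mult:
  assumes "u \<in> carrier G" "m \<in> N" "k \<in> N"
  shows "L (u \<otimes> (m \<otimes> k) \<otimes> inv u) = L (u \<otimes> m \<otimes> inv u) * L (u \<otimes> k \<otimes> inv u)"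
proof -
  have c: "m \<in> carrier G" "k \<in> carrier G" using assms N_sub by auto
  have "u \<otimes> (m \<otimes> k) \<otimes> inv u = (u \<otimes> m \<otimes> inv u) \<otimes> (u \<otimes> k \<otimes> inv u)"
    using assms(1) c by (simp add: m_assoc) (simp add: m_assoc[symmetric])
  then show ?thesis using L_N_mult[OF N_conj[OF assms(2,1)] N_conj[OF assms(3,1)]] by simp
qed

lemma L_N_cnj: "n \<in> N \<Longrightarrow> L n * cnj (L n) = 1"
  using L_cnj N_supp N_sub by simp

lemma L_conj_cong:
  assumes "s \<in> carrier G" "t \<in> carrier G" "g \<in> carrier G" "L (s \<otimes> inv t) \<noteq> 0"
  shows "L (s \<otimes> g \<otimes> inv s) = L (t \<otimes> g \<otimes> inv t)"
proof -
  have "s \<otimes> g \<otimes> inv s = (s \<otimes> inv t) \<otimes> (t \<otimes> g \<otimes> inv t) \<otimes> inv (s \<otimes> inv t)"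
    using assms(1-3) by (simp add: inv_mult_group m_assoc) (simp add: m_assoc[symmetric])
  then show ?thesis using L_conj[of "s \<otimes> inv t" "t \<otimes> g \<otimes> inv t"] assms by auto
qed

text \<open>Applied to s t^-1, the assumption \<open>stab\<close> says that restriction to
  \<open>N\<close> separates the right cosets of \<open>A\<close>. Irreducibility and the counting
  of conjugates both rest on this.\<close>

lemma conj_eq_on_N_iff:
  assumes s: "s \<in> carrier G" and t: "t \<in> carrier G"
  shows "(\<forall>n\<in>N. L (s \<otimes> n \<otimes> inv s) = L (t \<otimes> n \<otimes> inv t)) \<longleftrightarrow> L (s \<otimes> inv t) \<noteq> 0"
proof
  assume nz: "L (s \<otimes> inv t) \<noteq> 0"
  show "\<forall>n\<in>N. L (s \<otimes> n \<otimes> inv s) = L (t \<otimes> n \<otimes> inv t)"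
    using L_conj_cong[OF s t N_sub nz] by blast
next
  assume eq: "\<forall>n\<in>N. L (s \<otimes> n \<otimes> inv s) = L (t \<otimes> n \<otimes> inv t)"
  show "L (s \<otimes> inv t) \<noteq> 0"
  proof (rule stab)
    fix n assume n: "n \<in> N"
    then have nc: "n \<in> carrier G" using N_sub by simp
    let ?m = "inv t \<otimes> n \<otimes> t"
    have m: "?m \<in> N" using N_conj[OF n, of "inv t"] t by simp
    have "t \<otimes> ?m \<otimes> inv t = n"
      using t nc by (simp add: m_assoc) (simp add: m_assoc[symmetric])
    moreover have "s \<otimes> ?m \<otimes> inv s = (s \<otimes> inv t) \<otimes> n \<otimes> inv (s \<otimes> inv t)"
      using s t nc by (simp add: inv_mult_group m_assoc)
    ultimately show "L ((s \<otimes> inv t) \<otimes> n \<otimes> inv (s \<otimes> inv t)) = L n" using eq m by metis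
  qed (use s t in simp)
qed

text \<open>The summand is multiplicative in n, hence a linear character of \<open>N\<close>; one
  value other than 1 makes the sum vanish.\<close>

lemma N_orth:
  assumes mult: "\<And>n k. \<lbrakk>n \<in> N; k \<in> N\<rbrakk> \<Longrightarrow> \<theta> (n \<otimes> k) = \<theta> n * \<theta> k"
    and unit: "\<And>n. n \<in> N \<Longrightarrow> \<theta> n * cnj (\<theta> n) = 1" and t: "t \<in> carrier G"
  shows "(\<Sum>n\<in>N. cnj (\<theta> n) * L (t \<otimes> n \<otimes> inv t)) =
    (if \<forall>n\<in>N. L (t \<otimes> n \<otimes> inv t) = \<theta> n then of_nat (card N) else 0)"
proof (cases "\<forall>n\<in>N. L (t \<otimes> n \<otimes> inv t) = \<theta> n")
  case True
  then show ?thesis using unit by (simp add: mult.commute)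
next
  case False
  then obtain m where m: "m \<in> N" "L (t \<otimes> m \<otimes> inv t) \<noteq> \<theta> m" by blast
  have mc: "m \<in> carrier G" using m N_sub by simp
  let ?f = "\<lambda>n. cnj (\<theta> n) * L (t \<otimes> n \<otimes> inv t)"
  have "sum ?f N = 0"
  proof (rule sum_eq_0_if_scaled)
    show "bij_betw (\<lambda>k. m \<otimes> k) N N"
    proof (rule bij_betw_byWitness[where f' = "\<lambda>k. inv m \<otimes> k"])
      have "inv m \<in> N" by (rule subgroup.m_inv_closed[OF N_subgroup m(1)])
      then show "(\<lambda>k. m \<otimes> k) ` N \<subseteq> N" "(\<lambda>k. inv m \<otimes> k) ` N \<subseteq> N" using m N_mult by auto
    qed (use mc N_sub in \<open>auto simp: m_assoc[symmetric]\<close>)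
    show "?f (m \<otimes> k) = ?f m * ?f k" if "k \<in> N" for k
      using that t m by (simp add: L_conj_N_mult mult)
    show "?f m \<noteq> 1"
    proof
      assume "?f m = 1"
      then have "\<theta> m * (cnj (\<theta> m) * L (t \<otimes> m \<otimes> inv t)) = \<theta> m" by simp
      then have "(\<theta> m * cnj (\<theta> m)) * L (t \<otimes> m \<otimes> inv t) = \<theta> m" by (simp only: mult.assoc)
      then show False using m unit[OF m(1)] by simp
    qed
  qed
  then show ?thesis unfolding if_not_P[OF False] .
qed

text \<open>The representatives are numbered by an initial segment of the naturals because they
  become row and column indices of a matrix.\<close>

lemma transversal:
  obtains m :: nat and s :: "nat \<Rightarrow> 'a" where
    "\<And>i. i < m \<Longrightarrow> s i \<in> carrier G"
    "\<And>g. g \<in> carrier G \<Longrightarrow> \<exists>i<m. L (g \<otimes> inv (s i)) \<noteq> 0"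
    "\<And>i j. \<lbrakk>i < m; j < m; L (s i \<otimes> inv (s j)) \<noteq> 0\<rbrakk> \<Longrightarrow> i = j"
    "m * card A = card (carrier G)"
proof -
  have finR: "finite (rcosets A)"
    by (rule finite_subset[OF rcosets_subset_PowG[OF A_subgroup]]) (simp add: fin)
  obtain c where c: "bij_betw c {0..<card (rcosets A)} (rcosets A)"
    using ex_bij_betw_nat_finite[OF finR] by (elim exE)
  define s where "s i = (SOME g. g \<in> carrier G \<and> c i = A #> g)" for i
  have s: "s i \<in> carrier G \<and> c i = A #> s i" if "i < card (rcosets A)" for i
  proof -
    have "c i \<in> rcosets A" using bij_betwE[OF c] that by simp
    then have "\<exists>g. g \<in> carrier G \<and> c i = A #> g" by (auto simp: RCOSETS_def)
    then show ?thesis unfolding s_def by (rule someI_ex)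
  qed
  have eq: "A #> g = A #> h \<longleftrightarrow> L (g \<otimes> inv h) \<noteq> 0" if "g \<in> carrier G" "h \<in> carrier G" for g h
  proof
    assume "A #> g = A #> h"
    then have "g \<in> A #> h" using rcos_self[OF that(1) A_subgroup] by simp
    then obtain a where "a \<in> A" "g = a \<otimes> h" by (auto simp: r_coset_def)
    then show "L (g \<otimes> inv h) \<noteq> 0" using that by (auto simp: m_assoc)
  next
    assume "L (g \<otimes> inv h) \<noteq> 0"
    then have "g \<otimes> inv h \<in> A" using that by simp
    then have "(g \<otimes> inv h) \<otimes> h \<in> A #> h" by (auto simp only: r_coset_def)
    then have "g \<in> A #> h" using that by (simp add: m_assoc)
    then show "A #> g = A #> h" using repr_independence[OF _ that(2) A_subgroup] by simp
  qed
  show thesis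
  proof
    show "s i \<in> carrier G" if "i < card (rcosets A)" for i using s that by simp
    show "\<exists>i<card (rcosets A). L (g \<otimes> inv (s i)) \<noteq> 0" if g: "g \<in> carrier G" for g
    proof -
      have "A #> g \<in> rcosets A" using g by (auto simp: RCOSETS_def)
      then have "A #> g \<in> c ` {0..<card (rcosets A)}" using bij_betw_imp_surj_on[OF c] by simp
      then obtain i where i: "i < card (rcosets A)" "c i = A #> g" by force
      then have "A #> g = A #> s i" using s[OF i(1)] by simp
      then show ?thesis using eq[OF g] s[OF i(1)] i(1) by auto
    qed
    show "i = j" if "i < card (rcosets A)" "j < card (rcosets A)" "L (s i \<otimes> inv (s j)) \<noteq> 0" for i j
    proof -
      have "c i = c j" using that(3) s[OF that(1)] s[OF that(2)] eq[of "s i" "s j"] by simp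
      then show ?thesis using c that by (auto simp: bij_betw_def inj_on_def)
    qed
    show "card (rcosets A) * card A = card (carrier G)"
      using lagrange[OF A_subgroup] by (simp add: order_def)
  qed
qed

end

text \<open>Equality case of the triangle inequality: the real parts are at most 1 and average to 1,
  so each of them is 1 and leaves no room for an imaginary part.\<close>

lemma all_eq_1_if_sum_eq_card:
  fixes f :: "'a \<Rightarrow> complex"
  assumes "finite S" "\<And>x. x \<in> S \<Longrightarrow> norm (f x) \<le> 1" "sum f S = of_nat (card S)" "x \<in> S"
  shows "f x = 1"
proof -
  have le: "Re (f y) \<le> 1" if "y \<in> S" for y
    using assms(2)[OF that] complex_Re_le_cmod[of "f y"] by linarith
  have "(\<Sum>y\<in>S. 1 - Re (f y)) = 0"
    using arg_cong[OF assms(3), of Re] by (simp add: sum_subtractf)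
  then have "1 - Re (f x) = 0"
    using sum_nonneg_0[OF assms(1), of "\<lambda>y. 1 - Re (f y)" x] le assms(4) by simp
  then have re: "Re (f x) = 1" by simp
  have "(Re (f x))\<^sup>2 + (Im (f x))\<^sup>2 \<le> 1"
    using assms(2)[OF assms(4)] by (metis cmod_power2 norm_ge_zero one_power2 power_mono)
  then have "Im (f x) = 0" using re by simp
  with re show ?thesis by (simp add: complex_eq_iff)
qed

text \<open>An invariant subspace is stable under the whole group algebra; \<open>R_irred\<close>
  applies averages over \<open>N\<close> and sums of translates to a vector in this way.\<close>

lemma invariant_subspace_sum:
  assumes W: "invariant_subspace G n \<rho> W" and w: "w \<in> W"
    and "finite I" "\<And>i. i \<in> I \<Longrightarrow> g i \<in> carrier G"
    and \<rho>: "\<And>x. x \<in> carrier G \<Longrightarrow> \<rho> x \<in> carrier_mat n n"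
  shows "vec n (\<lambda>k. \<Sum>i\<in>I. c i * (\<rho> (g i) *\<^sub>v w) $ k) \<in> W"
  using assms(3,4)
proof (induction I rule: finite_induct)
  case empty
  have "vec n (\<lambda>k. 0) = (0\<^sub>v n :: complex vec)" by (intro eq_vecI) auto
  then show ?case using W by (simp add: invariant_subspace_def)
next
  case (insert i I)
  let ?v = "vec n (\<lambda>k. \<Sum>i\<in>I. c i * (\<rho> (g i) *\<^sub>v w) $ k)"
  have gi: "g i \<in> carrier G" and v: "?v \<in> W" using insert by auto
  have "c i \<cdot>\<^sub>v (\<rho> (g i) *\<^sub>v w) + ?v \<in> W" using W w gi v by (simp add: invariant_subspace_def)
  moreover have "c i \<cdot>\<^sub>v (\<rho> (g i) *\<^sub>v w) + ?v = vec n (\<lambda>k. \<Sum>i\<in>insert i I. c i * (\<rho> (g i) *\<^sub>v w) $ k)"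
    using insert.hyps \<rho>[OF gi] by (intro eq_vecI) auto
  ultimately show ?case by simp
qed

lemma ind_char_cong:
  assumes "group G" "\<And>g. g \<in> carrier G \<Longrightarrow> L g = L' g"
  shows "ind_char G L = ind_char G L'"
proof
  fix x
  interpret group G by fact
  have "{g \<in> carrier G. L g \<noteq> 0} = {g \<in> carrier G. L' g \<noteq> 0}" using assms(2) by auto
  then show "ind_char G L x = ind_char G L' x"
    unfolding ind_char_def using assms(2) by (simp cong: sum.cong)
qed

section \<open>Kernel, conjugates and fibres of the induced character\<close>

context mono_datum
begin

lemma L_norm_le: "g \<in> carrier G \<Longrightarrow> norm (L g) \<le> 1"
  using L_norm[of g] by (cases "L g = 0") auto

lemma A_nz: "of_nat (card A) \<noteq> (0 :: complex)"
  using A_pos by (simp only: of_nat_eq_0_iff)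

lemma ind_char_eq: "x \<in> carrier G \<Longrightarrow>
    of_nat (card A) * ind_char G L x = (\<Sum>g\<in>carrier G. L (g \<otimes> x \<otimes> inv g))"
  by (simp only: ind_char_def if_True nonzero_mult_div_cancel_left[OF A_nz] times_divide_eq_right)

lemma ind_char_one: "ind_char G L \<one> = of_nat (card (carrier G)) / of_nat (card A)"
  by (simp add: ind_char_def L_one)

text \<open>The defining sum has |G| terms of norm at most 1, so it reaches the value at the
  identity only if each term is 1. Kernel conditions thereby become conditions on
  \<open>L\<close>.\<close>

lemma ind_char_eq_one_iff:
  assumes z: "z \<in> carrier G"
  shows "ind_char G L z = ind_char G L \<one> \<longleftrightarrow> (\<forall>g\<in>carrier G. L (g \<otimes> z \<otimes> inv g) = 1)"
proof
  assume "ind_char G L z = ind_char G L \<one>"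
  then have "(\<Sum>g\<in>carrier G. L (g \<otimes> z \<otimes> inv g)) = of_nat (card (carrier G))"
    using ind_char_eq[OF z] ind_char_eq[OF one_closed] by (simp add: L_one)
  from all_eq_1_if_sum_eq_card[OF fin _ this] show "\<forall>g\<in>carrier G. L (g \<otimes> z \<otimes> inv g) = 1"
    using L_norm_le z by simp
qed (use z in \<open>simp add: ind_char_def L_one\<close>)

text \<open>The projection to the \<open>L\<close>-isotypic part for \<open>N\<close> has rank one, hence its trace against \<open>a\<close> recovers \<open>L\<close>.\<close>

lemma recover_L:
  assumes a: "a \<in> carrier G"
  shows "(\<Sum>n\<in>N. cnj (L n) * ind_char G L (n \<otimes> a)) = of_nat (card N) * L a"
proof -
  have step: "L (g \<otimes> (n \<otimes> a) \<otimes> inv g) = L (g \<otimes> n \<otimes> inv g) * L (g \<otimes> a \<otimes> inv g)"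
    if g: "g \<in> carrier G" and n: "n \<in> N" for g n
  proof -
    have nc: "n \<in> carrier G" using n N_sub by simp
    have "g \<otimes> (n \<otimes> a) \<otimes> inv g = (g \<otimes> n \<otimes> inv g) \<otimes> (g \<otimes> a \<otimes> inv g)"
      using g nc a by (simp add: m_assoc) (simp add: m_assoc[symmetric])
    then show ?thesis using L_left[of "g \<otimes> n \<otimes> inv g" "g \<otimes> a \<otimes> inv g"] N_supp N_conj[OF n g] g a nc by auto
  qed
  have inner: "(\<Sum>n\<in>N. cnj (L n) * L (g \<otimes> n \<otimes> inv g)) = (if L g \<noteq> 0 then of_nat (card N) else 0)"
    if g: "g \<in> carrier G" for g
  proof -
    have "(\<forall>n\<in>N. L (g \<otimes> n \<otimes> inv g) = L n) \<longleftrightarrow> L g \<noteq> 0"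
      using conj_eq_on_N_iff[OF g one_closed] g N_sub by (auto simp: r_one)
    then show ?thesis using N_orth[of L g] L_N_mult L_N_cnj g by simp
  qed
  have "of_nat (card A) * (\<Sum>n\<in>N. cnj (L n) * ind_char G L (n \<otimes> a)) =
    (\<Sum>n\<in>N. cnj (L n) * (\<Sum>g\<in>carrier G. L (g \<otimes> (n \<otimes> a) \<otimes> inv g)))"
    using a N_sub by (simp only: sum_distrib_left[where r = "of_nat (card A)"] mult.left_commute[of "of_nat (card A)"]
        ind_char_eq m_closed cong: sum.cong)
  also have "\<dots> = (\<Sum>n\<in>N. \<Sum>g\<in>carrier G. L (g \<otimes> a \<otimes> inv g) * (cnj (L n) * L (g \<otimes> n \<otimes> inv g)))"
    by (simp add: sum_distrib_left step ac_simps)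
  also have "\<dots> = (\<Sum>g\<in>carrier G. L (g \<otimes> a \<otimes> inv g) * (\<Sum>n\<in>N. cnj (L n) * L (g \<otimes> n \<otimes> inv g)))"
    by (subst sum.swap) (simp add: sum_distrib_left)
  also have "\<dots> = (\<Sum>g\<in>carrier G. if L g \<noteq> 0 then of_nat (card N) * L a else 0)"
    using inner L_conj a by (intro sum.cong) auto
  also have "\<dots> = of_nat (card A) * (of_nat (card N) * L a)"
    using fin by (simp add: sum.inter_filter[symmetric])
  finally show ?thesis using A_nz mult_left_cancel by blast
qed

text \<open>The averages in \<open>recover_L\<close> see only the induced character and the
  restriction to \<open>N\<close>, and they return \<open>L\<close>.\<close>

lemma eq_if_ind_char_eq:
  assumes "mono_datum G N L'" "ind_char G L = ind_char G L'" "\<And>n. n \<in> N \<Longrightarrow> L n = L' n" "a \<in> carrier G"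
  shows "L a = L' a"
proof -
  interpret L': mono_datum G N L' by fact
  have "(\<Sum>n\<in>N. cnj (L n) * ind_char G L (n \<otimes> a)) = (\<Sum>n\<in>N. cnj (L' n) * ind_char G L' (n \<otimes> a))"
    by (rule sum.cong) (simp_all only: assms(2,3))
  then have "of_nat (card N) * L a = of_nat (card N) * L' a"
    by (simp only: recover_L[OF assms(4)] L'.recover_L[OF assms(4)])
  then show ?thesis using N_pos by simp
qed

lemma conj_bij: "s \<in> carrier G \<Longrightarrow> bij_betw (\<lambda>g. s \<otimes> g \<otimes> inv s) (carrier G) (carrier G)"
  by (rule bij_betw_byWitness[where f' = "\<lambda>g. inv s \<otimes> g \<otimes> s"])
    (auto simp: m_assoc, auto simp: m_assoc[symmetric])

lemma conj_mult: "\<lbrakk>s \<in> carrier G; g \<in> carrier G; h \<in> carrier G\<rbrakk> \<Longrightarrow>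
    s \<otimes> (g \<otimes> h) \<otimes> inv s = (s \<otimes> g \<otimes> inv s) \<otimes> (s \<otimes> h \<otimes> inv s)"
  by (simp add: m_assoc) (simp add: m_assoc[symmetric])

lemma mono_datum_conj:
  assumes s: "s \<in> carrier G"
  shows "mono_datum G N (\<lambda>g. L (s \<otimes> g \<otimes> inv s))"
proof (intro mono_datum.intro mono_datum_axioms.intro)
  show "group G" by (rule is_group)
  show "finite (carrier G)" by (rule fin)
  show "N \<lhd> G" by (rule nrm)
next
  fix g h assume "g \<in> carrier G" "h \<in> carrier G" "L (s \<otimes> g \<otimes> inv s) \<noteq> 0" "L (s \<otimes> h \<otimes> inv s) \<noteq> 0"
  then show "L (s \<otimes> (g \<otimes> h) \<otimes> inv s) = L (s \<otimes> g \<otimes> inv s) * L (s \<otimes> h \<otimes> inv s)"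
    using s by (simp add: conj_mult L_mult)
next
  fix g assume g: "g \<in> carrier G"
  have "inv (s \<otimes> g \<otimes> inv s) = s \<otimes> inv g \<otimes> inv s" using s g by (simp add: inv_mult_group m_assoc)
  then show "L (s \<otimes> inv g \<otimes> inv s) = cnj (L (s \<otimes> g \<otimes> inv s))"
    using L_inv_all[of "s \<otimes> g \<otimes> inv s"] s g by simp
next
  fix n assume "n \<in> N"
  then show "L (s \<otimes> n \<otimes> inv s) \<noteq> 0" using N_supp N_conj s by simp
next
  fix g assume g: "g \<in> carrier G"
    and st: "\<And>n. n \<in> N \<Longrightarrow> L (s \<otimes> (g \<otimes> n \<otimes> inv g) \<otimes> inv s) = L (s \<otimes> n \<otimes> inv s)"
  have "\<forall>n\<in>N. L ((s \<otimes> g) \<otimes> n \<otimes> inv (s \<otimes> g)) = L (s \<otimes> n \<otimes> inv s)"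
    using st s g N_sub by (simp add: inv_mult_group m_assoc)
  then have "L ((s \<otimes> g) \<otimes> inv s) \<noteq> 0" using conj_eq_on_N_iff[of "s \<otimes> g" s] s g by simp
  then show "L (s \<otimes> g \<otimes> inv s) \<noteq> 0" .
qed

lemma card_supp_conj:
  assumes s: "s \<in> carrier G"
  shows "card {g \<in> carrier G. L (s \<otimes> g \<otimes> inv s) \<noteq> 0} = card A"
proof (rule bij_betw_same_card)
  show "bij_betw (\<lambda>g. s \<otimes> g \<otimes> inv s) {g \<in> carrier G. L (s \<otimes> g \<otimes> inv s) \<noteq> 0} A"
    unfolding bij_betw_def
  proof
    show "inj_on (\<lambda>g. s \<otimes> g \<otimes> inv s) {g \<in> carrier G. L (s \<otimes> g \<otimes> inv s) \<noteq> 0}"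
      using conj_bij[OF s] by (auto simp: bij_betw_def intro: inj_on_subset)
    have "h \<in> (\<lambda>g. s \<otimes> g \<otimes> inv s) ` {g \<in> carrier G. L (s \<otimes> g \<otimes> inv s) \<noteq> 0}" if h: "h \<in> A" for h
    proof -
      have "h \<in> (\<lambda>g. s \<otimes> g \<otimes> inv s) ` carrier G" using conj_bij[OF s] h by (simp add: bij_betw_def)
      then obtain g where "g \<in> carrier G" "h = s \<otimes> g \<otimes> inv s" by (elim imageE)
      then show ?thesis using h by auto
    qed
    then show "(\<lambda>g. s \<otimes> g \<otimes> inv s) ` {g \<in> carrier G. L (s \<otimes> g \<otimes> inv s) \<noteq> 0} = A" using s by auto
  qed
qed

lemma ind_char_conj:
  assumes s: "s \<in> carrier G"
  shows "ind_char G (\<lambda>g. L (s \<otimes> g \<otimes> inv s)) = ind_char G L"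
proof
  fix x show "ind_char G (\<lambda>g. L (s \<otimes> g \<otimes> inv s)) x = ind_char G L x"
  proof (cases "x \<in> carrier G")
    case True
    have bij: "bij_betw (\<lambda>g. s \<otimes> g) (carrier G) (carrier G)"
      by (rule bij_betw_byWitness[where f' = "\<lambda>g. inv s \<otimes> g"]) (use s in \<open>auto simp: m_assoc[symmetric]\<close>)
    have "(\<Sum>g\<in>carrier G. L (s \<otimes> (g \<otimes> x \<otimes> inv g) \<otimes> inv s)) =
        (\<Sum>g\<in>carrier G. L ((s \<otimes> g) \<otimes> x \<otimes> inv (s \<otimes> g)))"
      using s True by (intro sum.cong) (auto simp: inv_mult_group m_assoc)
    also have "\<dots> = (\<Sum>g\<in>carrier G. L (g \<otimes> x \<otimes> inv g))"
      by (rule sum.reindex_bij_betw[OF bij, of "\<lambda>g. L (g \<otimes> x \<otimes> inv g)"])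
    finally show ?thesis using True by (simp add: ind_char_def card_supp_conj[OF s])
  qed (simp add: ind_char_def)
qed

text \<open>If no conjugate of \<open>L\<close> agreed with \<open>L'\<close> on \<open>N\<close>,
  orthogonality would make the average of the common character against \<open>L'\<close> over
  \<open>N\<close> zero, while \<open>recover_L\<close> for \<open>L'\<close> at the identity gives
  the order of \<open>N\<close>. So some conjugate agrees with \<open>L'\<close> on
  \<open>N\<close>, and \<open>eq_if_ind_char_eq\<close> extends this to the group.\<close>

lemma conj_if_ind_char_eq:
  assumes L': "mono_datum G N L'" and eq: "ind_char G L = ind_char G L'"
  shows "\<exists>s\<in>carrier G. \<forall>g\<in>carrier G. L' g = L (s \<otimes> g \<otimes> inv s)"
proof -
  interpret L': mono_datum G N L' by fact
  have "\<exists>s\<in>carrier G. \<forall>n\<in>N. L (s \<otimes> n \<otimes> inv s) = L' n"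
  proof (rule ccontr)
    assume no: "\<not> ?thesis"
    have "of_nat (card A) * (\<Sum>n\<in>N. cnj (L' n) * ind_char G L n) =
      (\<Sum>n\<in>N. \<Sum>g\<in>carrier G. cnj (L' n) * L (g \<otimes> n \<otimes> inv g))"
      using N_sub by (simp only: sum_distrib_left[where r = "of_nat (card A)"] mult.left_commute[of "of_nat (card A)"]
          ind_char_eq cong: sum.cong) (simp only: sum_distrib_left)
    also have "\<dots> = (\<Sum>g\<in>carrier G. \<Sum>n\<in>N. cnj (L' n) * L (g \<otimes> n \<otimes> inv g))" by (rule sum.swap)
    also have "\<dots> = 0"
    proof (rule sum.neutral, rule ballI)
      fix g assume g: "g \<in> carrier G"
      then have "\<not> (\<forall>n\<in>N. L (g \<otimes> n \<otimes> inv g) = L' n)" using no by blast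
      then show "(\<Sum>n\<in>N. cnj (L' n) * L (g \<otimes> n \<otimes> inv g)) = 0"
        using N_orth[OF L'.L_N_mult L'.L_N_cnj g] by (simp only: if_False)
    qed
    finally have "(\<Sum>n\<in>N. cnj (L' n) * ind_char G L n) = 0" using A_nz mult_eq_0_iff by blast
    then have "(\<Sum>n\<in>N. cnj (L' n) * ind_char G L' (n \<otimes> \<one>)) = 0" using eq N_sub by (simp cong: sum.cong)
    then show False using L'.recover_L[of \<one>] N_pos by (simp add: L'.L_one)
  qed
  then obtain s where s: "s \<in> carrier G" "\<And>n. n \<in> N \<Longrightarrow> L (s \<otimes> n \<otimes> inv s) = L' n" by blast
  have "L (s \<otimes> a \<otimes> inv s) = L' a" if "a \<in> carrier G" for a
    using mono_datum.eq_if_ind_char_eq[OF mono_datum_conj[OF s(1)] L' _ s(2) that] ind_char_conj[OF s(1)] eq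
    by simp
  then have "\<forall>a\<in>carrier G. L' a = L (s \<otimes> a \<otimes> inv s)" by (metis (no_types))
  then show ?thesis using s(1) by (rule bexI)
qed

text \<open>\<open>A\<close> is the stabiliser of \<open>L\<close> under conjugation, so the orbit
  has |G : A| members. The conjugates are cut to zero outside the carrier in order to be counted as
  functions.\<close>

lemma card_conjugates:
  "card ((\<lambda>s g. if g \<in> carrier G then L (s \<otimes> g \<otimes> inv s) else 0) ` carrier G) * card A = card (carrier G)"
proof -
  let ?c = "\<lambda>s g. if g \<in> carrier G then L (s \<otimes> g \<otimes> inv s) else 0"
  have eq: "?c s = ?c t \<longleftrightarrow> L (s \<otimes> inv t) \<noteq> 0" if s: "s \<in> carrier G" and t: "t \<in> carrier G" for s t
  proof
    assume "?c s = ?c t"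
    then have "?c s n = ?c t n" for n by (rule fun_cong)
    then have "\<forall>n\<in>N. L (s \<otimes> n \<otimes> inv s) = L (t \<otimes> n \<otimes> inv t)"
      using N_sub by (metis (no_types, lifting))
    then show "L (s \<otimes> inv t) \<noteq> 0" using conj_eq_on_N_iff[OF s t] by simp
  next
    assume nz: "L (s \<otimes> inv t) \<noteq> 0"
    show "?c s = ?c t" using L_conj_cong[OF s t _ nz] by auto
  qed
  have fib: "card {s \<in> carrier G. ?c s = F} = card A" if "F \<in> ?c ` carrier G" for F
  proof -
    from that obtain t where t: "t \<in> carrier G" "F = ?c t" by (elim imageE)
    have "{s \<in> carrier G. ?c s = F} = {s \<in> carrier G. L (s \<otimes> inv t) \<noteq> 0}"
      using eq[OF _ t(1)] t(2) by (intro Collect_cong conj_cong refl) simp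
    also have "card \<dots> = card A"
      by (rule bij_betw_same_card[of "\<lambda>s. s \<otimes> inv t"],
          rule bij_betw_byWitness[where f' = "\<lambda>a. a \<otimes> t"]) (use t in \<open>auto simp: m_assoc\<close>)
    finally show ?thesis .
  qed
  have "card (carrier G) = (\<Sum>F\<in>?c ` carrier G. card {s \<in> carrier G. ?c s = F})"
    using sum.image_gen[OF fin, of "\<lambda>_. 1 :: nat" ?c] by simp
  then show ?thesis using fib by simp
qed

end

text \<open>The fibres of \<open>ind_char\<close> on the family are full conjugation orbits, and
  each has |G| / k elements.\<close>

lemma card_ind_char_image:
  fixes G (structure)
  assumes fin: "finite \<L>"
    and datum: "\<And>L. L \<in> \<L> \<Longrightarrow> mono_datum G N L"
    and outside: "\<And>L g. \<lbrakk>L \<in> \<L>; g \<notin> carrier G\<rbrakk> \<Longrightarrow> L g = 0"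
    and closed: "\<And>L s. \<lbrakk>L \<in> \<L>; s \<in> carrier G\<rbrakk> \<Longrightarrow>
      (\<lambda>g. if g \<in> carrier G then L (s \<otimes> g \<otimes> inv s) else 0) \<in> \<L>"
    and supp: "\<And>L. L \<in> \<L> \<Longrightarrow> card {g \<in> carrier G. L g \<noteq> 0} = k"
  shows "card (ind_char G ` \<L>) * card (carrier G) = card \<L> * k"
proof -
  have fib: "card {L' \<in> \<L>. ind_char G L' = \<chi>} * k = card (carrier G)" if "\<chi> \<in> ind_char G ` \<L>" for \<chi>
  proof -
    from that obtain L where L: "L \<in> \<L>" "\<chi> = ind_char G L" by (elim imageE)
    interpret mono_datum G N L using datum L by simp
    let ?c = "\<lambda>s g. if g \<in> carrier G then L (s \<otimes> g \<otimes> inv s) else 0"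
    have "ind_char G (?c s) = \<chi>" if "s \<in> carrier G" for s
    proof -
      have "ind_char G (?c s) = ind_char G (\<lambda>g. L (s \<otimes> g \<otimes> inv s))"
        by (rule ind_char_cong[OF is_group]) simp
      then show ?thesis using ind_char_conj[OF that] L by simp
    qed
    moreover have "L' \<in> ?c ` carrier G" if L': "L' \<in> \<L>" "ind_char G L' = \<chi>" for L'
    proof -
      obtain s where s: "s \<in> carrier G" "\<forall>g\<in>carrier G. L' g = L (s \<otimes> g \<otimes> inv s)"
        using conj_if_ind_char_eq[OF datum[OF L'(1)]] L'(2) L(2) by auto
      then have "L' = ?c s" using outside[OF L'(1)] by auto
      then show ?thesis using s(1) by blast
    qed
    ultimately have "{L' \<in> \<L>. ind_char G L' = \<chi>} = ?c ` carrier G" using closed[OF L(1)] by blast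
    then show ?thesis using card_conjugates supp[OF L(1)] by simp
  qed
  have "card \<L> = (\<Sum>\<chi>\<in>ind_char G ` \<L>. card {L \<in> \<L>. ind_char G L = \<chi>})"
    using sum.image_gen[OF fin, of "\<lambda>_. 1 :: nat" "ind_char G"] by simp
  then have "card \<L> * k = (\<Sum>\<chi>\<in>ind_char G ` \<L>. card {L \<in> \<L>. ind_char G L = \<chi>} * k)"
    by (simp only: sum_distrib_right)
  then show ?thesis using fib by simp
qed

section \<open>The induced representation as an explicit monomial matrix\<close>

locale mono_transversal = mono_datum +
  fixes m :: nat and s :: "nat \<Rightarrow> 'a"
  assumes s_closed: "i < m \<Longrightarrow> s i \<in> carrier G"
    and s_ex: "g \<in> carrier G \<Longrightarrow> \<exists>i<m. L (g \<otimes> inv (s i)) \<noteq> 0"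
    and s_inj: "\<lbrakk>i < m; j < m; L (s i \<otimes> inv (s j)) \<noteq> 0\<rbrakk> \<Longrightarrow> i = j"
    and m_index: "m * card A = card (carrier G)"
begin

lemma s_unique:
  assumes g: "g \<in> carrier G" and i: "i < m" "L (g \<otimes> inv (s i)) \<noteq> 0" and j: "j < m" "L (g \<otimes> inv (s j)) \<noteq> 0"
  shows "i = j"
proof (rule s_inj[OF i(1) j(1)])
  have si: "s i \<in> carrier G" and sj: "s j \<in> carrier G" using s_closed i j by auto
  have "s i \<otimes> inv (s j) = inv (g \<otimes> inv (s i)) \<otimes> (g \<otimes> inv (s j))"
    using g si sj by (simp add: inv_mult_group m_assoc) (simp add: m_assoc[symmetric])
  then show "L (s i \<otimes> inv (s j)) \<noteq> 0"
    using L_mult[of "inv (g \<otimes> inv (s i))" "g \<otimes> inv (s j)"] L_inv_all[of "g \<otimes> inv (s i)"] g si sj i j by simp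
qed

text \<open>Matrix products collapse to one term: g lies in exactly one coset of \<open>A\<close>,
  so g s_j^-1 is in \<open>A\<close> for exactly one j.\<close>

lemma sum_right:
  assumes g: "g \<in> carrier G"
    and c: "\<And>j. \<lbrakk>j < m; L (g \<otimes> inv (s j)) \<noteq> 0\<rbrakk> \<Longrightarrow> L (g \<otimes> inv (s j)) * F j = c"
  shows "(\<Sum>j<m. L (g \<otimes> inv (s j)) * F j) = c"
proof -
  obtain i where i: "i < m" "L (g \<otimes> inv (s i)) \<noteq> 0" using s_ex[OF g] by auto
  have "(\<Sum>j<m. L (g \<otimes> inv (s j)) * F j) = L (g \<otimes> inv (s i)) * F i + (\<Sum>j\<in>{..<m} - {i}. L (g \<otimes> inv (s j)) * F j)"
    using i by (intro sum.remove) auto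
  also have "(\<Sum>j\<in>{..<m} - {i}. L (g \<otimes> inv (s j)) * F j) = 0"
    using s_unique[OF g i] by (intro sum.neutral) auto
  finally show ?thesis using c[OF i] by simp
qed

text \<open>The mirror image of \<open>sum_right\<close>, obtained from it by inverting the argument
  and taking complex conjugates.\<close>

lemma sum_left:
  assumes g: "g \<in> carrier G"
    and c: "\<And>j. \<lbrakk>j < m; L (s j \<otimes> g) \<noteq> 0\<rbrakk> \<Longrightarrow> F j * L (s j \<otimes> g) = c"
  shows "(\<Sum>j<m. F j * L (s j \<otimes> g)) = c"
proof -
  have eq: "L (s j \<otimes> g) = cnj (L (inv g \<otimes> inv (s j)))" if "j < m" for j
    using L_inv_all[of "inv g \<otimes> inv (s j)"] g s_closed[OF that] by (simp add: inv_mult_group)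
  have "(\<Sum>j<m. F j * L (s j \<otimes> g)) = cnj (\<Sum>j<m. L (inv g \<otimes> inv (s j)) * cnj (F j))"
    by (simp add: cnj_sum eq mult.commute)
  also have "(\<Sum>j<m. L (inv g \<otimes> inv (s j)) * cnj (F j)) = cnj c"
  proof (rule sum_right)
    show "L (inv g \<otimes> inv (s j)) * cnj (F j) = cnj c" if "j < m" "L (inv g \<otimes> inv (s j)) \<noteq> 0" for j
      using c[OF that(1)] eq[OF that(1)] that(2) by (metis complex_cnj_cnj complex_cnj_mult complex_cnj_zero_iff mult.commute)
  qed (use g in simp)
  finally show ?thesis by simp
qed

text \<open>The representation induced from \<open>L\<close> in the basis given by right cosets;
  each row and each column has exactly one nonzero entry.\<close>

definition R :: "'a \<Rightarrow> complex mat" where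
  "R x = mat m m (\<lambda>(i, j). L (s i \<otimes> x \<otimes> inv (s j)))"

lemma R_carrier: "R x \<in> carrier_mat m m" by (simp add: R_def)

lemma L_ss: "\<lbrakk>i < m; j < m\<rbrakk> \<Longrightarrow> L (s i \<otimes> inv (s j)) = (if i = j then 1 else 0)"
  using s_inj[of i j] s_closed[of i] L_one by (auto simp: r_inv)

lemma R_rep: "is_rep G m R"
  unfolding is_rep_def
proof (intro conjI ballI)
  show "R \<one> = 1\<^sub>m m"
    using s_closed L_ss by (intro eq_matI) (auto simp: R_def)
next
  fix g h assume g: "g \<in> carrier G" and h: "h \<in> carrier G"
  show "R (g \<otimes> h) = R g * R h"
  proof (rule eq_matI)
    fix i k assume "i < dim_row (R g * R h)" "k < dim_col (R g * R h)"
    then have i: "i < m" and k: "k < m" by (auto simp: R_def)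
    have "(R g * R h) $$ (i, k) = (\<Sum>j<m. L ((s i \<otimes> g) \<otimes> inv (s j)) * L (s j \<otimes> h \<otimes> inv (s k)))"
      using i k by (simp add: R_def scalar_prod_def lessThan_atLeast0)
    also have "\<dots> = L (s i \<otimes> (g \<otimes> h) \<otimes> inv (s k))"
    proof (rule sum_right)
      show "s i \<otimes> g \<in> carrier G" using s_closed[OF i] g by simp
      fix j assume j: "j < m" "L ((s i \<otimes> g) \<otimes> inv (s j)) \<noteq> 0"
      let ?a = "(s i \<otimes> g) \<otimes> inv (s j)"
      have c: "s i \<in> carrier G" "s j \<in> carrier G" "s k \<in> carrier G" using s_closed i j k by auto
      have "L ?a * L (s j \<otimes> h \<otimes> inv (s k)) = L (?a \<otimes> (s j \<otimes> h \<otimes> inv (s k)))"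
        using L_left[of ?a "s j \<otimes> h \<otimes> inv (s k)"] c g h j by simp
      also have "?a \<otimes> (s j \<otimes> h \<otimes> inv (s k)) = s i \<otimes> (g \<otimes> h) \<otimes> inv (s k)"
        using c g h by (simp add: m_assoc) (simp add: m_assoc[symmetric])
      finally show "L ?a * L (s j \<otimes> h \<otimes> inv (s k)) = L (s i \<otimes> (g \<otimes> h) \<otimes> inv (s k))" .
    qed
    finally show "R (g \<otimes> h) $$ (i, k) = (R g * R h) $$ (i, k)" using i k by (simp add: R_def)
  qed (simp_all add: R_def)
qed (simp add: R_def)

lemma m_pos: "m > 0" using s_ex[OF one_closed] by auto

text \<open>\<open>N\<close> is normal and contained in \<open>A\<close>, so its elements act by
  diagonal matrices. The diagonal entries are conjugates of \<open>L\<close> on \<open>N\<close>,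
  pairwise different for different positions.\<close>

lemma R_N: "\<lbrakk>n \<in> N; i < m; j < m\<rbrakk> \<Longrightarrow>
    R n $$ (i, j) = (if i = j then L (s i \<otimes> n \<otimes> inv (s i)) else 0)"
proof -
  assume n: "n \<in> N" and i: "i < m" and j: "j < m"
  have c: "s i \<in> carrier G" "s j \<in> carrier G" "n \<in> carrier G" using s_closed i j n N_sub by auto
  have eq: "s i \<otimes> n \<otimes> inv (s j) = (s i \<otimes> n \<otimes> inv (s i)) \<otimes> (s i \<otimes> inv (s j))"
    using c by (simp add: m_assoc) (simp add: m_assoc[symmetric])
  have "L (s i \<otimes> n \<otimes> inv (s j)) = L (s i \<otimes> n \<otimes> inv (s i)) * L (s i \<otimes> inv (s j))"
    unfolding eq using L_left[of "s i \<otimes> n \<otimes> inv (s i)"] N_supp[OF N_conj[OF n c(1)]] c by simp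
  then show ?thesis using L_ss[OF i j] i j by (simp add: R_def)
qed

lemma R_irred: "irred_rep G m R"
  unfolding irred_rep_def
proof (intro conjI allI impI)
  show "0 < m" by (rule m_pos)
  show "is_rep G m R" by (rule R_rep)
  fix W assume W: "invariant_subspace G m R W"
  then have Wc: "W \<subseteq> carrier_vec m" and W0: "0\<^sub>v m \<in> W"
    and Wsm: "\<And>c v. v \<in> W \<Longrightarrow> c \<cdot>\<^sub>v v \<in> W" by (auto simp: invariant_subspace_def)
  show "W = {0\<^sub>v m} \<or> W = carrier_vec m"
  proof (cases "W = {0\<^sub>v m}")
    case False
    then obtain w where w: "w \<in> W" "w \<noteq> 0\<^sub>v m" using W0 by blast
    have wc: "w \<in> carrier_vec m" by (rule subsetD[OF Wc w(1)])
    have "\<exists>i<m. w $ i \<noteq> 0"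
    proof (rule ccontr)
      assume "\<not> ?thesis"
      then have "w = 0\<^sub>v m" using wc by (intro eq_vecI) auto
      then show False using w by simp
    qed
    then obtain i where i: "i < m" "w $ i \<noteq> 0" by blast
    have si: "s i \<in> carrier G" using s_closed i by simp
    \<comment> \<open>Averaging against the i-th diagonal character of \<open>N\<close> projects to
      the i-th coordinate, since the diagonal characters are pairwise different.\<close>
    have "vec m (\<lambda>k. \<Sum>n\<in>N. cnj (L (s i \<otimes> n \<otimes> inv (s i))) * (R n *\<^sub>v w) $ k) \<in> W"
      by (rule invariant_subspace_sum[OF W w(1) finN]) (use N_sub R_carrier in auto)
    also have "vec m (\<lambda>k. \<Sum>n\<in>N. cnj (L (s i \<otimes> n \<otimes> inv (s i))) * (R n *\<^sub>v w) $ k) =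
        (of_nat (card N) * w $ i) \<cdot>\<^sub>v unit_vec m i"
    proof (rule eq_vecI)
      fix k assume "k < dim_vec ((of_nat (card N) * w $ i) \<cdot>\<^sub>v unit_vec m i)"
      then have k: "k < m" by simp
      have sk: "s k \<in> carrier G" using s_closed k by simp
      have "(R n *\<^sub>v w) $ k = L (s k \<otimes> n \<otimes> inv (s k)) * w $ k" if n: "n \<in> N" for n
      proof -
        have "(R n *\<^sub>v w) $ k = (\<Sum>j<m. R n $$ (k, j) * w $ j)"
          using k wc R_carrier[of n] by (simp add: scalar_prod_def lessThan_atLeast0)
        also have "\<dots> = (\<Sum>j<m. if j = k then L (s k \<otimes> n \<otimes> inv (s k)) * w $ k else 0)"
          using R_N[OF n k] by (intro sum.cong) auto
        finally show ?thesis using k by simp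
      qed
      then have "(\<Sum>n\<in>N. cnj (L (s i \<otimes> n \<otimes> inv (s i))) * (R n *\<^sub>v w) $ k) =
          (\<Sum>n\<in>N. cnj (L (s i \<otimes> n \<otimes> inv (s i))) * L (s k \<otimes> n \<otimes> inv (s k))) * w $ k"
        by (simp add: sum_distrib_right mult.assoc)
      also have "(\<Sum>n\<in>N. cnj (L (s i \<otimes> n \<otimes> inv (s i))) * L (s k \<otimes> n \<otimes> inv (s k))) =
          (if \<forall>n\<in>N. L (s k \<otimes> n \<otimes> inv (s k)) = L (s i \<otimes> n \<otimes> inv (s i)) then of_nat (card N) else 0)"
      proof (rule N_orth[OF _ _ sk])
        show "L (s i \<otimes> n \<otimes> inv (s i)) * cnj (L (s i \<otimes> n \<otimes> inv (s i))) = 1" if "n \<in> N" for n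
          by (rule L_N_cnj[OF N_conj[OF that si]])
      qed (rule L_conj_N_mult[OF si])
      also have "(\<forall>n\<in>N. L (s k \<otimes> n \<otimes> inv (s k)) = L (s i \<otimes> n \<otimes> inv (s i))) \<longleftrightarrow> k = i"
        unfolding conj_eq_on_N_iff[OF sk si] using L_ss[OF k i(1)] by simp
      finally show "vec m (\<lambda>k. \<Sum>n\<in>N. cnj (L (s i \<otimes> n \<otimes> inv (s i))) * (R n *\<^sub>v w) $ k) $ k =
          ((of_nat (card N) * w $ i) \<cdot>\<^sub>v unit_vec m i) $ k"
        using k i by auto
    qed simp
    finally have "(1 / (of_nat (card N) * w $ i)) \<cdot>\<^sub>v ((of_nat (card N) * w $ i) \<cdot>\<^sub>v unit_vec m i) \<in> W"
      by (rule Wsm)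
    then have ui: "unit_vec m i \<in> W" using N_pos i by (simp add: smult_smult_assoc)
    have "v \<in> W" if v: "v \<in> carrier_vec m" for v
    proof -
      \<comment> \<open>The element s_j^-1 s_i carries the i-th basis vector to the j-th, so the
        translates of one basis vector span the space.\<close>
      have "vec m (\<lambda>k. \<Sum>j<m. v $ j * (R (inv (s j) \<otimes> s i) *\<^sub>v unit_vec m i) $ k) \<in> W"
        by (rule invariant_subspace_sum[OF W ui]) (use s_closed i R_carrier in auto)
      also have "vec m (\<lambda>k. \<Sum>j<m. v $ j * (R (inv (s j) \<otimes> s i) *\<^sub>v unit_vec m i) $ k) = v"
      proof (rule eq_vecI)
        fix k assume "k < dim_vec v"
        then have k: "k < m" using v by simp
        have "(R (inv (s j) \<otimes> s i) *\<^sub>v unit_vec m i) $ k = (if j = k then 1 else 0)" if j: "j < m" for j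
        proof -
          have c: "s i \<in> carrier G" "s j \<in> carrier G" "s k \<in> carrier G" using s_closed i j k by auto
          have "s k \<otimes> (inv (s j) \<otimes> s i) \<otimes> inv (s i) = s k \<otimes> inv (s j)" using c by (simp add: m_assoc)
          then show ?thesis
            using mult_mat_vec_unit[OF R_carrier i(1)] k i j L_ss[OF k j] by (auto simp: R_def)
        qed
        then have "(\<Sum>j<m. v $ j * (R (inv (s j) \<otimes> s i) *\<^sub>v unit_vec m i) $ k) =
            (\<Sum>j<m. if j = k then v $ k else 0)" by (intro sum.cong) auto
        then show "vec m (\<lambda>k. \<Sum>j<m. v $ j * (R (inv (s j) \<otimes> s i) *\<^sub>v unit_vec m i) $ k) $ k = v $ k"
          using k by simp
      qed (use v in simp)
      finally show ?thesis .
    qed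
    then show ?thesis using Wc by blast
  qed simp
qed

text \<open>Every group element is a s_i for a unique pair of a in \<open>A\<close> and i, and
  conjugating by a does not change \<open>L\<close>; the sum over the group is therefore |A| times
  the sum over the diagonal.\<close>

lemma R_trace:
  assumes x: "x \<in> carrier G"
  shows "mat_trace (R x) = ind_char G L x"
proof -
  have bij: "bij_betw (\<lambda>p. snd p \<otimes> s (fst p)) ({..<m} \<times> A) (carrier G)"
    unfolding bij_betw_def
  proof
    show inj: "inj_on (\<lambda>p. snd p \<otimes> s (fst p)) ({..<m} \<times> A)"
    proof (rule inj_onI)
      fix p p' assume p: "p \<in> {..<m} \<times> A" "p' \<in> {..<m} \<times> A"
        and e: "snd p \<otimes> s (fst p) = snd p' \<otimes> s (fst p')"
      obtain i a j b where ij: "p = (i, a)" "p' = (j, b)" by (cases p; cases p')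
      have *: "i < m" "j < m" "a \<in> carrier G" "L a \<noteq> 0" "b \<in> carrier G" "L b \<noteq> 0"
        "a \<otimes> s i = b \<otimes> s j" using p e unfolding ij by auto
      have c: "s i \<in> carrier G" "s j \<in> carrier G" using s_closed *(1,2) by auto
      have "a \<otimes> s i \<otimes> inv (s i) = a" using c *(3) by (simp add: m_assoc)
      moreover have "a \<otimes> s i \<otimes> inv (s j) = b" unfolding *(7) using c *(5) by (simp add: m_assoc)
      ultimately have "i = j"
        using s_unique[of "a \<otimes> s i" i j] *(1-4,6) c by simp
      then show "p = p'" using *(3,5,7) c ij by simp
    qed
    show "(\<lambda>p. snd p \<otimes> s (fst p)) ` ({..<m} \<times> A) = carrier G"
    proof (rule card_subset_eq[OF fin])
      show "(\<lambda>p. snd p \<otimes> s (fst p)) ` ({..<m} \<times> A) \<subseteq> carrier G" using s_closed by auto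
      show "card ((\<lambda>p. snd p \<otimes> s (fst p)) ` ({..<m} \<times> A)) = card (carrier G)"
        unfolding card_image[OF inj] by (simp only: card_cartesian_product card_lessThan m_index)
    qed
  qed
  have "(\<Sum>g\<in>carrier G. L (g \<otimes> x \<otimes> inv g)) =
      (\<Sum>p\<in>{..<m} \<times> A. L ((snd p \<otimes> s (fst p)) \<otimes> x \<otimes> inv (snd p \<otimes> s (fst p))))"
    by (rule sum.reindex_bij_betw[OF bij, symmetric])
  also have "\<dots> = (\<Sum>p\<in>{..<m} \<times> A. L (s (fst p) \<otimes> x \<otimes> inv (s (fst p))))"
  proof (rule sum.cong[OF refl])
    fix p assume p: "p \<in> {..<m} \<times> A"
    obtain i a where ia: "p = (i, a)" by (cases p)
    have *: "i < m" "a \<in> carrier G" "L a \<noteq> 0" using p unfolding ia by auto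
    have c: "s i \<in> carrier G" using s_closed * by auto
    have "(a \<otimes> s i) \<otimes> x \<otimes> inv (a \<otimes> s i) = a \<otimes> (s i \<otimes> x \<otimes> inv (s i)) \<otimes> inv a"
      using c * x by (simp add: inv_mult_group m_assoc)
    then show "L ((snd p \<otimes> s (fst p)) \<otimes> x \<otimes> inv (snd p \<otimes> s (fst p))) = L (s (fst p) \<otimes> x \<otimes> inv (s (fst p)))"
      unfolding ia using L_conj[of a "s i \<otimes> x \<otimes> inv (s i)"] * c x by simp
  qed
  also have "\<dots> = of_nat (card A) * (\<Sum>i<m. L (s i \<otimes> x \<otimes> inv (s i)))"
    by (simp only: sum.cartesian_product'[of _ "{..<m}" A] fst_conv sum_constant sum_distrib_left)
  finally have "of_nat (card A) * ind_char G L x = of_nat (card A) * (\<Sum>i<m. L (s i \<otimes> x \<otimes> inv (s i)))"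
    unfolding ind_char_eq[OF x] .
  then have "ind_char G L x = (\<Sum>i<m. L (s i \<otimes> x \<otimes> inv (s i)))" using A_nz mult_left_cancel by blast
  then show ?thesis by (simp add: mat_trace_def R_def)
qed

text \<open>The matrix of these sums intertwines \<open>R\<close> and \<open>\<rho>\<close>, so it vanishes by Schur's lemma.\<close>

lemma R_intertwiner_zero:
  assumes \<rho>: "irred_rep G n \<rho>" and ne: "\<exists>g\<in>carrier G. mat_trace (\<rho> g) \<noteq> ind_char G L g"
    and ijk: "i < n" "j < m" "k < n"
  shows "(\<Sum>g\<in>carrier G. cnj (L (s j \<otimes> g)) * \<rho> g $$ (i, k)) = 0"
proof -
  have rep: "is_rep G n \<rho>" using \<rho> by (simp add: irred_rep_def)
  then have r: "\<rho> h \<in> carrier_mat n n" if "h \<in> carrier G" for h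
    using that by (simp add: is_rep_def)
  define T where "T = mat n m (\<lambda>(i, j). \<Sum>g\<in>carrier G. cnj (L (s j \<otimes> g)) * \<rho> g $$ (i, k))"
  have T: "T \<in> carrier_mat n m" by (simp add: T_def)
  have inter: "T * R x = \<rho> x * T" if x: "x \<in> carrier G" for x
  proof (rule eq_matI)
    fix i l assume "i < dim_row (\<rho> x * T)" "l < dim_col (\<rho> x * T)"
    then have i: "i < n" and l: "l < m" using T r[OF x] by auto
    have sl: "s l \<in> carrier G" using s_closed l by simp
    have bij: "bij_betw (\<lambda>g. x \<otimes> g) (carrier G) (carrier G)"
      by (rule bij_betw_byWitness[where f' = "\<lambda>g. inv x \<otimes> g"]) (use x in \<open>auto simp: m_assoc[symmetric]\<close>)
    let ?c = "\<Sum>g\<in>carrier G. cnj (L (s l \<otimes> (inv x \<otimes> g))) * \<rho> g $$ (i, k)"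
    have "(\<rho> x * T) $$ (i, l) = (\<Sum>p<n. \<rho> x $$ (i, p) * (\<Sum>g\<in>carrier G. cnj (L (s l \<otimes> g)) * \<rho> g $$ (p, k)))"
      using i l r[OF x] by (simp add: T_def scalar_prod_def lessThan_atLeast0)
    also have "\<dots> = (\<Sum>p<n. \<Sum>g\<in>carrier G. cnj (L (s l \<otimes> g)) * (\<rho> x $$ (i, p) * \<rho> g $$ (p, k)))"
      by (simp add: sum_distrib_left ac_simps)
    also have "\<dots> = (\<Sum>g\<in>carrier G. cnj (L (s l \<otimes> g)) * (\<Sum>p<n. \<rho> x $$ (i, p) * \<rho> g $$ (p, k)))"
      by (subst sum.swap) (simp add: sum_distrib_left)
    \<comment> \<open>Everything is expressed through x g, so that reindexing absorbs
      \<open>\<rho> x\<close> and moves the inverse of x into the argument of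
      \<open>L\<close>.\<close>
    also have "\<dots> = (\<Sum>g\<in>carrier G. cnj (L (s l \<otimes> (inv x \<otimes> (x \<otimes> g)))) * \<rho> (x \<otimes> g) $$ (i, k))"
    proof (rule sum.cong[OF refl])
      fix g assume g: "g \<in> carrier G"
      have "\<rho> (x \<otimes> g) $$ (i, k) = (\<rho> x * \<rho> g) $$ (i, k)" using rep x g by (simp add: is_rep_def)
      also have "\<dots> = (\<Sum>p<n. \<rho> x $$ (i, p) * \<rho> g $$ (p, k))"
        using i ijk(3) r[OF x] r[OF g] by (simp add: scalar_prod_def lessThan_atLeast0)
      moreover have "inv x \<otimes> (x \<otimes> g) = g" using x g by (simp add: m_assoc[symmetric])
      ultimately show "cnj (L (s l \<otimes> g)) * (\<Sum>p<n. \<rho> x $$ (i, p) * \<rho> g $$ (p, k)) =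
          cnj (L (s l \<otimes> (inv x \<otimes> (x \<otimes> g)))) * \<rho> (x \<otimes> g) $$ (i, k)" by simp
    qed
    also have "\<dots> = ?c"
      by (rule sum.reindex_bij_betw[OF bij, of "\<lambda>g. cnj (L (s l \<otimes> (inv x \<otimes> g))) * \<rho> g $$ (i, k)"])
    finally have rhs: "(\<rho> x * T) $$ (i, l) = ?c" .
    have "(T * R x) $$ (i, l) = (\<Sum>j<m. T $$ (i, j) * L (s j \<otimes> x \<otimes> inv (s l)))"
      using i l T by (simp add: R_def scalar_prod_def lessThan_atLeast0)
    also have "\<dots> = (\<Sum>j<m. T $$ (i, j) * L (s j \<otimes> (x \<otimes> inv (s l))))"
      using s_closed sl x by (intro sum.cong) (auto simp: m_assoc)
    also have "\<dots> = ?c"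
    proof (rule sum_left)
      show "x \<otimes> inv (s l) \<in> carrier G" using x sl by simp
      fix j assume j: "j < m" "L (s j \<otimes> (x \<otimes> inv (s l))) \<noteq> 0"
      let ?a = "s j \<otimes> (x \<otimes> inv (s l))"
      have sj: "s j \<in> carrier G" using s_closed j by simp
      have a: "?a \<in> carrier G" using sj sl x by simp
      have "cnj (L (s j \<otimes> g)) * L ?a = cnj (L (s l \<otimes> (inv x \<otimes> g)))" if g: "g \<in> carrier G" for g
      proof -
        have "s j \<otimes> g = ?a \<otimes> (s l \<otimes> (inv x \<otimes> g))"
          using sj sl x g by (simp add: m_assoc) (simp add: m_assoc[symmetric])
        then have "L (s j \<otimes> g) = L ?a * L (s l \<otimes> (inv x \<otimes> g))"
          using L_left[of ?a "s l \<otimes> (inv x \<otimes> g)"] a j sl x g by simp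
        then have "cnj (L (s j \<otimes> g)) * L ?a = (L ?a * cnj (L ?a)) * cnj (L (s l \<otimes> (inv x \<otimes> g)))"
          by (simp only: complex_cnj_mult mult.commute mult.left_commute mult.assoc)
        then show ?thesis using L_cnj[OF a j(2)] by simp
      qed
      then show "T $$ (i, j) * L ?a = ?c"
        using i j(1) by (simp add: T_def sum_distrib_right mult.assoc mult.commute[of "\<rho> _ $$ _"])
          (simp add: mult.assoc[symmetric])
    qed
    finally show "(T * R x) $$ (i, l) = (\<rho> x * T) $$ (i, l)" using rhs by simp
  qed (use T r[OF x] in \<open>auto simp: R_def\<close>)
  have "T = 0\<^sub>m n m"
  proof (rule ccontr)
    assume T0: "T \<noteq> 0\<^sub>m n m"
    have "mat_trace (R g) = mat_trace (\<rho> g)" if "g \<in> carrier G" for g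
      by (rule schur_trace_eq[OF R_irred \<rho> T T0 inter that])
    then show False using ne R_trace by auto
  qed
  then have "T $$ (i, j) = 0" using ijk by simp
  then show ?thesis using ijk by (simp add: T_def)
qed

end

context mono_datum
begin

lemma ex_transversal: "\<exists>m s. mono_transversal G N L m s"
proof (rule transversal)
  fix m :: nat and s :: "nat \<Rightarrow> 'a"
  assume "\<And>i. i < m \<Longrightarrow> s i \<in> carrier G"
    "\<And>g. g \<in> carrier G \<Longrightarrow> \<exists>i<m. L (g \<otimes> inv (s i)) \<noteq> 0"
    "\<And>i j. \<lbrakk>i < m; j < m; L (s i \<otimes> inv (s j)) \<noteq> 0\<rbrakk> \<Longrightarrow> i = j"
    "m * card A = card (carrier G)"
  then have "mono_transversal G N L m s"
    by (intro mono_transversal.intro mono_transversal_axioms.intro mono_datum_axioms)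
  then show ?thesis by (intro exI)
qed

lemma ind_char_Irr: "ind_char G L \<in> Irr G"
proof -
  obtain m s where "mono_transversal G N L m s" using ex_transversal by (elim exE)
  then interpret mono_transversal G N L m s .
  show ?thesis unfolding Irr_def
    using R_irred R_trace by (intro CollectI exI[of _ m] exI[of _ R] conjI ext) (auto simp: ind_char_def)
qed

lemma sum_translate_zero:
  assumes \<rho>: "irred_rep G n \<rho>" and ne: "\<exists>g\<in>carrier G. mat_trace (\<rho> g) \<noteq> ind_char G L g"
    and ik: "i < n" "k < n" and t: "t \<in> carrier G"
  shows "(\<Sum>g\<in>carrier G. cnj (L (t \<otimes> g)) * \<rho> g $$ (i, k)) = 0"
proof -
  obtain m s where "mono_transversal G N L m s" using ex_transversal by (elim exE)
  then interpret mono_transversal G N L m s .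
  obtain j where j: "j < m" "L (t \<otimes> inv (s j)) \<noteq> 0" using s_ex[OF t] by auto
  have sj: "s j \<in> carrier G" using s_closed j by simp
  have "L (t \<otimes> g) = L (t \<otimes> inv (s j)) * L (s j \<otimes> g)" if g: "g \<in> carrier G" for g
  proof -
    have "t \<otimes> g = (t \<otimes> inv (s j)) \<otimes> (s j \<otimes> g)"
      using t sj g by (simp add: m_assoc) (simp add: m_assoc[symmetric])
    then show ?thesis using L_left[of "t \<otimes> inv (s j)" "s j \<otimes> g"] t sj g j by simp
  qed
  then have "(\<Sum>g\<in>carrier G. cnj (L (t \<otimes> g)) * \<rho> g $$ (i, k)) =
      cnj (L (t \<otimes> inv (s j))) * (\<Sum>g\<in>carrier G. cnj (L (s j \<otimes> g)) * \<rho> g $$ (i, k))"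
    by (simp add: sum_distrib_left mult.assoc)
  then show ?thesis using R_intertwiner_zero[OF \<rho> ne ik(1) j(1) ik(2)] by simp
qed

text \<open>Replacing g by g t turns the conjugate of \<open>L\<close> into a left translate, at the
  price of a factor \<open>\<rho> t\<close> on the right that is pulled out of the sum.\<close>

theorem sum_conj_zero:
  assumes \<rho>: "irred_rep G n \<rho>" and ne: "\<exists>g\<in>carrier G. mat_trace (\<rho> g) \<noteq> ind_char G L g"
    and ik: "i < n" "k < n" and t: "t \<in> carrier G"
  shows "(\<Sum>g\<in>carrier G. cnj (L (t \<otimes> g \<otimes> inv t)) * \<rho> g $$ (i, k)) = 0"
proof -
  have rep: "is_rep G n \<rho>" using \<rho> by (simp add: irred_rep_def)
  then have r: "\<rho> h \<in> carrier_mat n n" if "h \<in> carrier G" for h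
    using that by (simp add: is_rep_def)
  have bij: "bij_betw (\<lambda>g. g \<otimes> t) (carrier G) (carrier G)"
    by (rule bij_betw_byWitness[where f' = "\<lambda>g. g \<otimes> inv t"]) (use t in \<open>auto simp: m_assoc\<close>)
  have "(\<Sum>g\<in>carrier G. cnj (L (t \<otimes> g \<otimes> inv t)) * \<rho> g $$ (i, k)) =
      (\<Sum>g\<in>carrier G. cnj (L (t \<otimes> (g \<otimes> t) \<otimes> inv t)) * \<rho> (g \<otimes> t) $$ (i, k))"
    by (rule sum.reindex_bij_betw[OF bij, symmetric])
  also have "\<dots> = (\<Sum>g\<in>carrier G. \<Sum>p<n. cnj (L (t \<otimes> g)) * \<rho> g $$ (i, p) * \<rho> t $$ (p, k))"
  proof (rule sum.cong[OF refl])
    fix g assume g: "g \<in> carrier G"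
    have "\<rho> (g \<otimes> t) $$ (i, k) = (\<rho> g * \<rho> t) $$ (i, k)" using rep t g by (simp add: is_rep_def)
    also have "\<dots> = (\<Sum>p<n. \<rho> g $$ (i, p) * \<rho> t $$ (p, k))"
      using ik r[OF t] r[OF g] by (simp add: scalar_prod_def lessThan_atLeast0)
    moreover have "t \<otimes> (g \<otimes> t) \<otimes> inv t = t \<otimes> g" using t g by (simp add: m_assoc)
    ultimately show "cnj (L (t \<otimes> (g \<otimes> t) \<otimes> inv t)) * \<rho> (g \<otimes> t) $$ (i, k) =
      (\<Sum>p<n. cnj (L (t \<otimes> g)) * \<rho> g $$ (i, p) * \<rho> t $$ (p, k))"
      by (simp add: sum_distrib_left mult.assoc)
  qed
  also have "\<dots> = (\<Sum>p<n. (\<Sum>g\<in>carrier G. cnj (L (t \<otimes> g)) * \<rho> g $$ (i, p)) * \<rho> t $$ (p, k))"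
    by (subst sum.swap) (simp add: sum_distrib_right)
  also have "\<dots> = 0" using sum_translate_zero[OF \<rho> ne ik(1) _ t] by (intro sum.neutral) auto
  finally show ?thesis .
qed

end

section \<open>Perfect pairings of finite abelian groups\<close>

text \<open>The left argument names characters of the group on the right, so one type serves as
  group and as dual. Left nondegeneracy makes the naming injective; right nondegeneracy says that
  the characters separate points.\<close>

locale bichar =
  fixes \<psi> :: "'v::{finite, ab_group_add} \<Rightarrow> 'v \<Rightarrow> complex"
  assumes add_l: "\<psi> (a + a') d = \<psi> a d * \<psi> a' d"
    and add_r: "\<psi> a (d + d') = \<psi> a d * \<psi> a d'"
    and unit: "\<psi> a d * cnj (\<psi> a d) = 1"
    and nondeg_l: "(\<And>d. \<psi> a d = 1) \<Longrightarrow> a = 0"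
    and nondeg_r: "(\<And>a. \<psi> a d = 1) \<Longrightarrow> d = 0"
begin

lemma nz: "\<psi> a d \<noteq> 0" using unit[of a d] by auto

lemma zero_l [simp]: "\<psi> 0 d = 1" using add_l[of 0 0 d] nz[of 0 d] by simp

lemma zero_r [simp]: "\<psi> a 0 = 1" using add_r[of a 0 0] nz[of a 0] by simp

lemma uminus_l: "\<psi> (- a) d = cnj (\<psi> a d)"
proof -
  have "\<psi> a d * \<psi> (- a) d = \<psi> a d * cnj (\<psi> a d)" using add_l[of a "- a" d] unit[of a d] by simp
  then show ?thesis using nz mult_left_cancel by blast
qed

lemma ext_l: assumes "\<And>d. \<psi> a d = \<psi> a' d" shows "a = a'"
proof -
  have "\<psi> (a + - a') d = 1" for d unfolding add_l uminus_l using assms unit by simp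
  then have "a + - a' = 0" by (rule nondeg_l)
  then show ?thesis by simp
qed

lemma sum_l: "(\<Sum>a\<in>UNIV. \<psi> a d) = (if d = 0 then of_nat (card (UNIV :: 'v set)) else 0)"
proof (cases "d = 0")
  case False
  then obtain a where a: "\<psi> a d \<noteq> 1" using nondeg_r by blast
  have "(\<Sum>a\<in>UNIV. \<psi> a d) = 0"
  proof (rule sum_eq_0_if_scaled)
    show "bij_betw (\<lambda>a'. a + a') UNIV UNIV"
      by (rule bij_betw_byWitness[where f' = "\<lambda>a'. a' - a"]) auto
  qed (use a in \<open>simp_all add: add_l\<close>)
  with False show ?thesis by simp
qed simp

lemma sum_l_cnj: "(\<Sum>a\<in>UNIV. cnj (\<psi> a d)) = (if d = 0 then of_nat (card (UNIV :: 'v set)) else 0)"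
  using arg_cong[OF sum_l[of d], of cnj] by (simp add: cnj_sum split: if_splits)

lemma sum_subgroup:
  assumes H: "0 \<in> H" "\<And>s t. \<lbrakk>s \<in> H; t \<in> H\<rbrakk> \<Longrightarrow> s + t \<in> H" "\<And>t. t \<in> H \<Longrightarrow> - t \<in> H"
  shows "(\<Sum>t\<in>H. \<psi> b t) = (if \<forall>t\<in>H. \<psi> b t = 1 then of_nat (card H) else 0)"
proof (cases "\<forall>t\<in>H. \<psi> b t = 1")
  case False
  then obtain u where u: "u \<in> H" "\<psi> b u \<noteq> 1" by blast
  have "(\<Sum>t\<in>H. \<psi> b t) = 0"
  proof (rule sum_eq_0_if_scaled)
    show "bij_betw (\<lambda>t. u + t) H H"
    proof (rule bij_betw_byWitness[where f' = "\<lambda>t. - u + t"])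
      show "(\<lambda>t. u + t) ` H \<subseteq> H" "(\<lambda>t. - u + t) ` H \<subseteq> H" using H u by blast+
    qed auto
  qed (use u in \<open>simp_all add: add_r\<close>)
  then show ?thesis unfolding if_not_P[OF False] .
qed simp

text \<open>Every character of a subgroup extends, hence a subgroup of order \<open>h\<close> has \<open>h\<close> restricted characters.\<close>

lemma card_restrictions:
  assumes H: "0 \<in> H" "\<And>s t. \<lbrakk>s \<in> H; t \<in> H\<rbrakk> \<Longrightarrow> s + t \<in> H" "\<And>t. t \<in> H \<Longrightarrow> - t \<in> H"
  shows "card (range (\<lambda>b. restrict (\<psi> b) H)) = card H"
proof -
  let ?r = "\<lambda>b. restrict (\<psi> b) H"
  define K where "K = {b. \<forall>t\<in>H. \<psi> b t = 1}"
  \<comment> \<open>Double counting: summing over t first gives |H| |K|, where \<open>K\<close> is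
    the annihilator of \<open>H\<close>; summing over b first gives the order of the whole group.
    The fibres of restriction are the cosets of \<open>K\<close>.\<close>
  have "(\<Sum>b\<in>UNIV. \<Sum>t\<in>H. \<psi> b t) = (\<Sum>b\<in>UNIV. if b \<in> K then of_nat (card H) else 0)"
    using sum_subgroup[OF H] by (simp add: K_def)
  also have "\<dots> = of_nat (card H * card K)" by (simp add: sum.If_cases mult.commute)
  finally have 1: "(\<Sum>b\<in>UNIV. \<Sum>t\<in>H. \<psi> b t) = of_nat (card H * card K)" .
  have "(\<Sum>b\<in>UNIV. \<Sum>t\<in>H. \<psi> b t) = (\<Sum>t\<in>H. if t = 0 then of_nat (card (UNIV :: 'v set)) else 0)"
    by (subst sum.swap) (simp add: sum_l)
  also have "\<dots> = of_nat (card (UNIV :: 'v set))" using H(1) by simp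
  finally have "of_nat (card H * card K) = (of_nat (card (UNIV :: 'v set)) :: complex)" using 1 by simp
  then have HK: "card H * card K = card (UNIV :: 'v set)" using of_nat_eq_iff by blast
  have fib: "card {b \<in> UNIV. ?r b = F} = card K" if F: "F \<in> range ?r" for F
  proof -
    obtain c where c: "F = ?r c" using F by blast
    have iff: "?r (c + k) = ?r c \<longleftrightarrow> k \<in> K" for k
      using nz by (auto simp: K_def restrict_def fun_eq_iff add_l)
    have "bij_betw (\<lambda>k. c + k) K {b \<in> UNIV. ?r b = F}"
    proof (rule bij_betw_byWitness[where f' = "\<lambda>b. b - c"])
      show "(\<lambda>b. b - c) ` {b \<in> UNIV. ?r b = F} \<subseteq> K"
        using iff[of "_ - c"] c by (auto simp: algebra_simps)
    qed (use iff c in auto)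
    then show ?thesis by (rule bij_betw_same_card[symmetric])
  qed
  have "card (UNIV :: 'v set) = (\<Sum>F\<in>range ?r. card {b \<in> UNIV. ?r b = F})"
    using sum.image_gen[of UNIV "\<lambda>_. 1 :: nat" ?r] by simp
  then have "card (UNIV :: 'v set) = card (range ?r) * card K" using fib by simp
  moreover have "card K > 0" using HK finite_UNIV_card_ge_0[where 'a = 'v] by (cases "card K") auto
  ultimately show ?thesis using HK by (metis mult_right_cancel less_numeral_extra(3))
qed

end

lemma bichar_prod:
  assumes "bichar \<psi>" "bichar \<chi>"
  shows "bichar (\<lambda>a d. \<psi> (fst a) (fst d) * \<chi> (snd a) (snd d))"
proof -
  interpret A: bichar \<psi> by fact
  interpret B: bichar \<chi> by fact
  show ?thesis
  proof
    fix a d :: "'a \<times> 'b"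
    have "\<psi> (fst a) (fst d) * \<chi> (snd a) (snd d) * cnj (\<psi> (fst a) (fst d) * \<chi> (snd a) (snd d)) =
      (\<psi> (fst a) (fst d) * cnj (\<psi> (fst a) (fst d))) * (\<chi> (snd a) (snd d) * cnj (\<chi> (snd a) (snd d)))"
      by (simp add: ac_simps)
    then show "\<psi> (fst a) (fst d) * \<chi> (snd a) (snd d) * cnj (\<psi> (fst a) (fst d) * \<chi> (snd a) (snd d)) = 1"
      by (simp only: A.unit B.unit mult_1)
  next
    fix a :: "'a \<times> 'b" assume *: "\<And>d. \<psi> (fst a) (fst d) * \<chi> (snd a) (snd d) = 1"
    have "fst a = 0" using *[of "(_, 0)"] by (intro A.nondeg_l) simp
    moreover have "snd a = 0" using *[of "(0, _)"] by (intro B.nondeg_l) simp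
    ultimately show "a = 0" by (simp add: prod_eq_iff)
  next
    fix d :: "'a \<times> 'b" assume *: "\<And>a. \<psi> (fst a) (fst d) * \<chi> (snd a) (snd d) = 1"
    have "fst d = 0" using *[of "(_, 0)"] by (intro A.nondeg_r) simp
    moreover have "snd d = 0" using *[of "(0, _)"] by (intro B.nondeg_r) simp
    ultimately show "d = 0" by (simp add: prod_eq_iff)
  qed (simp_all add: A.add_l A.add_r B.add_l B.add_r ac_simps)
qed

lemma cis_eq_if_dvd:
  assumes "int p dvd k - l" "p > 0"
  shows "cis (2 * pi * of_int k / of_nat p) = cis (2 * pi * of_int l / of_nat p)"
proof -
  obtain m where m: "k - l = int p * m" using assms(1) by blast
  have "2 * pi * of_int k / of_nat p = 2 * pi * of_int l / of_nat p + 2 * pi * of_int m"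
  proof -
    have "(of_int k :: real) = of_int l + of_nat p * of_int m"
      using arg_cong[OF m, of "of_int :: int \<Rightarrow> real"] by simp
    then show ?thesis using assms(2) by (simp add: field_simps)
  qed
  then show ?thesis by (simp add: cis_mult[symmetric] cis_multiple_2pi)
qed

text \<open>Adding 1 permutes the ring; comparing the sum of all elements before and after leaves
  the claim.\<close>

lemma of_nat_card_UNIV: "of_nat (card (UNIV :: 'f::{ring_1, finite} set)) = (0 :: 'f)"
proof -
  have "(\<Sum>y\<in>(UNIV :: 'f set). y + 1) = (\<Sum>y\<in>UNIV. y)"
    by (rule sum.reindex_bij_betw[of "\<lambda>y. y + 1" UNIV UNIV "\<lambda>y. y"])
      (rule bij_betw_byWitness[where f' = "\<lambda>y. y - 1"], auto)
  then show ?thesis by (simp add: sum.distrib)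
qed

text \<open>The quotient by a maximal proper additive subgroup is cyclic.\<close>

lemma ex_additive_character:
  "\<exists>\<phi> :: 'f::{field, finite} \<Rightarrow> complex.
     (\<forall>x y. \<phi> (x + y) = \<phi> x * \<phi> y) \<and> (\<forall>x. \<phi> x * cnj (\<phi> x) = 1) \<and> (\<exists>x. \<phi> x \<noteq> 1)"
proof -
  define sub where "sub H \<longleftrightarrow> 0 \<in> H \<and> (\<forall>a\<in>H. \<forall>b\<in>H. a - b \<in> H)" for H :: "'f set"
  have "{0} \<in> {H. sub H \<and> H \<noteq> (UNIV :: 'f set)}"
    using zero_neq_one[where 'a = 'f] unfolding sub_def by (auto simp: set_eq_iff intro!: exI[of _ 1])
  then have ne: "{H. sub H \<and> H \<noteq> (UNIV :: 'f set)} \<noteq> {}" by blast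
  obtain H :: "'f set" where H: "sub H" "H \<noteq> UNIV"
    and max: "\<And>H'. \<lbrakk>sub H'; H' \<noteq> UNIV; H \<subseteq> H'\<rbrakk> \<Longrightarrow> H = H'"
    using finite_has_maximal[OF _ ne] by auto
  have H0: "0 \<in> H" and Hd: "\<And>a b. \<lbrakk>a \<in> H; b \<in> H\<rbrakk> \<Longrightarrow> a - b \<in> H" using H(1) by (auto simp: sub_def)
  have Hm: "- a \<in> H" if "a \<in> H" for a using Hd[OF H0 that] by simp
  have Ha: "a + b \<in> H" if "a \<in> H" "b \<in> H" for a b using Hd[OF that(1) Hm[OF that(2)]] by simp
  obtain x where x: "x \<notin> H" using H(2) by blast
  \<comment> \<open>These integers form an ideal with positive generator p, the order of x modulo
    \<open>H\<close>. It differs from 1 because x is not in \<open>H\<close>.\<close>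
  define D where "D = {k :: int. of_int k * x \<in> H}"
  have Dd: "k - l \<in> D" if "k \<in> D" "l \<in> D" for k l
    using Hd that by (simp add: D_def algebra_simps)
  have D0: "0 \<in> D" using H0 by (simp add: D_def)
  have Da: "k + l \<in> D" if "k \<in> D" "l \<in> D" for k l
    using Dd[OF that(1) Dd[OF D0 that(2)]] by simp
  have Dn: "of_nat n * k \<in> D" if "k \<in> D" for n k
    by (induction n) (use D0 Da that in \<open>auto simp: distrib_right\<close>)
  have Dz: "m * k \<in> D" if "k \<in> D" for m k
    using Dn[OF that, of "nat m"] Dd[OF D0 Dn[OF that, of "nat (- m)"]] by (cases "m \<ge> 0") auto
  have "\<exists>p>0. int p \<in> D"
  proof -
    have "int (card (UNIV :: 'f set)) \<in> D" using H0 by (simp add: D_def of_nat_card_UNIV)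
    then show ?thesis
      by (intro exI[of _ "card (UNIV :: 'f set)"] conjI) (simp_all add: finite_UNIV_card_ge_0)
  qed
  then obtain p where p: "p > 0" "int p \<in> D" and least: "\<And>n. \<lbrakk>n > 0; int n \<in> D\<rbrakk> \<Longrightarrow> p \<le> n"
    using exists_least_iff[of "\<lambda>p. p > 0 \<and> int p \<in> D"] by (metis leI)
  have Ddvd: "int p dvd k" if k: "k \<in> D" for k
  proof (rule ccontr)
    assume nd: "\<not> int p dvd k"
    have "k mod int p = k - (k div int p) * int p" by (simp add: minus_div_mult_eq_mod)
    then have "k mod int p \<in> D" using Dd[OF k Dz[OF p(2)]] by simp
    moreover have pos: "k mod int p > 0" using nd p(1)
      by (metis dvd_eq_mod_eq_0 of_nat_0_less_iff order_le_less pos_mod_sign)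
    ultimately have "p \<le> nat (k mod int p)" using least[of "nat (k mod int p)"] by simp
    moreover have "k mod int p < int p" using p(1) by simp
    ultimately show False using pos by (simp add: le_nat_iff)
  qed
  have p1: "p \<noteq> 1" using p(2) x by (auto simp: D_def)
  define H' where "H' = {y. \<exists>k. y - of_int k * x \<in> H}"
  have "sub H'"
    unfolding sub_def
  proof (intro conjI ballI)
    show "0 \<in> H'" unfolding H'_def using H0 by (auto intro!: exI[of _ 0])
    fix a b assume "a \<in> H'" "b \<in> H'"
    then obtain k l where kl: "a - of_int k * x \<in> H" "b - of_int l * x \<in> H" by (auto simp: H'_def)
    have "(a - b) - of_int (k - l) * x = (a - of_int k * x) - (b - of_int l * x)" by (simp add: algebra_simps)
    then have "(a - b) - of_int (k - l) * x \<in> H" using Hd[OF kl] by (simp only:)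
    then show "a - b \<in> H'" unfolding H'_def by blast
  qed
  moreover have "H \<subseteq> H'" unfolding H'_def by (auto intro!: exI[of _ 0])
  moreover have "x \<in> H'" unfolding H'_def using H0 by (auto intro!: exI[of _ 1])
  ultimately have "H' = UNIV" using max[of H'] x by blast
  then have ex: "\<exists>k. y - of_int k * x \<in> H" for y unfolding H'_def by blast
  \<comment> \<open>Maximality of \<open>H\<close> puts every y into the coset of some multiple k x.
    The choice of k is unique modulo p, which a p-th root of unity does not notice.\<close>
  define \<kappa> where "\<kappa> y = (SOME k. y - of_int k * x \<in> H)" for y
  have \<kappa>: "y - of_int (\<kappa> y) * x \<in> H" for y unfolding \<kappa>_def by (rule someI_ex[OF ex])
  define \<phi> where "\<phi> y = cis (2 * pi * of_int (\<kappa> y) / of_nat p)" for y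
  have \<phi>: "\<phi> y = cis (2 * pi * of_int k / of_nat p)" if "y - of_int k * x \<in> H" for y k
  proof -
    have "(y - of_int k * x) - (y - of_int (\<kappa> y) * x) \<in> H" by (rule Hd[OF that \<kappa>])
    moreover have "(y - of_int k * x) - (y - of_int (\<kappa> y) * x) = of_int (\<kappa> y - k) * x"
      by (simp add: algebra_simps)
    ultimately have "\<kappa> y - k \<in> D" by (simp only: D_def mem_Collect_eq)
    then show ?thesis unfolding \<phi>_def by (intro cis_eq_if_dvd Ddvd p(1))
  qed
  have add: "\<phi> (y + z) = \<phi> y * \<phi> z" for y z
  proof -
    have "(y - of_int (\<kappa> y) * x) + (z - of_int (\<kappa> z) * x) \<in> H" by (rule Ha[OF \<kappa> \<kappa>])
    moreover have "(y - of_int (\<kappa> y) * x) + (z - of_int (\<kappa> z) * x) = (y + z) - of_int (\<kappa> y + \<kappa> z) * x"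
      by (simp add: algebra_simps)
    ultimately have "(y + z) - of_int (\<kappa> y + \<kappa> z) * x \<in> H" by (simp only:)
    then have "\<phi> (y + z) = cis (2 * pi * of_int (\<kappa> y + \<kappa> z) / of_nat p)" by (rule \<phi>)
    also have "\<dots> = \<phi> y * \<phi> z"
      unfolding \<phi>_def cis_mult by (simp add: algebra_simps add_divide_distrib)
    finally show ?thesis .
  qed
  have unit: "\<phi> y * cnj (\<phi> y) = 1" for y unfolding \<phi>_def by (simp add: cis_cnj cis_mult)
  have "\<phi> x \<noteq> 1"
  proof
    assume "\<phi> x = 1"
    moreover have "\<phi> x = cis (2 * pi / of_nat p)" using \<phi>[of x 1] H0 by simp
    ultimately have "cos (2 * pi / of_nat p) = 1" by (metis cis.simps(1) one_complex.simps(1))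
    then obtain n where "2 * pi / of_nat p = of_int n * 2 * pi" using cos_one_2pi_int[of "2 * pi / of_nat p"] by auto
    then have "1 = of_int n * (of_nat p :: real)" using p(1) by (simp add: field_simps)
    then have "1 = n * int p" by (metis of_int_eq_iff of_int_mult of_int_of_nat_eq of_int_1)
    then have "int p dvd 1" by (metis dvd_triv_right)
    then show False using p1 by simp
  qed
  then show ?thesis using add unit by blast
qed

text \<open>A nonzero a sends x0 / a to x0, where \<phi> is nontrivial; the multiples of one
  additive character thus give a perfect pairing.\<close>

lemma bichar_field:
  fixes \<phi> :: "'f::{field, finite} \<Rightarrow> complex"
  assumes "\<And>x y. \<phi> (x + y) = \<phi> x * \<phi> y" "\<And>x. \<phi> x * cnj (\<phi> x) = 1" "\<phi> x0 \<noteq> 1"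
  shows "bichar (\<lambda>a d. \<phi> (a * d))"
proof
  fix a assume *: "\<And>d. \<phi> (a * d) = 1"
  show "a = 0"
  proof (rule ccontr)
    assume "a \<noteq> 0"
    then have "a * (x0 / a) = x0" by simp
    then show False using *[of "x0 / a"] assms(3) by simp
  qed
next
  fix d assume *: "\<And>a. \<phi> (a * d) = 1"
  show "d = 0"
  proof (rule ccontr)
    assume "d \<noteq> 0"
    then have "(x0 / d) * d = x0" by simp
    then show False using *[of "x0 / d"] assms(3) by simp
  qed
qed (simp_all add: assms distrib_left distrib_right)

section \<open>The method of little groups\<close>

lemma card_range_eq_if_same_kernel:
  assumes "\<And>b b'. F b = F b' \<longleftrightarrow> R b = R b'"
  shows "card (range F) = card (range R)"
proof (rule bij_betw_same_card)
  show "bij_betw (\<lambda>y. R (inv_into UNIV F y)) (range F) (range R)"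
    unfolding bij_betw_def
  proof
    have R: "R (inv_into UNIV F (F b)) = R b" for b
      using assms by (metis f_inv_into_f rangeI)
    show "inj_on (\<lambda>y. R (inv_into UNIV F y)) (range F)"
      using R assms by (auto simp: inj_on_def)
    show "(\<lambda>y. R (inv_into UNIV F y)) ` range F = range R" using R by (auto simp: image_iff)
  qed
qed

text \<open>The maps \<open>tc\<close> and \<open>dc\<close> exhibit a quotient of \<open>G\<close> as a semidirect product of \<open>'s\<close> and \<open>'v\<close>; the characters of
  \<open>'v\<close> are the \<open>\<psi> a\<close>, and \<open>act\<close> is the action on them dual to the conjugation \<open>M\<close>.\<close>

locale little_group = group G + S: bichar \<beta> + V: bichar \<psi>
  for G :: "('a, 'b) monoid_scheme" (structure)
    and \<beta> :: "'s::{finite, ab_group_add} \<Rightarrow> 's \<Rightarrow> complex"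
    and \<psi> :: "'v::{finite, ab_group_add} \<Rightarrow> 'v \<Rightarrow> complex" +
  fixes tc :: "'a \<Rightarrow> 's" and dc :: "'a \<Rightarrow> 'v" and M :: "'s \<Rightarrow> 'v \<Rightarrow> 'v" and act :: "'s \<Rightarrow> 'v \<Rightarrow> 'v"
  assumes fin: "finite (carrier G)"
    and tc_mult: "\<lbrakk>g \<in> carrier G; h \<in> carrier G\<rbrakk> \<Longrightarrow> tc (g \<otimes> h) = tc g + tc h"
    and dc_mult: "\<lbrakk>g \<in> carrier G; h \<in> carrier G\<rbrakk> \<Longrightarrow> dc (g \<otimes> h) = M (tc h) (dc g) + dc h"
    and coords_surj: "\<exists>g\<in>carrier G. tc g = t \<and> dc g = d"
    and adj: "\<psi> a (M t d) = \<psi> (act t a) d"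
    and act_zero: "act 0 a = a"
    and act_add: "act (t + t') a = act t (act t' a)"
begin

definition Stab :: "'v \<Rightarrow> 's set" where "Stab a = {t. act t a = a}"

text \<open>The character \<psi> a extended to its inertia group and twisted by \<beta> b. It
  depends on b through the restriction to \<open>Stab a\<close>, so different b may give the same
  function, and the count runs over \<open>range (LG a)\<close>.\<close>

definition LG :: "'v \<Rightarrow> 's \<Rightarrow> 'a \<Rightarrow> complex" where
  "LG a b g = (if g \<in> carrier G \<and> tc g \<in> Stab a then \<beta> b (tc g) * \<psi> a (dc g) else 0)"

definition K :: "'a set" where "K = {g \<in> carrier G. tc g = 0}"

lemma tc_one: "tc \<one> = 0" using tc_mult[of \<one> \<one>] by simp

lemma tc_inv: "g \<in> carrier G \<Longrightarrow> tc (inv g) = - tc g"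
  using tc_mult[of g "inv g"] tc_one by (simp add: eq_neg_iff_add_eq_0 add.commute)

text \<open>\<open>M 0\<close> is known through its pairing with characters, so the equation is
  tested against each \<psi> a.\<close>

lemma dc_one: "dc \<one> = 0"
proof (rule V.nondeg_r)
  fix a
  have "\<psi> a (dc \<one>) = \<psi> a (dc \<one>) * \<psi> a (dc \<one>)"
    using arg_cong[OF dc_mult[of \<one> \<one>], of "\<psi> a"] by (simp add: tc_one V.add_r adj act_zero)
  then show "\<psi> a (dc \<one>) = 1" using V.nz[of a "dc \<one>"] by simp
qed

lemma act_commute: "act t (act u a) = act u (act t a)"
  by (simp only: act_add[symmetric] add.commute)

lemma act_uminus: "act (- t) (act t a) = a" "act t (act (- t) a) = a"
  by (simp_all add: act_add[symmetric] act_zero)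

lemma Stab_zero: "0 \<in> Stab a" by (simp add: Stab_def act_zero)

lemma Stab_add: "\<lbrakk>s \<in> Stab a; t \<in> Stab a\<rbrakk> \<Longrightarrow> s + t \<in> Stab a" by (simp add: Stab_def act_add)

lemma Stab_uminus: "t \<in> Stab a \<Longrightarrow> - t \<in> Stab a" using act_uminus(1)[of t a] by (simp add: Stab_def)

lemma Stab_act: "Stab (act t a) = Stab a"
proof -
  have "act u (act t a) = act t a \<longleftrightarrow> act u a = a" for u
    using act_commute[of u t a] by (metis act_uminus(1))
  then show ?thesis by (simp add: Stab_def)
qed

lemma LG_nz: "g \<in> carrier G \<Longrightarrow> LG a b g \<noteq> 0 \<longleftrightarrow> tc g \<in> Stab a"
  by (simp add: LG_def S.nz V.nz)

lemma LG_eq: "\<lbrakk>g \<in> carrier G; tc g \<in> Stab a\<rbrakk> \<Longrightarrow> LG a b g = \<beta> b (tc g) * \<psi> a (dc g)"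
  by (simp add: LG_def)

lemma LG_K: "g \<in> K \<Longrightarrow> LG a b g = \<psi> a (dc g)"
  by (simp add: K_def LG_def Stab_zero)

lemma K_normal: "K \<lhd> G"
proof (rule normal_invI)
  show "subgroup K G"
    by (rule subgroupI) (auto simp: K_def tc_inv tc_mult intro!: exI[of _ \<one>] tc_one)
  show "g \<otimes> h \<otimes> inv g \<in> K" if "g \<in> carrier G" "h \<in> K" for g h
    using that by (simp add: K_def tc_mult tc_inv)
qed

text \<open>Conjugation enters through (s g s^-1) s = s g, which needs no formula for the
  coordinates of an inverse.\<close>

lemma dc_conj:
  assumes s: "s \<in> carrier G" and g: "g \<in> carrier G"
  shows "\<psi> (act (tc s) a) (dc (s \<otimes> g \<otimes> inv s)) * \<psi> a (dc s) = \<psi> (act (tc g) a) (dc s) * \<psi> a (dc g)"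
proof -
  have "(s \<otimes> g \<otimes> inv s) \<otimes> s = s \<otimes> g" using s g by (simp add: m_assoc)
  then have "\<psi> a (dc ((s \<otimes> g \<otimes> inv s) \<otimes> s)) = \<psi> a (dc (s \<otimes> g))" by simp
  then show ?thesis using s g by (simp only: dc_mult m_closed inv_closed V.add_r adj)
qed

text \<open>Conjugation by s moves a along its orbit. The index b stays the same, because
  \<open>'s\<close> is abelian: \<open>tc\<close> is invariant under conjugation and
  \<open>Stab\<close> is constant on orbits.\<close>

lemma LG_conj:
  assumes s: "s \<in> carrier G" and g: "g \<in> carrier G"
  shows "LG (act (tc s) a) b (s \<otimes> g \<otimes> inv s) = LG a b g"
proof -
  have tc: "tc (s \<otimes> g \<otimes> inv s) = tc g" using s g by (simp add: tc_mult tc_inv)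
  show ?thesis
  proof (cases "tc g \<in> Stab a")
    case True
    then have "act (tc g) a = a" by (simp add: Stab_def)
    then have "\<psi> (act (tc s) a) (dc (s \<otimes> g \<otimes> inv s)) * \<psi> a (dc s) = \<psi> a (dc g) * \<psi> a (dc s)"
      using dc_conj[OF s g, of a] by (simp add: mult.commute)
    then have "\<psi> (act (tc s) a) (dc (s \<otimes> g \<otimes> inv s)) = \<psi> a (dc g)" using V.nz mult_right_cancel by blast
    then show ?thesis using True s g tc by (simp add: LG_def Stab_act)
  qed (use s g tc in \<open>simp add: LG_def Stab_act\<close>)
qed

lemma LG_conj':
  assumes s: "s \<in> carrier G" and g: "g \<in> carrier G"
  shows "LG a b (s \<otimes> g \<otimes> inv s) = LG (act (- tc s) a) b g"
  using LG_conj[OF s g, of "act (- tc s) a" b] by (simp only: act_uminus)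

lemma LG_mult:
  assumes "g \<in> carrier G" "h \<in> carrier G" "tc g \<in> Stab a" "tc h \<in> Stab a"
  shows "LG a b (g \<otimes> h) = LG a b g * LG a b h"
proof -
  have "act (tc h) a = a" using assms by (simp add: Stab_def)
  then show ?thesis
    using assms Stab_add[OF assms(3,4)]
    by (simp add: LG_def tc_mult dc_mult S.add_r V.add_r adj)
qed

lemma LG_datum: "mono_datum G K (LG a b)"
proof (intro mono_datum.intro mono_datum_axioms.intro)
  show "group G" by (rule is_group)
  show "finite (carrier G)" by (rule fin)
  show "K \<lhd> G" by (rule K_normal)
  show "LG a b (g \<otimes> h) = LG a b g * LG a b h"
    if "g \<in> carrier G" "h \<in> carrier G" "LG a b g \<noteq> 0" "LG a b h \<noteq> 0" for g h
    using that LG_mult by (simp add: LG_nz)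
  show "LG a b (inv g) = cnj (LG a b g)" if g: "g \<in> carrier G" "LG a b g \<noteq> 0" for g
  proof -
    have t: "tc g \<in> Stab a" using g LG_nz by simp
    have "LG a b g * LG a b (inv g) = LG a b \<one>"
      using LG_mult[of g "inv g" a b] g t Stab_uminus[OF t] by (simp add: tc_inv)
    also have "\<dots> = 1" by (simp add: LG_def tc_one dc_one Stab_zero)
    also have "\<dots> = LG a b g * cnj (LG a b g)"
    proof -
      have "LG a b g * cnj (LG a b g) = (\<beta> b (tc g) * cnj (\<beta> b (tc g))) * (\<psi> a (dc g) * cnj (\<psi> a (dc g)))"
        unfolding LG_eq[OF g(1) t] by (simp add: ac_simps)
      then show ?thesis by (simp only: S.unit V.unit mult_1)
    qed
    finally show ?thesis using g(2) mult_left_cancel by blast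
  qed
  show "LG a b n \<noteq> 0" if "n \<in> K" for n using LG_K[OF that] V.nz by simp
  show "LG a b g \<noteq> 0" if g: "g \<in> carrier G" and st: "\<And>n. n \<in> K \<Longrightarrow> LG a b (g \<otimes> n \<otimes> inv g) = LG a b n" for g
  proof -
    \<comment> \<open>Already on \<open>K\<close> the coordinate \<open>dc\<close> takes every
      value, so a character fixed there has a fixed index.\<close>
    have "act (- tc g) a = a"
    proof (rule V.ext_l)
      fix d
      obtain n where n: "n \<in> carrier G" "tc n = 0" "dc n = d" using coords_surj[of 0 d] by blast
      then have nK: "n \<in> K" by (simp add: K_def)
      show "\<psi> (act (- tc g) a) d = \<psi> a d"
        using st[OF nK] LG_conj'[OF g n(1), of a b] LG_K[OF nK] n(3) by simp
    qed
    then have "- tc g \<in> Stab a" by (simp add: Stab_def)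
    then have "tc g \<in> Stab a" using Stab_uminus by fastforce
    then show ?thesis using g by (simp add: LG_nz)
  qed
qed

lemma card_tc: "card {g \<in> carrier G. tc g \<in> T} = card K * card T"
proof -
  have fib: "card {g \<in> carrier G. tc g = t} = card K" for t
  proof -
    obtain u where u: "u \<in> carrier G" "tc u = t" using coords_surj by blast
    show ?thesis
      by (rule bij_betw_same_card[of "\<lambda>g. g \<otimes> inv u"],
          rule bij_betw_byWitness[where f' = "\<lambda>g. g \<otimes> u"])
        (use u in \<open>auto simp: K_def tc_mult tc_inv m_assoc\<close>)
  qed
  have "card {g \<in> carrier G. tc g \<in> T} = (\<Sum>t\<in>T. card {g \<in> carrier G. tc g = t})"
  proof -
    have "{g \<in> carrier G. tc g \<in> T} = (\<Union>t\<in>T. {g \<in> carrier G. tc g = t})" by auto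
    also have "card \<dots> = (\<Sum>t\<in>T. card {g \<in> carrier G. tc g = t})"
      by (rule card_UN_disjoint) (use fin in auto)
    finally show ?thesis .
  qed
  then show ?thesis by (simp add: fib)
qed

lemma card_K_pos: "card K > 0"
  using fin tc_one by (auto simp: card_gt_0_iff K_def intro!: exI[of _ \<one>])

lemma card_carrier: "card (carrier G) = card K * card (UNIV :: 's set)"
  using card_tc[of UNIV] by simp

lemma LG_supp: "{g \<in> carrier G. LG a b g \<noteq> 0} = {g \<in> carrier G. tc g \<in> Stab a}"
  using LG_nz by blast

lemma LG_degree: "of_nat (card (Stab a)) * ind_char G (LG a b) \<one> = of_nat (card (UNIV :: 's set))"
proof -
  interpret mono_datum G K "LG a b" by (rule LG_datum)
  have "ind_char G (LG a b) \<one> = of_nat (card K * card (UNIV :: 's set)) / of_nat (card K * card (Stab a))"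
    unfolding ind_char_one LG_supp card_tc card_carrier ..
  moreover have "Stab a \<noteq> {}" using Stab_zero by blast
  ultimately show ?thesis using card_K_pos by (simp add: field_simps)
qed

text \<open>Conjugates of z stay in \<open>K\<close>, where evaluating them amounts to letting a run
  through its orbit.\<close>

lemma LG_kernel:
  assumes z: "z \<in> K"
  shows "ind_char G (LG a b) z = ind_char G (LG a b) \<one> \<longleftrightarrow> (\<forall>t. \<psi> (act t a) (dc z) = 1)"
proof -
  interpret mono_datum G K "LG a b" by (rule LG_datum)
  have zc: "z \<in> carrier G" using z by (simp add: K_def)
  have "LG a b (g \<otimes> z \<otimes> inv g) = \<psi> (act (- tc g) a) (dc z)" if "g \<in> carrier G" for g
    using LG_conj'[OF that zc] LG_K[OF z] by simp
  then have "(\<forall>g\<in>carrier G. LG a b (g \<otimes> z \<otimes> inv g) = 1) \<longleftrightarrow> (\<forall>g\<in>carrier G. \<psi> (act (- tc g) a) (dc z) = 1)"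
    by simp
  also have "\<dots> \<longleftrightarrow> (\<forall>t. \<psi> (act t a) (dc z) = 1)"
    using coords_surj by (metis minus_minus)
  finally show ?thesis using ind_char_eq_one_iff[OF zc] by simp
qed

lemma LG_inj: "LG a b = LG a' b' \<Longrightarrow> a = a'"
proof (rule V.ext_l)
  fix d assume eq: "LG a b = LG a' b'"
  obtain n where n: "n \<in> carrier G" "tc n = 0" "dc n = d" using coords_surj[of 0 d] by blast
  then have nK: "n \<in> K" by (simp add: K_def)
  show "\<psi> a d = \<psi> a' d" using LG_K[OF nK, of a b] LG_K[OF nK, of a' b'] n(3) eq by simp
qed

lemma card_range_LG: "card (range (LG a)) = card (Stab a)"
proof -
  have "LG a b = LG a b' \<longleftrightarrow> restrict (\<beta> b) (Stab a) = restrict (\<beta> b') (Stab a)" for b b'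
  proof
    assume eq: "LG a b = LG a b'"
    have "\<beta> b t = \<beta> b' t" if t: "t \<in> Stab a" for t
    proof -
      obtain g where g: "g \<in> carrier G" "tc g = t" using coords_surj by blast
      have "\<beta> b t * \<psi> a (dc g) = \<beta> b' t * \<psi> a (dc g)"
        using fun_cong[OF eq, of g] g t by (simp add: LG_def)
      then show ?thesis using V.nz by simp
    qed
    then show "restrict (\<beta> b) (Stab a) = restrict (\<beta> b') (Stab a)" by (simp add: restrict_def fun_eq_iff)
  next
    assume eq: "restrict (\<beta> b) (Stab a) = restrict (\<beta> b') (Stab a)"
    have "\<beta> b t = \<beta> b' t" if t: "t \<in> Stab a" for t using fun_cong[OF eq, of t] t by simp
    then show "LG a b = LG a b'" by (simp add: LG_def fun_eq_iff)
  qed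
  then have "card (range (LG a)) = card (range (\<lambda>b. restrict (\<beta> b) (Stab a)))"
    by (rule card_range_eq_if_same_kernel)
  also have "\<dots> = card (Stab a)"
    by (rule S.card_restrictions) (use Stab_zero Stab_add Stab_uminus in auto)
  finally show ?thesis .
qed

text \<open>There are |Q| m different functions \<open>LG a b\<close>, each with support of order
  |K| m, and the group has order |K| |S|; the factor |K| cancels from
  \<open>card_ind_char_image\<close>.\<close>

theorem card_little_group_chars:
  assumes m: "\<And>a. a \<in> Q \<Longrightarrow> card (Stab a) = m"
    and inv: "\<And>a t. a \<in> Q \<Longrightarrow> act t a \<in> Q"
  shows "card {ind_char G (LG a b) | a b. a \<in> Q} * card (UNIV :: 's set) = card Q * m\<^sup>2"
proof -
  define \<L> where "\<L> = (\<Union>a\<in>Q. range (LG a))"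
  have "card \<L> = (\<Sum>a\<in>Q. card (range (LG a)))"
    unfolding \<L>_def by (rule card_UN_disjoint) (use LG_inj in auto)
  then have card\<L>: "card \<L> = card Q * m" using m by (simp add: card_range_LG)
  have "card (ind_char G ` \<L>) * card (carrier G) = card \<L> * (card K * m)"
  proof (rule card_ind_char_image)
    show "finite \<L>" unfolding \<L>_def by simp
    show "mono_datum G K L" if "L \<in> \<L>" for L using that LG_datum by (auto simp: \<L>_def)
    show "L g = 0" if "L \<in> \<L>" "g \<notin> carrier G" for L g using that by (auto simp: \<L>_def LG_def)
    show "(\<lambda>g. if g \<in> carrier G then L (s \<otimes> g \<otimes> inv s) else 0) \<in> \<L>" if L: "L \<in> \<L>" and s: "s \<in> carrier G" for L s
    proof -
      obtain a b where a: "a \<in> Q" "L = LG a b" using L by (auto simp: \<L>_def)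
      have "(\<lambda>g. if g \<in> carrier G then L (s \<otimes> g \<otimes> inv s) else 0) = LG (act (- tc s) a) b"
        using LG_conj'[OF s] a(2) by (auto simp: LG_def)
      then show ?thesis using inv[OF a(1)] unfolding \<L>_def by blast
    qed
    show "card {g \<in> carrier G. L g \<noteq> 0} = card K * m" if L: "L \<in> \<L>" for L
    proof -
      obtain a b where a: "a \<in> Q" "L = LG a b" using L by (auto simp: \<L>_def)
      then show ?thesis by (simp only: LG_supp card_tc m)
    qed
  qed
  then have "card K * (card (ind_char G ` \<L>) * card (UNIV :: 's set)) = card K * (card Q * m\<^sup>2)"
    by (simp add: card_carrier card\<L> power2_eq_square ac_simps)
  then have "card (ind_char G ` \<L>) * card (UNIV :: 's set) = card Q * m\<^sup>2" using card_K_pos by simp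
  moreover have "ind_char G ` \<L> = {ind_char G (LG a b) | a b. a \<in> Q}" by (auto simp: \<L>_def)
  ultimately show ?thesis by simp
qed

text \<open>Summing over all \<open>b\<close> and then all \<open>a\<close> isolates the kernel of the quotient map.\<close>

lemma LG_complete:
  assumes "\<And>a b. (\<Sum>g\<in>carrier G. cnj (LG a b g) * f g) = 0"
  shows "(\<Sum>g | g \<in> carrier G \<and> tc g = 0 \<and> dc g = 0. f g) = 0"
proof -
  let ?s = "of_nat (card (UNIV :: 's set)) :: complex" and ?v = "of_nat (card (UNIV :: 'v set)) :: complex"
  have b: "(\<Sum>b\<in>UNIV. cnj (LG a b g)) = (if tc g = 0 then ?s * cnj (\<psi> a (dc g)) else 0)"
    if "g \<in> carrier G" for a g
  proof (cases "tc g \<in> Stab a")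
    case True
    then have "(\<Sum>b\<in>UNIV. cnj (LG a b g)) = (\<Sum>b\<in>UNIV. cnj (\<beta> b (tc g))) * cnj (\<psi> a (dc g))"
      using that by (simp add: LG_def sum_distrib_right)
    then show ?thesis by (simp add: S.sum_l_cnj)
  next
    case False
    then show ?thesis using Stab_zero by (auto simp: LG_def)
  qed
  have ab: "(\<Sum>a\<in>UNIV. \<Sum>b\<in>UNIV. cnj (LG a b g)) = (if tc g = 0 \<and> dc g = 0 then ?s * ?v else 0)"
    if "g \<in> carrier G" for g
  proof -
    have "(\<Sum>a\<in>UNIV. \<Sum>b\<in>UNIV. cnj (LG a b g)) = (if tc g = 0 then ?s * (\<Sum>a\<in>UNIV. cnj (\<psi> a (dc g))) else 0)"
      using b[OF that] by (simp add: sum_distrib_left)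
    then show ?thesis by (simp add: V.sum_l_cnj)
  qed
  have "0 = (\<Sum>a\<in>UNIV. \<Sum>b\<in>UNIV. \<Sum>g\<in>carrier G. cnj (LG a b g) * f g)" using assms by simp
  also have "\<dots> = (\<Sum>a\<in>UNIV. \<Sum>g\<in>carrier G. \<Sum>b\<in>UNIV. cnj (LG a b g) * f g)"
    by (intro sum.cong refl sum.swap)
  also have "\<dots> = (\<Sum>g\<in>carrier G. (\<Sum>a\<in>UNIV. \<Sum>b\<in>UNIV. cnj (LG a b g)) * f g)"
    by (subst sum.swap) (simp add: sum_distrib_right)
  also have "\<dots> = (\<Sum>g\<in>carrier G. if tc g = 0 \<and> dc g = 0 then ?s * ?v * f g else 0)"
    using ab by (intro sum.cong) auto
  also have "\<dots> = (\<Sum>g | g \<in> carrier G \<and> tc g = 0 \<and> dc g = 0. ?s * ?v * f g)"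
    using fin by (simp add: sum.inter_filter[symmetric])
  also have "\<dots> = ?s * ?v * (\<Sum>g | g \<in> carrier G \<and> tc g = 0 \<and> dc g = 0. f g)"
    by (rule sum_distrib_left[symmetric])
  finally show ?thesis by simp
qed

end

section \<open>Coordinates on the unipotent group\<close>

locale UD4 =
  fixes G :: "('g, 'b) monoid_scheme" (structure) and x :: "nat \<Rightarrow> 'f::{field, finite} \<Rightarrow> 'g"
  assumes U: "is_UD4 G x"

sublocale UD4 \<subseteq> group G
  using U by (simp add: is_UD4_def)

context UD4
begin

lemma x_closed: "\<lbrakk>1 \<le> i; i \<le> 12\<rbrakk> \<Longrightarrow> x i t \<in> carrier G"
  using U by (simp add: is_UD4_def)

lemma x_add: "\<lbrakk>1 \<le> i; i \<le> 12\<rbrakk> \<Longrightarrow> x i t \<otimes> x i u = x i (t + u)"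
  using U by (simp add: is_UD4_def)

lemma x_zero: "\<lbrakk>1 \<le> i; i \<le> 12\<rbrakk> \<Longrightarrow> x i 0 = \<one>"
  using x_add[of i 0 0] x_closed[of i 0] by (simp add: l_cancel_one')

lemma D4_comm_range: "D4_comm i j = Some (k, s) \<Longrightarrow> 1 \<le> k \<and> k \<le> 12"
  unfolding D4_comm_def by (drule map_of_SomeD) auto

text \<open>Oriented so that rewriting moves the smaller index to the left. The commutator
  contributes a root of larger index than both, so collecting a word comes to an end.\<close>

lemma x_swap:
  assumes "1 \<le> i" "i < j" "j \<le> 12"
  shows "x j u \<otimes> x i t = x i t \<otimes> (x j u \<otimes>
    (case D4_comm i j of None \<Rightarrow> \<one> | Some (k, s) \<Rightarrow> x k (- (of_int s * t * u))))"
proof -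
  have c: "x i t \<in> carrier G" "x j u \<in> carrier G" using assms x_closed by auto
  let ?k = "commutator G (x i t) (x j u)"
  have kc: "?k \<in> carrier G" using c by (simp add: commutator_def)
  have "x j u \<otimes> x i t \<otimes> ?k = x i t \<otimes> x j u"
    using c by (simp add: commutator_def m_assoc) (simp add: m_assoc[symmetric])
  then have "x j u \<otimes> x i t = x i t \<otimes> x j u \<otimes> inv ?k"
    using c kc by (metis inv_solve_right m_closed)
  moreover have "?k = (case D4_comm i j of None \<Rightarrow> \<one> | Some (k, s) \<Rightarrow> x k (of_int s * t * u))"
    using U assms unfolding is_UD4_def by blast
  moreover have "inv (x k w) = x k (- w)" if "D4_comm i j = Some (k, s)" for k s w
  proof (rule inv_equality)
    have k: "1 \<le> k" "k \<le> 12" using D4_comm_range[OF that] by auto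
    show "x k (- w) \<otimes> x k w = \<one>" using k by (simp add: x_add x_zero)
    show "x k w \<in> carrier G" "x k (- w) \<in> carrier G" using k x_closed by auto
  qed
  ultimately show ?thesis
    using c x_closed D4_comm_range by (auto simp: m_assoc split: option.splits)
qed

lemma x_swap_left:
  assumes "1 \<le> i" "i < j" "j \<le> 12" "w \<in> carrier G"
  shows "x j u \<otimes> (x i t \<otimes> w) = x i t \<otimes> (x j u \<otimes>
    ((case D4_comm i j of None \<Rightarrow> \<one> | Some (k, s) \<Rightarrow> x k (- (of_int s * t * u))) \<otimes> w))"
proof -
  have c: "x i t \<in> carrier G" "x j u \<in> carrier G" using assms x_closed by auto
  let ?k = "case D4_comm i j of None \<Rightarrow> \<one> | Some (k, s) \<Rightarrow> x k (- (of_int s * t * u))"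
  have k: "?k \<in> carrier G" using x_closed D4_comm_range by (auto split: option.splits)
  have "x j u \<otimes> (x i t \<otimes> w) = x j u \<otimes> x i t \<otimes> w" using c assms by (simp add: m_assoc)
  also have "\<dots> = x i t \<otimes> (x j u \<otimes> ?k) \<otimes> w" by (simp only: x_swap[OF assms(1-3)])
  finally show ?thesis using c k assms(4) by (simp only: m_assoc m_closed)
qed

lemma x_add_left: "\<lbrakk>1 \<le> i; i \<le> 12; w \<in> carrier G\<rbrakk> \<Longrightarrow> x i t \<otimes> (x i u \<otimes> w) = x i (t + u) \<otimes> w"
  by (simp add: m_assoc[symmetric] x_closed x_add)

lemmas word_simps = m_assoc x_closed x_add x_add_left x_swap x_swap_left

definition W :: "'f \<Rightarrow> 'f \<Rightarrow> 'f \<Rightarrow> 'f \<Rightarrow> 'f \<Rightarrow> 'f \<Rightarrow> 'f \<Rightarrow> 'f \<Rightarrow> 'f \<Rightarrow> 'f \<Rightarrow> 'f \<Rightarrow> 'f \<Rightarrow> 'g" where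
  "W c1 c2 c3 c4 c5 c6 c7 c8 c9 c10 c11 c12 =
    x 1 c1 \<otimes> (x 2 c2 \<otimes> (x 3 c3 \<otimes> (x 4 c4 \<otimes> (x 5 c5 \<otimes> (x 6 c6 \<otimes> (x 7 c7 \<otimes>
    (x 8 c8 \<otimes> (x 9 c9 \<otimes> (x 10 c10 \<otimes> (x 11 c11 \<otimes> x 12 c12))))))))))"

text \<open>Collection is done once per root for a single factor on the right. A product of two
  normal forms then takes twelve substitutions instead of one large rewriting.\<close>

lemma W_x1: "W c1 c2 c3 c4 c5 c6 c7 c8 c9 c10 c11 c12 \<otimes> x 1 u = W (c1 + u) c2 c3 c4 (c5 - c3 * u) c6 c7 (c8 + c6 * u) (c9 - c7 * u - c3 * c4 * u) c10 (c11 + c10 * u) (c12 - c6 * c7 * u - c3 * c4 * c6 * u)"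
  by (simp add: W_def word_simps D4_comm_def algebra_simps)

lemma W_x2: "W c1 c2 c3 c4 c5 c6 c7 c8 c9 c10 c11 c12 \<otimes> x 2 u = W c1 (c2 + u) c3 c4 c5 (c6 - c3 * u) c7 (c8 + c5 * u) c9 (c10 - c7 * u - c3 * c4 * u) (c11 + c9 * u) (c12 - c5 * c7 * u - c3 * c4 * c5 * u)"
  by (simp add: W_def word_simps D4_comm_def algebra_simps)

lemma W_x3: "W c1 c2 c3 c4 c5 c6 c7 c8 c9 c10 c11 c12 \<otimes> x 3 u = W c1 c2 (c3 + u) c4 c5 c6 (c7 - c4 * u) c8 c9 c10 c11 (c12 + c11 * u)"
  by (simp add: W_def word_simps D4_comm_def algebra_simps)

lemma W_x4: "W c1 c2 c3 c4 c5 c6 c7 c8 c9 c10 c11 c12 \<otimes> x 4 u = W c1 c2 c3 (c4 + u) c5 c6 c7 c8 (c9 + c5 * u) (c10 + c6 * u) (c11 + c8 * u) (c12 + c5 * c6 * u)"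
  by (simp add: W_def word_simps D4_comm_def algebra_simps)

lemma W_x5: "W c1 c2 c3 c4 c5 c6 c7 c8 c9 c10 c11 c12 \<otimes> x 5 u = W c1 c2 c3 c4 (c5 + u) c6 c7 c8 c9 c10 c11 (c12 + c10 * u)"
  by (simp add: W_def word_simps D4_comm_def algebra_simps)

lemma W_x6: "W c1 c2 c3 c4 c5 c6 c7 c8 c9 c10 c11 c12 \<otimes> x 6 u = W c1 c2 c3 c4 c5 (c6 + u) c7 c8 c9 c10 c11 (c12 + c9 * u)"
  by (simp add: W_def word_simps D4_comm_def algebra_simps)

lemma W_x7: "W c1 c2 c3 c4 c5 c6 c7 c8 c9 c10 c11 c12 \<otimes> x 7 u = W c1 c2 c3 c4 c5 c6 (c7 + u) c8 c9 c10 c11 (c12 - c8 * u)"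
  by (simp add: W_def word_simps D4_comm_def algebra_simps)

lemma W_x8: "W c1 c2 c3 c4 c5 c6 c7 c8 c9 c10 c11 c12 \<otimes> x 8 u = W c1 c2 c3 c4 c5 c6 c7 (c8 + u) c9 c10 c11 c12"
  by (simp add: W_def word_simps D4_comm_def algebra_simps)

lemma W_x9: "W c1 c2 c3 c4 c5 c6 c7 c8 c9 c10 c11 c12 \<otimes> x 9 u = W c1 c2 c3 c4 c5 c6 c7 c8 (c9 + u) c10 c11 c12"
  by (simp add: W_def word_simps D4_comm_def algebra_simps)

lemma W_x10: "W c1 c2 c3 c4 c5 c6 c7 c8 c9 c10 c11 c12 \<otimes> x 10 u = W c1 c2 c3 c4 c5 c6 c7 c8 c9 (c10 + u) c11 c12"
  by (simp add: W_def word_simps D4_comm_def algebra_simps)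

lemma W_x11: "W c1 c2 c3 c4 c5 c6 c7 c8 c9 c10 c11 c12 \<otimes> x 11 u = W c1 c2 c3 c4 c5 c6 c7 c8 c9 c10 (c11 + u) c12"
  by (simp add: W_def word_simps D4_comm_def algebra_simps)

lemma W_x12: "W c1 c2 c3 c4 c5 c6 c7 c8 c9 c10 c11 c12 \<otimes> x 12 u = W c1 c2 c3 c4 c5 c6 c7 c8 c9 c10 c11 (c12 + u)"
  by (simp add: W_def word_simps D4_comm_def algebra_simps)


end

section \<open>The group law in coordinates\<close>

type_synonym 'f tri = "'f \<times> 'f \<times> 'f"
type_synonym 'f vec8 = "'f \<times> 'f tri \<times> 'f tri \<times> 'f"

text \<open>Coordinates \<open>(d\<^sub>3, (d\<^sub>5, d\<^sub>6, d\<^sub>7), (d\<^sub>8, d\<^sub>9, d\<^sub>1\<^sub>0), d\<^sub>1\<^sub>1)\<close> are indexed by the roots. Conjugation of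
  \<open>X\<^sub>3 X\<^sub>5 \<dots> X\<^sub>1\<^sub>1\<close> modulo \<open>X\<^sub>1\<^sub>2\<close> by \<open>x\<^sub>1(t\<^sub>1) x\<^sub>2(t\<^sub>2) x\<^sub>4(t\<^sub>4)\<close> is \<open>conjM\<close>, its transpose is \<open>dualM\<close>, and \<open>coc\<close> is the
  contribution of a product to the \<open>X\<^sub>1\<^sub>2\<close>-coordinate.\<close>

fun conjM :: "'f::field tri \<Rightarrow> 'f vec8 \<Rightarrow> 'f vec8" where
  "conjM (t1, t2, t4) (d3, (d5, d6, d7), (d8, d9, d10), d11) =
    (d3, (d5 - d3 * t1, d6 - d3 * t2, d7 + d3 * t4),
     (d8 + d5 * t2 + d6 * t1 - d3 * t1 * t2, d9 + d5 * t4 - d7 * t1 - d3 * t1 * t4,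
      d10 + d6 * t4 - d7 * t2 - d3 * t2 * t4),
     d11 + d10 * t1 + d8 * t4 + d9 * t2 + d5 * t2 * t4 + d6 * t1 * t4 - d7 * t1 * t2 - d3 * t1 * t2 * t4)"

fun dualM :: "'f::field tri \<Rightarrow> 'f vec8 \<Rightarrow> 'f vec8" where
  "dualM (t1, t2, t4) (a3, (a5, a6, a7), (a8, a9, a10), a11) =
    (a3 - t1 * a5 - t2 * a6 + t4 * a7 - t1 * t2 * a8 - t1 * t4 * a9 - t2 * t4 * a10 - t1 * t2 * t4 * a11,
     (a5 + t2 * a8 + t4 * a9 + t2 * t4 * a11, a6 + t1 * a8 + t4 * a10 + t1 * t4 * a11,
      a7 - t1 * a9 - t2 * a10 - t1 * t2 * a11),
     (a8 + t4 * a11, a9 + t2 * a11, a10 + t1 * a11), a11)"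

fun coc :: "'f::field tri \<Rightarrow> 'f vec8 \<Rightarrow> 'f vec8 \<Rightarrow> 'f" where
  "coc (e1, e2, e4) (d3, (d5, d6, d7), (d8, d9, d10), d11) (e3, (e5, e6, e7), _, _) =
    d10 * e5 + d11 * e3 - d8 * e7 + d9 * e6 + d10 * e1 * e3 + d5 * d6 * e4 - d5 * d7 * e2 - d5 * e2 * e7
    + d5 * e4 * e6 - d6 * d7 * e1 - d6 * e1 * e7 + d6 * e4 * e5 - d7 * e1 * e6 - d7 * e2 * e5 + d8 * e3 * e4
    + d9 * e2 * e3 - d3 * d5 * e2 * e4 - d3 * d6 * e1 * e4 + d3 * d7 * e1 * e2 + d3 * e1 * e2 * e7
    - d3 * e1 * e4 * e6 - d3 * e2 * e4 * e5 + d5 * e2 * e3 * e4 + d6 * e1 * e3 * e4 - d7 * e1 * e2 * e3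
    + d3 * d3 * e1 * e2 * e4 - d3 * e1 * e2 * e3 * e4"

lemma fst_conjM: "fst (conjM t d) = fst d"
  by (cases "(t, d)" rule: conjM.cases) simp

lemma fst_snd_conjM: "fst d = 0 \<Longrightarrow> fst (snd (conjM t d)) = fst (snd d)"
  by (cases "(t, d)" rule: conjM.cases) simp

lemma conjM_zero: "conjM 0 d = d"
  by (cases "(0 :: 'a tri, d)" rule: conjM.cases) (auto simp: zero_prod_def)

text \<open>This makes \<open>zc\<close> additive on X_1 X_2 X_4 X_8 ... X_12, the subgroup that
  carries the linear characters nontrivial on X_12.\<close>

lemma coc_zero: "\<lbrakk>fst d = 0; fst (snd d) = 0; fst e = 0; fst (snd e) = 0\<rbrakk> \<Longrightarrow> coc t d e = 0"
  by (cases "(t, d, e)" rule: coc.cases) (auto simp: zero_prod_def)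

lemma coc_zero_right: "\<lbrakk>fst e = 0; fst (snd e) = 0\<rbrakk> \<Longrightarrow> coc 0 d e = 0"
  by (cases "(0 :: 'a tri, d, e)" rule: coc.cases) (auto simp: zero_prod_def)

context UD4
begin

text \<open>The correction in the seventh entry makes \<open>E\<close> the ordered product in which \<open>x\<^sub>4\<close> precedes \<open>x\<^sub>3\<close>.\<close>

fun E :: "'f tri \<times> 'f vec8 \<times> 'f \<Rightarrow> 'g" where
  "E ((t1, t2, t4), (d3, (d5, d6, d7), (d8, d9, d10), d11), z) =
    W t1 t2 d3 t4 d5 d6 (d7 - d3 * t4) d8 d9 d10 d11 z"

declare E.simps [simp del]

lemma W_mult: "W c1 c2 c3 c4 c5 c6 c7 c8 c9 c10 c11 c12 \<otimes> W e1 e2 e3 e4 e5 e6 e7 e8 e9 e10 e11 e12 =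
    W c1 c2 c3 c4 c5 c6 c7 c8 c9 c10 c11 c12 \<otimes> x 1 e1 \<otimes> x 2 e2 \<otimes> x 3 e3 \<otimes> x 4 e4 \<otimes> x 5 e5 \<otimes> x 6 e6
      \<otimes> x 7 e7 \<otimes> x 8 e8 \<otimes> x 9 e9 \<otimes> x 10 e10 \<otimes> x 11 e11 \<otimes> x 12 e12"
  by (simp add: W_def m_assoc x_closed)

lemma E_mult: "E (t, d, z) \<otimes> E (t', d', z') = E (t + t', conjM t' d + d', z + z' + coc t' d d')"
proof -
  obtain t1 t2 t4 where t: "t = (t1, t2, t4)" by (cases t)
  obtain e1 e2 e4 where t': "t' = (e1, e2, e4)" by (cases t')
  obtain d3 d5 d6 d7 d8 d9 d10 d11 where d: "d = (d3, (d5, d6, d7), (d8, d9, d10), d11)"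
    by (cases d) auto
  obtain e3 e5 e6 e7 e8 e9 e10 e11 where d': "d' = (e3, (e5, e6, e7), (e8, e9, e10), e11)"
    by (cases d') auto
  show ?thesis
    unfolding t t' d d' E.simps W_mult W_x1 W_x2 W_x3 W_x4 W_x5 W_x6 W_x7 W_x8 W_x9 W_x10 W_x11 W_x12
      add_Pair conjM.simps coc.simps
    by (simp add: algebra_simps)
qed

lemma E_bij: "bij_betw E UNIV (carrier G)"
proof -
  let ?F = "\<lambda>ds. foldr (\<lambda>i acc. x i (ds ! (i - 1)) \<otimes> acc) [1..<13] \<one>"
  define l where "l = (\<lambda>((t1, t2, t4), (d3, (d5, d6, d7), (d8, d9, d10), d11), z).
    [t1, t2, d3, t4, d5, d6, d7 - d3 * t4, d8, d9, d10, d11, z :: 'f])"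
  have F: "bij_betw ?F {ds. length ds = 12} (carrier G)" using U by (simp add: is_UD4_def)
  \<comment> \<open>List positions count from 0, so root i sits at position i - 1. Adding
    \<open>ds ! 2 * ds ! 3\<close> undoes the correction in the seventh entry of
    \<open>E\<close>.\<close>
  have l: "bij_betw l UNIV {ds. length ds = 12}"
  proof (rule bij_betw_byWitness[where f' = "\<lambda>ds. ((ds ! 0, ds ! 1, ds ! 3),
      (ds ! 2, (ds ! 4, ds ! 5, ds ! 6 + ds ! 2 * ds ! 3), (ds ! 7, ds ! 8, ds ! 9), ds ! 10), ds ! 11)"])
    show "\<forall>ds\<in>{ds. length ds = 12}. l ((ds ! 0, ds ! 1, ds ! 3),
      (ds ! 2, (ds ! 4, ds ! 5, ds ! 6 + ds ! 2 * ds ! 3), (ds ! 7, ds ! 8, ds ! 9), ds ! 10), ds ! 11) = ds"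
      by (auto simp: l_def numeral_eq_Suc length_Suc_conv)
  qed (auto simp: l_def)
  have "?F (l p) = E p" for p
  proof -
    obtain t1 t2 t4 d3 d5 d6 d7 d8 d9 d10 d11 z
      where p: "p = ((t1, t2, t4), (d3, (d5, d6, d7), (d8, d9, d10), d11), z)"
      by (cases p) auto
    show ?thesis unfolding p E.simps l_def W_def
      by (simp add: upt_rec x_closed) (simp add: numeral_eq_Suc)
  qed
  then have "E = ?F \<circ> l" by (auto simp: fun_eq_iff)
  then show ?thesis using bij_betw_trans[OF l F] by simp
qed

definition co :: "'g \<Rightarrow> 'f tri \<times> 'f vec8 \<times> 'f" where "co = inv_into UNIV E"
definition tc :: "'g \<Rightarrow> 'f tri" where "tc g = fst (co g)"
definition dc :: "'g \<Rightarrow> 'f vec8" where "dc g = fst (snd (co g))"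
definition zc :: "'g \<Rightarrow> 'f" where "zc g = snd (snd (co g))"

lemma E_closed: "E p \<in> carrier G" using bij_betwE[OF E_bij] by blast

lemma co_E: "co (E p) = p"
  unfolding co_def using E_bij by (simp add: bij_betw_def inv_into_f_f)

lemma E_co: "g \<in> carrier G \<Longrightarrow> E (co g) = g"
  unfolding co_def using E_bij by (simp add: bij_betw_def f_inv_into_f)

lemma coords_E [simp]: "tc (E (t, d, z)) = t" "dc (E (t, d, z)) = d" "zc (E (t, d, z)) = z"
  by (simp_all add: tc_def dc_def zc_def co_E)

lemma E_coords: "g \<in> carrier G \<Longrightarrow> E (tc g, dc g, zc g) = g"
  using E_co[of g] by (simp add: tc_def dc_def zc_def)

lemma coords_mult:
  assumes "g \<in> carrier G" "h \<in> carrier G"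
  shows "tc (g \<otimes> h) = tc g + tc h" "dc (g \<otimes> h) = conjM (tc h) (dc g) + dc h"
    "zc (g \<otimes> h) = zc g + zc h + coc (tc h) (dc g) (dc h)"
proof -
  have "g \<otimes> h = E (tc g + tc h, conjM (tc h) (dc g) + dc h, zc g + zc h + coc (tc h) (dc g) (dc h))"
    using E_mult[of "tc g" "dc g" "zc g" "tc h" "dc h" "zc h"] assms by (simp only: E_coords)
  then show "tc (g \<otimes> h) = tc g + tc h" "dc (g \<otimes> h) = conjM (tc h) (dc g) + dc h"
    "zc (g \<otimes> h) = zc g + zc h + coc (tc h) (dc g) (dc h)" by simp_all
qed

lemma finite_carrier: "finite (carrier G)"
  using bij_betw_finite[OF E_bij] by simp

lemma card_carrier_Collect: "card {g \<in> carrier G. P (co g)} = card {p. P p}"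
proof (rule bij_betw_same_card[symmetric])
  show "bij_betw E {p. P p} {g \<in> carrier G. P (co g)}"
    by (rule bij_betw_byWitness[where f' = co]) (auto simp: co_E E_co E_closed)
qed

lemma x_E:
  "x 5 u = E (0, (0, (u, 0, 0), 0, 0), 0)" "x 6 u = E (0, (0, (0, u, 0), 0, 0), 0)"
  "x 7 u = E (0, (0, (0, 0, u), 0, 0), 0)" "x 8 u = E (0, (0, 0, (u, 0, 0), 0), 0)"
  "x 9 u = E (0, (0, 0, (0, u, 0), 0), 0)" "x 10 u = E (0, (0, 0, (0, 0, u), 0), 0)"
  "x 11 u = E (0, (0, 0, 0, u), 0)" "x 12 u = E (0, (0, 0, 0, 0), u)"
  by (simp_all add: E.simps zero_prod_def W_def x_zero x_closed)

lemma one_E: "\<one> = E (0, 0, 0)"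
  by (simp add: E.simps zero_prod_def W_def x_zero)

end

section \<open>The two families of linear characters\<close>

locale UD4_char = UD4 G x
  for G :: "('g, 'b) monoid_scheme" (structure) and x :: "nat \<Rightarrow> 'f::{field, finite} \<Rightarrow> 'g" +
  fixes \<phi> :: "'f \<Rightarrow> complex" and w0 :: 'f and q :: nat
  assumes q_def: "q = card (UNIV :: 'f set)" and \<phi>_add: "\<phi> (u + v) = \<phi> u * \<phi> v" and \<phi>_unit: "\<phi> u * cnj (\<phi> u) = 1" and \<phi>_nontriv: "\<phi> w0 \<noteq> 1"
begin

definition pair1 :: "'f \<Rightarrow> 'f \<Rightarrow> complex" where "pair1 a d = \<phi> (a * d)"
definition pair3 :: "'f tri \<Rightarrow> 'f tri \<Rightarrow> complex" where
  "pair3 a d = pair1 (fst a) (fst d) * (pair1 (fst (snd a)) (fst (snd d)) * pair1 (snd (snd a)) (snd (snd d)))"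
definition pair4 :: "'f \<times> 'f tri \<Rightarrow> 'f \<times> 'f tri \<Rightarrow> complex" where
  "pair4 a d = pair1 (fst a) (fst d) * pair3 (snd a) (snd d)"
definition pair8 :: "'f vec8 \<Rightarrow> 'f vec8 \<Rightarrow> complex" where
  "pair8 a d = pair1 (fst a) (fst d) * (pair3 (fst (snd a)) (fst (snd d)) *
    (pair3 (fst (snd (snd a))) (fst (snd (snd d))) * pair1 (snd (snd (snd a))) (snd (snd (snd d)))))"

lemma bichar1: "bichar pair1"
  using bichar_field[OF \<phi>_add \<phi>_unit \<phi>_nontriv] by (simp add: pair1_def[abs_def])

lemma bichar3: "bichar pair3"
  using bichar_prod[OF bichar1 bichar_prod[OF bichar1 bichar1]] by (simp add: pair3_def[abs_def])

lemma bichar4: "bichar pair4"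
  using bichar_prod[OF bichar1 bichar3] by (simp add: pair4_def[abs_def])

lemma bichar8: "bichar pair8"
  using bichar_prod[OF bichar1 bichar_prod[OF bichar3 bichar_prod[OF bichar3 bichar1]]]
  by (simp add: pair8_def[abs_def])

lemma pair3_eq: "pair3 (a, b, c) (d, e, f) = \<phi> (a * d + b * e + c * f)"
  by (simp add: pair3_def pair1_def \<phi>_add mult.assoc)

lemma pair8_eq: "pair8 (a3, (a5, a6, a7), (a8, a9, a10), a11) (d3, (d5, d6, d7), (d8, d9, d10), d11) =
    \<phi> (a3 * d3 + (a5 * d5 + a6 * d6 + a7 * d7) + (a8 * d8 + a9 * d9 + a10 * d10) + a11 * d11)"
  by (simp add: pair8_def pair3_eq pair1_def \<phi>_add mult.assoc)

lemma pair8_adj: "pair8 a (conjM t d) = pair8 (dualM t a) d"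
proof -
  obtain t1 t2 t4 where t: "t = (t1, t2, t4)" by (cases t)
  obtain d3 d5 d6 d7 d8 d9 d10 d11 where d: "d = (d3, (d5, d6, d7), (d8, d9, d10), d11)"
    by (cases d) auto
  obtain a3 a5 a6 a7 a8 a9 a10 a11 where a: "a = (a3, (a5, a6, a7), (a8, a9, a10), a11)"
    by (cases a) auto
  show ?thesis unfolding t d a conjM.simps dualM.simps pair8_eq
    by (rule arg_cong[where f = \<phi>]) (simp add: algebra_simps)
qed

lemma dualM_zero: "dualM 0 a = (a :: 'f vec8)"
  by (cases "(0 :: 'f tri, a)" rule: dualM.cases) (auto simp: zero_prod_def)

lemma dualM_add: "dualM (t + t') a = dualM t (dualM t' (a :: 'f vec8))"
proof -
  obtain t1 t2 t4 where t: "t = (t1, t2, t4)" by (cases t)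
  obtain u1 u2 u4 where t': "t' = (u1, u2, u4)" by (cases t')
  obtain a3 a5 a6 a7 a8 a9 a10 a11 where a: "a = (a3, (a5, a6, a7), (a8, a9, a10), a11)"
    by (cases a) auto
  show ?thesis unfolding t t' a add_Pair dualM.simps by (simp add: algebra_simps)
qed

sublocale little_group G pair3 pair8 tc dc conjM dualM
proof (intro little_group.intro little_group_axioms.intro bichar3 bichar8 is_group finite_carrier coords_mult pair8_adj
    dualM_zero dualM_add)
  fix t :: "'f tri" and d :: "'f vec8"
  show "\<exists>g\<in>carrier G. tc g = t \<and> dc g = d"
    by (rule bexI[of _ "E (t, d, 0)"]) (simp_all add: E_closed)
qed

sublocale F: bichar pair1 by (rule bichar1)
sublocale P4: bichar pair4 by (rule bichar4)

definition K1 :: "'g set" where "K1 = {g \<in> carrier G. tc g = 0 \<and> fst (dc g) = 0 \<and> fst (snd (dc g)) = 0}"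

text \<open>The linear character of X_1 X_2 X_4 X_8 ... X_12 given by b on X_1 X_2 X_4 and by a on
  X_12, and trivial on X_8 ... X_11.\<close>

definition LA :: "'f \<Rightarrow> 'f tri \<Rightarrow> 'g \<Rightarrow> complex" where
  "LA a b g = (if g \<in> carrier G \<and> fst (dc g) = 0 \<and> fst (snd (dc g)) = 0 then pair3 b (tc g) * pair1 a (zc g) else 0)"

lemma zc_one: "zc \<one> = 0" by (simp add: one_E)

lemma fst_dc_mult: "\<lbrakk>g \<in> carrier G; h \<in> carrier G\<rbrakk> \<Longrightarrow> fst (dc (g \<otimes> h)) = fst (dc g) + fst (dc h)"
  by (simp add: coords_mult fst_conjM)

lemma snd_dc_mult: "\<lbrakk>g \<in> carrier G; h \<in> carrier G; fst (dc g) = 0\<rbrakk> \<Longrightarrow>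
    fst (snd (dc (g \<otimes> h))) = fst (snd (dc g)) + fst (snd (dc h))"
  by (simp add: coords_mult fst_snd_conjM)

lemma fst_dc_inv: "g \<in> carrier G \<Longrightarrow> fst (dc (inv g)) = - fst (dc g)"
  using fst_dc_mult[of g "inv g"] dc_one by (simp add: eq_neg_iff_add_eq_0 add.commute)

lemma snd_dc_inv: "\<lbrakk>g \<in> carrier G; fst (dc g) = 0\<rbrakk> \<Longrightarrow> fst (snd (dc (inv g))) = - fst (snd (dc g))"
  using snd_dc_mult[of g "inv g"] dc_one by (simp add: eq_neg_iff_add_eq_0 add.commute)

lemma K1_conj:
  assumes g: "g \<in> carrier G" and n: "n \<in> K1"
  shows "g \<otimes> n \<otimes> inv g \<in> K1"
proof -
  let ?h = "g \<otimes> n \<otimes> inv g"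
  have nc: "n \<in> carrier G" and n0: "tc n = 0" "fst (dc n) = 0" "fst (snd (dc n)) = 0" using n by (auto simp: K1_def)
  have hc: "?h \<in> carrier G" using g nc by simp
  have hg: "?h \<otimes> g = g \<otimes> n" using g nc by (simp add: m_assoc)
  have h3: "fst (dc ?h) = 0"
    using arg_cong[OF hg, of "\<lambda>k. fst (dc k)"] fst_dc_mult[OF hc g] fst_dc_mult[OF g nc] n0 by simp
  have "fst (snd (dc (g \<otimes> n))) = fst (snd (dc g))" using g nc n0 by (simp add: coords_mult conjM_zero)
  then have "fst (snd (dc ?h)) = 0"
    using arg_cong[OF hg, of "\<lambda>k. fst (snd (dc k))"] snd_dc_mult[OF hc g h3] by simp
  moreover have "tc ?h = 0" using g nc n0 by (simp add: coords_mult(1) tc_inv)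
  ultimately show ?thesis using hc h3 by (simp add: K1_def)
qed

lemma K1_normal: "K1 \<lhd> G"
proof (rule normal_invI)
  show "subgroup K1 G"
  proof (rule subgroupI)
    have "\<one> \<in> K1" by (simp add: K1_def tc_one dc_one)
    then show "K1 \<noteq> {}" by blast
    show "inv a \<in> K1" if "a \<in> K1" for a using that by (simp add: K1_def tc_inv fst_dc_inv snd_dc_inv)
    show "a \<otimes> b \<in> K1" if "a \<in> K1" "b \<in> K1" for a b
      using that by (simp add: K1_def coords_mult(1) fst_dc_mult snd_dc_mult)
  qed (auto simp: K1_def)
qed (rule K1_conj)

lemma zc_conj_K1:
  assumes g: "g \<in> carrier G" and n: "n \<in> K1"
  shows "zc n = zc (g \<otimes> n \<otimes> inv g) + coc (tc g) (dc (g \<otimes> n \<otimes> inv g)) (dc g)"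
proof -
  let ?h = "g \<otimes> n \<otimes> inv g"
  have nc: "n \<in> carrier G" and n0: "tc n = 0" "fst (dc n) = 0" "fst (snd (dc n)) = 0" using n by (auto simp: K1_def)
  have hc: "?h \<in> carrier G" using g nc by simp
  have "?h \<otimes> g = g \<otimes> n" using g nc by (simp add: m_assoc)
  then have "zc (?h \<otimes> g) = zc (g \<otimes> n)" by simp
  then show ?thesis
    using coords_mult(3)[OF hc g] coords_mult(3)[OF g nc] n0 by (simp add: coc_zero_right)
qed

lemma LA_nz: "g \<in> carrier G \<Longrightarrow> LA a b g \<noteq> 0 \<longleftrightarrow> fst (dc g) = 0 \<and> fst (snd (dc g)) = 0"
  by (simp add: LA_def S.nz F.nz)

lemma LA_K1: "g \<in> K1 \<Longrightarrow> LA a b g = pair1 a (zc g)"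
  by (simp add: LA_def K1_def)

lemma LA_mult:
  assumes "g \<in> carrier G" "h \<in> carrier G" "LA a b g \<noteq> 0" "LA a b h \<noteq> 0"
  shows "LA a b (g \<otimes> h) = LA a b g * LA a b h"
proof -
  have 0: "fst (dc g) = 0" "fst (snd (dc g)) = 0" "fst (dc h) = 0" "fst (snd (dc h)) = 0"
    using assms by (simp_all add: LA_nz)
  then have z: "zc (g \<otimes> h) = zc g + zc h" using assms by (simp add: coords_mult(3) coc_zero)
  show ?thesis
    using assms(1,2) 0 by (simp add: LA_def fst_dc_mult snd_dc_mult z coords_mult(1) S.add_r F.add_r)
qed

text \<open>Conjugating X_8 ... X_11 by g shifts \<open>zc\<close> by \<open>coc\<close>, whose
  surviving terms pair the coordinates 3, 5, 6, 7 of g with 11, 10, 9, 8. Testing one root at a time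
  forces these four to vanish.\<close>

lemma LA_stab:
  assumes a: "a \<noteq> 0" and g: "g \<in> carrier G"
    and st: "\<And>n. n \<in> K1 \<Longrightarrow> LA a b (g \<otimes> n \<otimes> inv g) = LA a b n"
  shows "LA a b g \<noteq> 0"
proof -
  obtain e1 e2 e4 where t: "tc g = (e1, e2, e4)" by (cases "tc g")
  obtain e3 e5 e6 e7 e8 e9 e10 e11 where e: "dc g = (e3, (e5, e6, e7), (e8, e9, e10), e11)"
    by (cases "dc g") auto
  have key: "pair1 a (coc (tc g) (0, 0, w, d11) (dc g)) = 1" for w d11
  proof -
    let ?h = "E (0, (0, 0, w, d11), 0)"
    have hc: "?h \<in> carrier G" by (rule E_closed)
    have hK: "?h \<in> K1" using hc by (simp add: K1_def)
    let ?n = "inv g \<otimes> ?h \<otimes> g"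
    have n: "?n \<in> K1" using K1_conj[of "inv g" ?h] hK g by simp
    have h: "g \<otimes> ?n \<otimes> inv g = ?h" using g hc by (simp add: m_assoc) (simp add: m_assoc[symmetric])
    have "zc ?n = coc (tc g) (0, 0, w, d11) (dc g)" using zc_conj_K1[OF g n] unfolding h by simp
    moreover have "pair1 a (zc ?n) = pair1 a (zc ?h)"
      using st[OF n] LA_K1[OF n, of a b] LA_K1[OF hK, of a b] unfolding h by simp
    ultimately show ?thesis by simp
  qed
  \<comment> \<open>Coordinate 3 has to go before the others: \<open>coc\<close> also contains its
    products with the coordinates of X_1 X_2 X_4, and only without these do the later tests isolate
    a single coordinate.\<close>
  have "a * e3 = 0"
  proof (rule F.nondeg_l)
    fix d show "pair1 (a * e3) d = 1" using key[of 0 d] by (simp add: t e zero_prod_def pair1_def ac_simps)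
  qed
  then have e3: "e3 = 0" using a by simp
  have "a * e5 = 0"
  proof (rule F.nondeg_l)
    fix d show "pair1 (a * e5) d = 1" using key[of "(0, 0, d)" 0] by (simp add: t e e3 zero_prod_def pair1_def ac_simps)
  qed
  then have e5: "e5 = 0" using a by simp
  have "a * e6 = 0"
  proof (rule F.nondeg_l)
    fix d show "pair1 (a * e6) d = 1" using key[of "(0, d, 0)" 0] by (simp add: t e e3 zero_prod_def pair1_def ac_simps)
  qed
  then have e6: "e6 = 0" using a by simp
  have "a * e7 = 0"
  proof (rule F.nondeg_l)
    \<comment> \<open>The minus sign offsets the one before \<open>d8 * e7\<close> in
      \<open>coc\<close>.\<close>
    fix d show "pair1 (a * e7) d = 1" using key[of "(- d, 0, 0)" 0] by (simp add: t e e3 zero_prod_def pair1_def ac_simps)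
  qed
  then have "e7 = 0" using a by simp
  then show ?thesis using g e e3 e5 e6 by (simp add: LA_nz zero_prod_def)
qed

lemma LA_datum: assumes a: "a \<noteq> 0" shows "mono_datum G K1 (LA a b)"
proof (intro mono_datum.intro mono_datum_axioms.intro)
  show "group G" by (rule is_group)
  show "finite (carrier G)" by (rule finite_carrier)
  show "K1 \<lhd> G" by (rule K1_normal)
  show "LA a b (g \<otimes> h) = LA a b g * LA a b h"
    if "g \<in> carrier G" "h \<in> carrier G" "LA a b g \<noteq> 0" "LA a b h \<noteq> 0" for g h
    by (rule LA_mult[OF that])
  show "LA a b g \<noteq> 0"
    if "g \<in> carrier G" "\<And>n. n \<in> K1 \<Longrightarrow> LA a b (g \<otimes> n \<otimes> inv g) = LA a b n" for g
    by (rule LA_stab[OF a that])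
next
  fix g assume g: "g \<in> carrier G" "LA a b g \<noteq> 0"
  have gi: "LA a b (inv g) \<noteq> 0" using g by (simp add: LA_nz fst_dc_inv snd_dc_inv)
  have "LA a b g * LA a b (inv g) = LA a b \<one>"
    using LA_mult[of g "inv g" a b] g gi by simp
  also have "\<dots> = 1" by (simp add: LA_def tc_one dc_one zc_one)
  also have "\<dots> = LA a b g * cnj (LA a b g)"
  proof -
    have "LA a b g * cnj (LA a b g) = (pair3 b (tc g) * cnj (pair3 b (tc g))) * (pair1 a (zc g) * cnj (pair1 a (zc g)))"
      using g by (simp add: LA_nz) (simp add: LA_def ac_simps)
    then show ?thesis by (simp only: S.unit F.unit mult_1)
  qed
  finally show "LA a b (inv g) = cnj (LA a b g)" using g(2) mult_left_cancel by blast
next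
  fix n assume "n \<in> K1"
  then show "LA a b n \<noteq> 0" by (simp add: LA_K1 F.nz)
qed

end

section \<open>Completeness of the two families\<close>

lemma card_UNIV_Times: "card (UNIV :: ('a::finite \<times> 'b::finite) set) = card (UNIV :: 'a set) * card (UNIV :: 'b set)"
  by (simp only: UNIV_Times_UNIV[symmetric] card_cartesian_product)

context mono_datum
begin

text \<open>Needed for \<open>cls3\<close> and \<open>cls4\<close>, which place products of root
  subgroups in the kernel. Kernel membership means that \<open>L\<close> is 1 on all conjugates, a
  condition that passes to products.\<close>

lemma ind_char_kernel_set_mult:
  assumes "B \<subseteq> carrier G" "C \<subseteq> carrier G" "\<one> \<in> B" "\<one> \<in> C"
  shows "B <#> C \<subseteq> char_ker G (ind_char G L) \<longleftrightarrow>
    B \<subseteq> char_ker G (ind_char G L) \<and> C \<subseteq> char_ker G (ind_char G L)"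
proof
  assume BC: "B <#> C \<subseteq> char_ker G (ind_char G L)"
  have "b \<in> B <#> C" if "b \<in> B" for b
    unfolding set_mult_def using that assms(1) by (intro UN_I[OF that] UN_I[OF assms(4)]) auto
  moreover have "c \<in> B <#> C" if "c \<in> C" for c
    unfolding set_mult_def using that assms(2) by (intro UN_I[OF assms(3)] UN_I[OF that]) auto
  ultimately show "B \<subseteq> char_ker G (ind_char G L) \<and> C \<subseteq> char_ker G (ind_char G L)" using BC by blast
next
  assume BC: "B \<subseteq> char_ker G (ind_char G L) \<and> C \<subseteq> char_ker G (ind_char G L)"
  have "b \<otimes> c \<in> char_ker G (ind_char G L)" if "b \<in> B" "c \<in> C" for b c
  proof -
    have c: "b \<in> carrier G" "c \<in> carrier G" using that assms by auto
    have "ind_char G L b = ind_char G L \<one>" "ind_char G L c = ind_char G L \<one>"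
      using that BC by (auto simp: char_ker_def)
    then have "\<forall>g\<in>carrier G. L (g \<otimes> b \<otimes> inv g) = 1" "\<forall>g\<in>carrier G. L (g \<otimes> c \<otimes> inv g) = 1"
      unfolding ind_char_eq_one_iff[OF c(1)] ind_char_eq_one_iff[OF c(2)] .
    then have "\<forall>g\<in>carrier G. L (g \<otimes> (b \<otimes> c) \<otimes> inv g) = 1"
      using c by (simp add: conj_mult L_mult)
    then show ?thesis using ind_char_eq_one_iff[of "b \<otimes> c"] c by (simp add: char_ker_def)
  qed
  then show "B <#> C \<subseteq> char_ker G (ind_char G L)" by (auto simp: set_mult_def)
qed

end

context UD4_char
begin

lemma K1_conj_iff:
  assumes s: "s \<in> carrier G" and g: "g \<in> carrier G"
  shows "s \<otimes> g \<otimes> inv s \<in> K1 \<longleftrightarrow> g \<in> K1"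
proof
  assume "s \<otimes> g \<otimes> inv s \<in> K1"
  then have "inv s \<otimes> (s \<otimes> g \<otimes> inv s) \<otimes> inv (inv s) \<in> K1" using s by (intro K1_conj[of "inv s"]) auto
  moreover have "inv s \<otimes> (s \<otimes> g \<otimes> inv s) \<otimes> inv (inv s) = g"
    using s g by (simp add: m_assoc) (simp add: m_assoc[symmetric])
  ultimately show "g \<in> K1" by simp
qed (rule K1_conj[OF s])

text \<open>Orthogonality in b leaves only conjugates with \<open>tc\<close> zero, that is, those in
  \<open>K1\<close>; normality transfers this to g.\<close>

lemma sum_LA_conj:
  assumes s: "s \<in> carrier G" and g: "g \<in> carrier G"
  shows "(\<Sum>b\<in>UNIV. cnj (LA a b (s \<otimes> g \<otimes> inv s))) =
    (if g \<in> K1 then of_nat (card (UNIV :: 'f tri set)) * cnj (pair1 a (zc (s \<otimes> g \<otimes> inv s))) else 0)"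
proof -
  let ?h = "s \<otimes> g \<otimes> inv s"
  have hc: "?h \<in> carrier G" using s g by simp
  have "(\<Sum>b\<in>UNIV. cnj (LA a b ?h)) =
    (if ?h \<in> K1 then of_nat (card (UNIV :: 'f tri set)) * cnj (pair1 a (zc ?h)) else 0)"
  proof (cases "fst (dc ?h) = 0 \<and> fst (snd (dc ?h)) = 0")
    case True
    then have "(\<Sum>b\<in>UNIV. cnj (LA a b ?h)) = (\<Sum>b\<in>UNIV. cnj (pair3 b (tc ?h))) * cnj (pair1 a (zc ?h))"
      using hc by (simp add: LA_def sum_distrib_right)
    then show ?thesis using True hc by (simp add: S.sum_l_cnj K1_def)
  qed (auto simp: LA_def K1_def)
  then show ?thesis using K1_conj_iff[OF s g] by simp
qed

text \<open>For g in \<open>K1\<close>, conjugation by X_3 X_5 X_6 X_7 fixes \<open>dc g\<close> and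
  shifts \<open>zc g\<close> by a perfect pairing of r with \<open>dc g\<close>. Summing over r
  eliminates every g outside X_12.\<close>

lemma sum_conj_zc:
  assumes a: "a \<noteq> 0" and g: "g \<in> K1"
  defines "s \<equiv> \<lambda>r. E (0, (fst r, snd r, 0, 0), 0)"
  shows "(\<Sum>r\<in>UNIV. cnj (pair1 a (zc (s r \<otimes> g \<otimes> inv (s r))))) =
    (if dc g = 0 then of_nat (card (UNIV :: ('f \<times> 'f tri) set)) * cnj (pair1 a (zc g)) else 0)"
proof -
  have gc: "g \<in> carrier G" using g by (simp add: K1_def)
  obtain d8 d9 d10 d11 where d: "dc g = (0, 0, (d8, d9, d10), d11)"
    using g by (cases "dc g") (auto simp: K1_def)
  \<comment> \<open>The second vector lists the coefficients of r3, r5, r6, r7 in the shift, namely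
    d11, d10, d9 and - d8, scaled by a.\<close>
  have "cnj (pair1 a (zc (s r \<otimes> g \<otimes> inv (s r)))) =
      pair4 r (a * d11, (a * d10, a * d9, - (a * d8))) * cnj (pair1 a (zc g))" for r
  proof -
    let ?h = "s r \<otimes> g \<otimes> inv (s r)"
    have sc: "s r \<in> carrier G" by (simp add: s_def E_closed)
    have hc: "?h \<in> carrier G" using sc gc by simp
    have "?h \<otimes> s r = s r \<otimes> g" using sc gc by (simp add: m_assoc)
    then have "dc (?h \<otimes> s r) = dc (s r \<otimes> g)" by simp
    moreover have "tc (s r) = 0" "tc g = 0" using g by (simp_all add: s_def K1_def)
    ultimately have dh: "dc ?h = dc g"
      using coords_mult(2)[OF hc sc] coords_mult(2)[OF sc gc] by (simp add: conjM_zero add.commute)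
    obtain r3 r5 r6 r7 where r: "r = (r3, (r5, r6, r7))" by (cases r) auto
    have "coc (tc (s r)) (dc ?h) (dc (s r)) = d10 * r5 + d11 * r3 - d8 * r7 + d9 * r6"
      unfolding dh d by (simp add: s_def r zero_prod_def)
    then have z: "zc g = zc ?h + (d10 * r5 + d11 * r3 - d8 * r7 + d9 * r6)"
      using zc_conj_K1[OF sc g] by simp
    have p: "pair4 r (a * d11, (a * d10, a * d9, - (a * d8))) = pair1 a (d10 * r5 + d11 * r3 - d8 * r7 + d9 * r6)"
      unfolding r by (simp add: pair4_def pair3_eq pair1_def \<phi>_add[symmetric] algebra_simps)
    have "pair1 a (zc g) = pair1 a (zc ?h) * pair1 a (d10 * r5 + d11 * r3 - d8 * r7 + d9 * r6)"
      unfolding z by (rule F.add_r)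
    then have "pair1 a (d10 * r5 + d11 * r3 - d8 * r7 + d9 * r6) * cnj (pair1 a (zc g)) =
      cnj (pair1 a (zc ?h)) * (pair1 a (d10 * r5 + d11 * r3 - d8 * r7 + d9 * r6) *
        cnj (pair1 a (d10 * r5 + d11 * r3 - d8 * r7 + d9 * r6)))"
      by (simp add: ac_simps)
    then show ?thesis by (simp only: p F.unit mult_1_right)
  qed
  then have "(\<Sum>r\<in>UNIV. cnj (pair1 a (zc (s r \<otimes> g \<otimes> inv (s r))))) =
      (\<Sum>r\<in>UNIV. pair4 r (a * d11, (a * d10, a * d9, - (a * d8)))) * cnj (pair1 a (zc g))"
    by (simp add: sum_distrib_right)
  also have "\<dots> = (if dc g = 0 then of_nat (card (UNIV :: ('f \<times> 'f tri) set)) * cnj (pair1 a (zc g)) else 0)"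
    unfolding P4.sum_l d using a by (auto simp: zero_prod_def)
  finally show ?thesis .
qed

text \<open>The sum over b confines g to \<open>K1\<close>, the sum over the conjugating elements
  confines it to X_12, and what remains is a nonzero multiple of one Fourier coefficient of f along
  X_12.\<close>

lemma LA_complete:
  assumes a: "a \<noteq> 0"
    and H: "\<And>b s. s \<in> carrier G \<Longrightarrow> (\<Sum>g\<in>carrier G. cnj (LA a b (s \<otimes> g \<otimes> inv s)) * f g) = 0"
  shows "(\<Sum>g | g \<in> carrier G \<and> tc g = 0 \<and> dc g = 0. cnj (pair1 a (zc g)) * f g) = 0"
proof -
  define s :: "'f \<times> 'f tri \<Rightarrow> 'g" where "s = (\<lambda>r. E (0, (fst r, snd r, 0, 0), 0))"
  have sc: "s r \<in> carrier G" for r by (simp add: s_def E_closed)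
  let ?q3 = "of_nat (card (UNIV :: 'f tri set)) :: complex"
  let ?q4 = "of_nat (card (UNIV :: ('f \<times> 'f tri) set)) :: complex"
  have inner: "(\<Sum>r\<in>UNIV. \<Sum>b\<in>UNIV. cnj (LA a b (s r \<otimes> g \<otimes> inv (s r)))) =
      (if tc g = 0 \<and> dc g = 0 then ?q3 * ?q4 * cnj (pair1 a (zc g)) else 0)" if g: "g \<in> carrier G" for g
  proof (cases "g \<in> K1")
    case True
    have "(\<Sum>r\<in>UNIV. \<Sum>b\<in>UNIV. cnj (LA a b (s r \<otimes> g \<otimes> inv (s r)))) =
      ?q3 * (\<Sum>r\<in>UNIV. cnj (pair1 a (zc (s r \<otimes> g \<otimes> inv (s r)))))"
      using True by (simp add: sum_LA_conj[OF sc g] sum_distrib_left)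
    also have "\<dots> = ?q3 * (if dc g = 0 then ?q4 * cnj (pair1 a (zc g)) else 0)"
      unfolding s_def by (simp only: sum_conj_zc[OF a True])
    finally show ?thesis using True by (simp add: K1_def)
  next
    case False
    then have "\<not> (tc g = 0 \<and> dc g = 0)" using g by (auto simp: K1_def)
    then show ?thesis using False by (auto simp: sum_LA_conj[OF sc g])
  qed
  have "0 = (\<Sum>r\<in>UNIV. \<Sum>b\<in>UNIV. \<Sum>g\<in>carrier G. cnj (LA a b (s r \<otimes> g \<otimes> inv (s r))) * f g)"
    using H[OF sc] by simp
  also have "\<dots> = (\<Sum>r\<in>UNIV. \<Sum>g\<in>carrier G. \<Sum>b\<in>UNIV. cnj (LA a b (s r \<otimes> g \<otimes> inv (s r))) * f g)"
    by (intro sum.cong refl sum.swap)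
  also have "\<dots> = (\<Sum>g\<in>carrier G. (\<Sum>r\<in>UNIV. \<Sum>b\<in>UNIV. cnj (LA a b (s r \<otimes> g \<otimes> inv (s r)))) * f g)"
    by (subst sum.swap) (simp add: sum_distrib_right)
  also have "\<dots> = (\<Sum>g\<in>carrier G. if tc g = 0 \<and> dc g = 0 then ?q3 * ?q4 * (cnj (pair1 a (zc g)) * f g) else 0)"
    using inner by (intro sum.cong) auto
  also have "\<dots> = (\<Sum>g | g \<in> carrier G \<and> tc g = 0 \<and> dc g = 0. ?q3 * ?q4 * (cnj (pair1 a (zc g)) * f g))"
    using finite_carrier by (simp add: sum.inter_filter[symmetric])
  also have "\<dots> = ?q3 * ?q4 * (\<Sum>g | g \<in> carrier G \<and> tc g = 0 \<and> dc g = 0. cnj (pair1 a (zc g)) * f g)"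
    by (rule sum_distrib_left[symmetric])
  finally show ?thesis by simp
qed

theorem Irr_cases:
  assumes "\<chi> \<in> Irr G"
  obtains (A) a b where "a \<noteq> 0" "\<chi> = ind_char G (LA a b)" | (B) a b where "\<chi> = ind_char G (LG a b)"
proof (rule ccontr)
  assume none: "\<not> thesis"
  obtain n \<rho> where \<rho>: "irred_rep G n \<rho>" and \<chi>: "\<chi> = (\<lambda>g. if g \<in> carrier G then mat_trace (\<rho> g) else 0)"
    using assms by (auto simp: Irr_def)
  have ne: "\<exists>g\<in>carrier G. mat_trace (\<rho> g) \<noteq> ind_char G L g" if "\<chi> \<noteq> ind_char G L" for L
  proof (rule ccontr)
    assume "\<not> ?thesis"
    then have "\<chi> = ind_char G L" unfolding \<chi> by (auto simp: fun_eq_iff ind_char_def)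
    then show False using that by simp
  qed
  have n0: "0 < n" using \<rho> by (simp add: irred_rep_def)
  \<comment> \<open>One matrix entry is enough: the contradiction comes from its value at the
    identity, which is 1.\<close>
  define f where "f g = \<rho> g $$ (0, 0)" for g
  have neA: "\<chi> \<noteq> ind_char G (LA a b)" if "a \<noteq> 0" for a b using A[OF that] none by blast
  have neB: "\<chi> \<noteq> ind_char G (LG a b)" for a b using B none by blast
  let ?Z = "{g. g \<in> carrier G \<and> tc g = 0 \<and> dc g = 0}"
  have B0: "(\<Sum>g\<in>?Z. f g) = 0"
  proof (rule LG_complete)
    fix a b
    have "(\<Sum>g\<in>carrier G. cnj (LG a b (\<one> \<otimes> g \<otimes> inv \<one>)) * \<rho> g $$ (0, 0)) = 0"
      by (rule mono_datum.sum_conj_zero[OF LG_datum \<rho> ne[OF neB] n0 n0 one_closed])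
    then show "(\<Sum>g\<in>carrier G. cnj (LG a b g) * f g) = 0" by (simp add: f_def)
  qed
  have A0: "(\<Sum>g\<in>?Z. cnj (pair1 a (zc g)) * f g) = 0" if a: "a \<noteq> 0" for a
  proof (rule LA_complete[OF a])
    fix b s assume "s \<in> carrier G"
    then show "(\<Sum>g\<in>carrier G. cnj (LA a b (s \<otimes> g \<otimes> inv s)) * f g) = 0"
      unfolding f_def by (rule mono_datum.sum_conj_zero[OF LA_datum[OF a] \<rho> ne[OF neA[OF a]] n0 n0])
  qed
  \<comment> \<open>The family \<open>LG\<close> supplies the trivial character of X_12 and
    \<open>LA\<close> supplies all others, so every Fourier coefficient of f along X_12
    vanishes.\<close>
  have "(\<Sum>g\<in>?Z. cnj (pair1 a (zc g)) * f g) = 0" for a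
    using A0 B0 by (cases "a = 0") auto
  then have "0 = (\<Sum>a\<in>UNIV. \<Sum>g\<in>?Z. cnj (pair1 a (zc g)) * f g)" by simp
  also have "\<dots> = (\<Sum>g\<in>?Z. (\<Sum>a\<in>UNIV. cnj (pair1 a (zc g))) * f g)"
    by (subst sum.swap) (simp add: sum_distrib_right)
  also have "\<dots> = (\<Sum>g\<in>?Z. if g = \<one> then of_nat (card (UNIV :: 'f set)) * f \<one> else 0)"
  proof (rule sum.cong[OF refl])
    fix g assume g: "g \<in> ?Z"
    have "zc g = 0 \<longleftrightarrow> g = \<one>"
      using g E_coords[of g] one_E zc_one by auto
    then show "(\<Sum>a\<in>UNIV. cnj (pair1 a (zc g))) * f g =
        (if g = \<one> then of_nat (card (UNIV :: 'f set)) * f \<one> else 0)"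
      by (simp add: F.sum_l_cnj)
  qed
  also have "\<dots> = of_nat (card (UNIV :: 'f set)) * f \<one>"
    using finite_carrier by (simp add: tc_one dc_one)
  finally have "f \<one> = 0" by simp
  moreover have "\<rho> \<one> = 1\<^sub>m n" using \<rho> by (simp add: irred_rep_def is_rep_def)
  ultimately show False using n0 by (simp add: f_def)
qed

lemma LA_Irr: "a \<noteq> 0 \<Longrightarrow> ind_char G (LA a b) \<in> Irr G"
  by (rule mono_datum.ind_char_Irr[OF LA_datum])

lemma LG_Irr: "ind_char G (LG a b) \<in> Irr G"
  by (rule mono_datum.ind_char_Irr[OF LG_datum])

lemma x12_central: "s \<in> carrier G \<Longrightarrow> s \<otimes> x 12 u \<otimes> inv s = x 12 u"
proof -
  assume s: "s \<in> carrier G"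
  have 0: "conjM t (0, 0, 0, 0) = 0" "coc t (0, 0, 0, 0) d = 0" "coc 0 d (0, 0, 0, 0) = 0" for t :: "'f tri" and d
    by (cases "(t, d)" rule: conjM.cases, simp add: zero_prod_def)+
  have "s \<otimes> x 12 u = x 12 u \<otimes> s"
    using E_mult[of "tc s" "dc s" "zc s" 0 "(0, 0, 0, 0)" u] E_mult[of 0 "(0, 0, 0, 0)" u "tc s" "dc s" "zc s"]
    by (simp add: E_coords[OF s] x_E(8) 0 conjM_zero) (simp add: zero_prod_def[symmetric] add.commute)
  then show ?thesis using s x_closed[of 12 u] by (simp add: m_assoc)
qed

lemma x12_K1: "x 12 u \<in> K1"
  using x_closed[of 12 u] by (simp add: K1_def x_E(8))

lemma LA_x12: "LA a b (x 12 u) = pair1 a u"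
  using LA_K1[OF x12_K1] by (simp add: x_E(8))

text \<open>X_12 is central, so a can be read off and the two functions agree on \<open>K1\<close>.
  Then \<open>eq_if_ind_char_eq\<close> gives equality rather than mere conjugacy, and b is
  recovered too.\<close>

lemma LA_inj:
  assumes a: "a \<noteq> 0" "a' \<noteq> 0" and eq: "ind_char G (LA a b) = ind_char G (LA a' b')"
  shows "a = a' \<and> b = b'"
proof -
  interpret D: mono_datum G K1 "LA a b" by (rule LA_datum[OF a(1)])
  obtain s where s: "s \<in> carrier G" "\<forall>g\<in>carrier G. LA a' b' g = LA a b (s \<otimes> g \<otimes> inv s)"
    using D.conj_if_ind_char_eq[OF LA_datum[OF a(2)] eq] by blast
  have aa: "a = a'"
  proof (rule F.ext_l)
    fix u
    have "LA a' b' (x 12 u) = LA a b (x 12 u)" using s x12_central[OF s(1)] x_closed[of 12 u] by simp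
    then show "pair1 a u = pair1 a' u" by (simp add: LA_x12)
  qed
  have eqL: "LA a b g = LA a' b' g" if "g \<in> carrier G" for g
    by (rule D.eq_if_ind_char_eq[OF LA_datum[OF a(2)] eq _ that]) (simp add: LA_K1 aa)
  have "b = b'"
  proof (rule S.ext_l)
    fix t show "pair3 b t = pair3 b' t"
      using eqL[OF E_closed[of "(t, 0, 0)"]] by (simp add: LA_def E_closed)
  qed
  with aa show ?thesis by simp
qed

lemma q_pos: "q > 0"
  by (simp add: q_def finite_UNIV_card_ge_0)

lemma card_tri: "card (UNIV :: 'f tri set) = q ^ 3"
  by (simp add: card_UNIV_Times power3_eq_cube q_def)

lemma LA_degree: assumes "a \<noteq> 0" shows "char_deg G (ind_char G (LA a b)) = of_nat (q ^ 4)"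
proof -
  interpret D: mono_datum G K1 "LA a b" by (rule LA_datum[OF assms])
  have "{g \<in> carrier G. LA a b g \<noteq> 0} = {g \<in> carrier G. fst (dc g) = 0 \<and> fst (snd (dc g)) = 0}"
    using LA_nz by blast
  also have "card \<dots> = card {p :: 'f tri \<times> 'f vec8 \<times> 'f. fst (fst (snd p)) = 0 \<and> fst (snd (fst (snd p))) = 0}"
    unfolding dc_def by (rule card_carrier_Collect)
  also have "{p :: 'f tri \<times> 'f vec8 \<times> 'f. fst (fst (snd p)) = 0 \<and> fst (snd (fst (snd p))) = 0} =
      UNIV \<times> ({0} \<times> {0} \<times> UNIV \<times> UNIV) \<times> UNIV" by auto
  also have "card \<dots> = q ^ 8" by (simp add: card_cartesian_product card_UNIV_Times eval_nat_numeral q_def)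
  finally have A: "card {g \<in> carrier G. LA a b g \<noteq> 0} = q ^ 8" .
  have "card (carrier G) = card (UNIV :: ('f tri \<times> 'f vec8 \<times> 'f) set)"
    using bij_betw_same_card[OF E_bij] by simp
  then have "card (carrier G) = q ^ 4 * q ^ 8" by (simp add: card_UNIV_Times eval_nat_numeral q_def)
  then have "char_deg G (ind_char G (LA a b)) = of_nat (q ^ 4) * of_nat (q ^ 8) / of_nat (q ^ 8)"
    unfolding char_deg_def D.ind_char_one A by (simp only: of_nat_mult)
  moreover have "of_nat (q ^ 8) \<noteq> (0 :: complex)" using q_pos by simp
  ultimately show ?thesis by (metis nonzero_mult_div_cancel_right)
qed

section \<open>Root subgroups in the kernels\<close>

lemma in_ker_iff: "\<lbrakk>1 \<le> j; j \<le> 12\<rbrakk> \<Longrightarrow> in_ker G x \<chi> j \<longleftrightarrow> (\<forall>u. \<chi> (x j u) = \<chi> \<one>)"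
  using x_closed by (simp add: in_ker_def Xr_def char_ker_def image_subset_iff)

lemma LA_not_in_ker: assumes "a \<noteq> 0" shows "\<not> in_ker G x (ind_char G (LA a b)) 12"
proof
  assume ker: "in_ker G x (ind_char G (LA a b)) 12"
  interpret D: mono_datum G K1 "LA a b" by (rule LA_datum[OF assms])
  have "a = 0"
  proof (rule F.nondeg_l)
    fix u
    have "ind_char G (LA a b) (x 12 u) = ind_char G (LA a b) \<one>" using ker by (simp add: in_ker_iff)
    then have "\<forall>g\<in>carrier G. LA a b (g \<otimes> x 12 u \<otimes> inv g) = 1"
      using D.ind_char_eq_one_iff[of "x 12 u"] x_closed[of 12 u] by simp
    then have "LA a b (\<one> \<otimes> x 12 u \<otimes> inv \<one>) = 1" by (rule bspec[OF _ one_closed])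
    then show "pair1 a u = 1" using x_closed[of 12 u] by (simp add: LA_x12)
  qed
  with assms show False by simp
qed

lemma LG_in_ker:
  assumes j: "1 \<le> j" "j \<le> 12" and xj: "\<And>u. tc (x j u) = 0"
  shows "in_ker G x (ind_char G (LG a b)) j \<longleftrightarrow> (\<forall>u t. pair8 (dualM t a) (dc (x j u)) = 1)"
proof -
  have "x j u \<in> K" for u using xj x_closed[OF j] by (simp add: K_def)
  then show ?thesis using LG_kernel j by (simp add: in_ker_iff)
qed

lemma pair1_all: "(\<forall>u. pair1 c u = 1) \<longleftrightarrow> c = 0"
  using F.nondeg_l by auto

text \<open>For j from 5 to 11, X_j is in the kernel when coordinate j of \<open>dualM t a\<close>
  vanishes for all t. This is a polynomial in t whose coefficients are, up to sign, a_j and the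
  entries of a at the roots reached from \<alpha>_j by adding \<alpha>_1, \<alpha>_2,
  \<alpha>_4.\<close>

lemma LG_in_ker_simps:
  fixes a3 a5 a6 a7 a8 a9 a10 a11 :: 'f
  defines "a \<equiv> (a3, (a5, a6, a7), (a8, a9, a10), a11)"
  shows "in_ker G x (ind_char G (LG a b)) 12"
    "in_ker G x (ind_char G (LG a b)) 11 \<longleftrightarrow> a11 = 0"
    "in_ker G x (ind_char G (LG a b)) 10 \<longleftrightarrow> a10 = 0 \<and> a11 = 0"
    "in_ker G x (ind_char G (LG a b)) 9 \<longleftrightarrow> a9 = 0 \<and> a11 = 0"
    "in_ker G x (ind_char G (LG a b)) 8 \<longleftrightarrow> a8 = 0 \<and> a11 = 0"
    "in_ker G x (ind_char G (LG a b)) 7 \<longleftrightarrow> a7 = 0 \<and> a9 = 0 \<and> a10 = 0 \<and> a11 = 0"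
    "in_ker G x (ind_char G (LG a b)) 6 \<longleftrightarrow> a6 = 0 \<and> a8 = 0 \<and> a10 = 0 \<and> a11 = 0"
    "in_ker G x (ind_char G (LG a b)) 5 \<longleftrightarrow> a5 = 0 \<and> a8 = 0 \<and> a9 = 0 \<and> a11 = 0"
proof -
  have tri_all: "(\<forall>t. P t) \<longleftrightarrow> (\<forall>t1 t2 t4. P (t1, t2, t4))" for P :: "'f tri \<Rightarrow> bool" by auto
  have pq: "pair8 (dualM (t1, t2, t4) a) (0, (u5, u6, u7), (u8, u9, u10), u11) =
    pair1 (a5 + t2 * a8 + t4 * a9 + t2 * t4 * a11) u5 * pair1 (a6 + t1 * a8 + t4 * a10 + t1 * t4 * a11) u6 *
    pair1 (a7 - t1 * a9 - t2 * a10 - t1 * t2 * a11) u7 * pair1 (a8 + t4 * a11) u8 * pair1 (a9 + t2 * a11) u9 *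
    pair1 (a10 + t1 * a11) u10 * pair1 a11 u11" for t1 t2 t4 u5 u6 u7 u8 u9 u10 u11
    unfolding a_def dualM.simps by (simp add: pair8_def pair3_def ac_simps)
  have z0: "(0, 0, 0, 0) = (0 :: 'f vec8)" by (simp add: zero_prod_def)
  have p1: "(\<forall>u t. pair1 (c t) u = 1) \<longleftrightarrow> (\<forall>t. c t = 0)" for c :: "'f \<Rightarrow> 'f"
    using pair1_all by blast
  have p2: "(\<forall>u s t. pair1 (c s t) u = 1) \<longleftrightarrow> (\<forall>s t. c s t = 0)" for c :: "'f \<Rightarrow> 'f \<Rightarrow> 'f"
    using pair1_all by blast
  have e2: "(\<forall>t. a + t * b = 0) \<longleftrightarrow> a = 0 \<and> b = 0" for a b :: 'f
    by (metis add.left_neutral add.right_neutral mult_1 mult_zero_left mult_zero_right)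
  \<comment> \<open>The polynomial has degree at most one in each variable, so its values at 0 and 1
    determine its coefficients, even over the field with two elements.\<close>
  have e4: "(\<forall>s t. a + s * b + t * c + s * t * d = 0) \<longleftrightarrow> a = 0 \<and> b = 0 \<and> c = 0 \<and> d = 0" for a b c d :: 'f
  proof
    assume *: "\<forall>s t. a + s * b + t * c + s * t * d = 0"
    have a: "a = 0" using *[rule_format, of 0 0] by simp
    have b: "b = 0" using *[rule_format, of 1 0] a by simp
    have c: "c = 0" using *[rule_format, of 0 1] a by simp
    show "a = 0 \<and> b = 0 \<and> c = 0 \<and> d = 0" using *[rule_format, of 1 1] a b c by simp
  qed simp
  have e4m: "(\<forall>s t. a - s * b - t * c = s * t * d) \<longleftrightarrow> a = 0 \<and> b = 0 \<and> c = 0 \<and> d = 0" for a b c d :: 'f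
    using e4[of a "- b" "- c" "- d"] by simp
  show "in_ker G x (ind_char G (LG a b)) 12"
    by (subst LG_in_ker) (simp_all add: x_E z0)
  show "in_ker G x (ind_char G (LG a b)) 11 \<longleftrightarrow> a11 = 0"
    by (subst LG_in_ker) (auto simp: x_E tri_all zero_prod_def pq p1 p2 pair1_all)
  show "in_ker G x (ind_char G (LG a b)) 10 \<longleftrightarrow> a10 = 0 \<and> a11 = 0"
    by (subst LG_in_ker) (simp_all add: x_E tri_all zero_prod_def pq p1 p2 pair1_all e2)
  show "in_ker G x (ind_char G (LG a b)) 9 \<longleftrightarrow> a9 = 0 \<and> a11 = 0"
    by (subst LG_in_ker) (simp_all add: x_E tri_all zero_prod_def pq p1 p2 pair1_all e2)
  show "in_ker G x (ind_char G (LG a b)) 8 \<longleftrightarrow> a8 = 0 \<and> a11 = 0"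
    by (subst LG_in_ker) (simp_all add: x_E tri_all zero_prod_def pq p1 p2 pair1_all e2)
  show "in_ker G x (ind_char G (LG a b)) 7 \<longleftrightarrow> a7 = 0 \<and> a9 = 0 \<and> a10 = 0 \<and> a11 = 0"
    by (subst LG_in_ker) (simp_all add: x_E tri_all zero_prod_def pq p1 p2 pair1_all e4m)
  show "in_ker G x (ind_char G (LG a b)) 6 \<longleftrightarrow> a6 = 0 \<and> a8 = 0 \<and> a10 = 0 \<and> a11 = 0"
    by (subst LG_in_ker) (simp_all add: x_E tri_all zero_prod_def pq p1 p2 pair1_all e4)
  show "in_ker G x (ind_char G (LG a b)) 5 \<longleftrightarrow> a5 = 0 \<and> a8 = 0 \<and> a9 = 0 \<and> a11 = 0"
    by (subst LG_in_ker) (simp_all add: x_E tri_all zero_prod_def pq p1 p2 pair1_all e4)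
qed

end

section \<open>Stabilisers\<close>

text \<open>Used in two ways: as a form in (a5, a6, a7) it decides the order of a stabiliser, and as
  a form in t it cuts out the stabiliser itself in \<open>Stab_567\<close>.\<close>

definition lin :: "'f::field tri \<Rightarrow> 'f tri \<Rightarrow> 'f" where
  "lin l v = fst l * fst v + fst (snd l) * fst (snd v) + snd (snd l) * snd (snd v)"

lemma card_lin:
  fixes l :: "'f::{field, finite} tri"
  assumes "l \<noteq> 0"
  shows "card {v. lin l v = 0} = card (UNIV :: 'f set) ^ 2"
proof -
  let ?q = "card (UNIV :: 'f set)"
  have add: "lin l (v + w) = lin l v + lin l w" for v w by (simp add: lin_def algebra_simps)
  have scale: "lin l (c * fst v, c * fst (snd v), c * snd (snd v)) = c * lin l v" for c v
    by (simp add: lin_def algebra_simps)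
  have "lin l (1, 0, 0) = fst l" "lin l (0, 1, 0) = fst (snd l)" "lin l (0, 0, 1) = snd (snd l)"
    by (simp_all add: lin_def)
  then obtain u where u: "lin l u \<noteq> 0" using assms by (metis prod_eqI fst_zero snd_zero)
  have fib: "card {v. lin l v = c} = card {v. lin l v = 0}" for c
  proof -
    define w where "w = (c / lin l u * fst u, c / lin l u * fst (snd u), c / lin l u * snd (snd u))"
    have w: "lin l w = c" unfolding w_def scale using u by simp
    have "lin l (v - w) = lin l v - c" for v using add[of "v - w" w] w by simp
    then have "bij_betw (\<lambda>v. v + w) {v. lin l v = 0} {v. lin l v = c}"
      by (intro bij_betw_byWitness[where f' = "\<lambda>v. v - w"]) (auto simp: add w)
    then show ?thesis by (rule bij_betw_same_card[symmetric])
  qed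
  have "?q ^ 3 = (\<Sum>c\<in>UNIV. card {v. lin l v = c})"
  proof -
    have "(\<Union>c. {v. lin l v = c}) = UNIV" by auto
    moreover have "card (\<Union>c. {v. lin l v = c}) = (\<Sum>c\<in>UNIV. card {v. lin l v = c})"
      by (rule card_UN_disjoint) auto
    ultimately show ?thesis by (simp add: card_UNIV_Times power3_eq_cube)
  qed
  also have "\<dots> = (\<Sum>c\<in>(UNIV :: 'f set). card {v. lin l v = 0})" by (intro sum.cong refl fib)
  also have "\<dots> = ?q * card {v. lin l v = 0}" by simp
  finally have "?q * ?q ^ 2 = ?q * card {v. lin l v = 0}" by (simp add: power2_eq_square power3_eq_cube)
  then show ?thesis by (simp add: finite_UNIV_card_ge_0)
qed

lemma card_singleton_if: "\<lbrakk>0 \<in> S; \<And>t. t \<in> S \<Longrightarrow> t = 0\<rbrakk> \<Longrightarrow> card S = 1"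
  by (auto simp: card_1_singleton_iff)

context UD4_char
begin

text \<open>The last four equations carry no terms in a11: either a11 is zero, or the first three
  equations already force t to be zero.\<close>

lemma mem_Stab:
  "(t1, t2, t4) \<in> Stab (a3, (a5, a6, a7), (a8, a9, a10), a11) \<longleftrightarrow>
    t1 * a11 = 0 \<and> t2 * a11 = 0 \<and> t4 * a11 = 0 \<and>
    t2 * a8 + t4 * a9 = 0 \<and> t1 * a8 + t4 * a10 = 0 \<and> t1 * a9 + t2 * a10 = 0 \<and>
    t1 * a5 + t2 * a6 + t1 * t2 * a8 + t1 * t4 * a9 + t2 * t4 * a10 = t4 * a7"
proof (cases "a11 = 0")
  case True
  have "a3 - t1 * a5 - t2 * a6 + t4 * a7 - t1 * t2 * a8 - t1 * t4 * a9 - t2 * t4 * a10 = a3 \<longleftrightarrow>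
      t1 * a5 + t2 * a6 + t1 * t2 * a8 + t1 * t4 * a9 + t2 * t4 * a10 = t4 * a7"
    by (auto simp: algebra_simps)
  moreover have "a7 - t1 * a9 - t2 * a10 = a7 \<longleftrightarrow> t1 * a9 + t2 * a10 = 0"
    by (simp add: neg_eq_iff_add_eq_0)
  ultimately show ?thesis using True by (auto simp: Stab_def add.assoc)
next
  case False
  then show ?thesis by (auto simp: Stab_def)
qed

lemma Stab_cardI:
  assumes "\<And>t1 t2 t4. (t1, t2, t4) \<in> Stab a \<Longrightarrow> t1 = 0 \<and> t2 = 0 \<and> t4 = 0"
  shows "card (Stab a) = 1"
proof (rule card_singleton_if[OF Stab_zero])
  fix t assume "t \<in> Stab a"
  then show "t = 0" using assms by (cases t) (auto simp: zero_prod_def)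
qed

text \<open>Covers the cases where one or two of a8, a9, a10 are nonzero. The linear equations leave
  a line \<open>f s\<close> on which all quadratic terms vanish, so the last equation reads
  \<open>s * c = 0\<close>.\<close>

lemma Stab_lineI:
  fixes f :: "'f \<Rightarrow> 'f tri"
  assumes mem: "\<And>t1 t2 t4. (t1, t2, t4) \<in> Stab a \<Longrightarrow> \<exists>s. (t1, t2, t4) = f s"
    and f: "\<And>s. f s \<in> Stab a \<longleftrightarrow> s * c = 0" and inj: "inj f"
  shows "card (Stab a) = (if c = 0 then q else 1)"
proof -
  have "t \<in> range f" if "t \<in> Stab a" for t
    using mem[of "fst t" "fst (snd t)" "snd (snd t)"] that by auto
  then have "Stab a \<subseteq> f ` {s. s * c = 0}" using f by blast
  then have "Stab a = f ` {s. s * c = 0}" using f by blast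
  then have "card (Stab a) = card {s. s * c = 0}" using card_image[OF inj_on_subset[OF inj]] by simp
  then show ?thesis by (simp add: q_def)
qed

lemma Stab_11: "a11 \<noteq> 0 \<Longrightarrow> card (Stab (a3, v, w, a11)) = 1"
  by (cases v; cases w; simp only:; rule Stab_cardI) (simp add: mem_Stab)

lemma Stab_odd:
  assumes "(2 :: 'f) \<noteq> 0" "a8 \<noteq> 0" "a9 \<noteq> 0" "a10 \<noteq> 0"
  shows "card (Stab (a3, v, (a8, a9, a10), 0)) = 1"
proof -
  obtain a5 a6 a7 where v: "v = (a5, a6, a7)" by (cases v)
  show ?thesis unfolding v
  proof (rule Stab_cardI)
    fix t1 t2 t4 assume "(t1, t2, t4) \<in> Stab (a3, (a5, a6, a7), (a8, a9, a10), 0)"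
    then have e: "t2 * a8 + t4 * a9 = 0" "t1 * a8 + t4 * a10 = 0" "t1 * a9 + t2 * a10 = 0"
      by (simp_all add: mem_Stab)
    \<comment> \<open>This is a8 times the third equation plus a9 times the second minus a10 times
      the first.\<close>
    have "2 * (t1 * (a8 * a9)) = 0" using e by Groebner_Basis.algebra
    then have t1: "t1 = 0" using assms by simp
    then show "t1 = 0 \<and> t2 = 0 \<and> t4 = 0" using e assms by simp
  qed
qed

text \<open>In characteristic 2 the linear system leaves the line of multiples s (a10, a9, a8).
  There each of the three quadratic terms equals s^2 a8 a9 a10, and three of them are one. The last
  equation becomes s (c + s a8 a9 a10) = 0, with roots 0 and \<open>s0\<close>, which coincide
  exactly when c is 0.\<close>

lemma Stab_even:
  assumes 2: "(2 :: 'f) = 0" and nz: "a8 \<noteq> 0" "a9 \<noteq> 0" "a10 \<noteq> 0"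
  shows "card (Stab (a3, v, (a8, a9, a10), 0)) = (if lin (a10, a9, - a8) v = 0 then 1 else 2)"
proof -
  obtain a5 a6 a7 where v: "v = (a5, a6, a7)" by (cases v)
  define c where "c = lin (a10, a9, - a8) v"
  define s0 where "s0 = - c / (a8 * a9 * a10)"
  have c: "c = a10 * a5 + a9 * a6 - a8 * a7" by (simp add: c_def lin_def v)
  have two: "y + y = 0" for y :: 'f using 2 by (metis mult_2 mult_zero_left)
  have s0: "s0 * (a8 * a9 * a10) = - c" using nz by (simp add: s0_def)
  have "Stab (a3, v, (a8, a9, a10), 0) = {0, (s0 * a10, s0 * a9, s0 * a8)}"
  proof (intro equalityI subsetI)
    fix t assume t: "t \<in> Stab (a3, v, (a8, a9, a10), 0)"
    obtain t1 t2 t4 where tt: "t = (t1, t2, t4)" by (cases t)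
    have e: "t2 * a8 + t4 * a9 = 0" "t1 * a9 + t2 * a10 = 0"
      and e3: "t1 * a5 + t2 * a6 + t1 * t2 * a8 + t1 * t4 * a9 + t2 * t4 * a10 = t4 * a7"
      using t by (simp_all add: mem_Stab v tt)
    define s where "s = t2 / a9"
    have t2: "t2 = s * a9" using nz by (simp add: s_def)
    have "(t4 - s * a8) * a9 = 0" using e(1) two[of "s * a8 * a9"] unfolding t2 by Groebner_Basis.algebra
    then have t4: "t4 = s * a8" using nz by simp
    have "(t1 - s * a10) * a9 = 0" using e(2) two[of "s * a10 * a9"] unfolding t2 by Groebner_Basis.algebra
    then have t1: "t1 = s * a10" using nz by simp
    have "s * (c + s * (a8 * a9 * a10)) = 0"
      using e3 two[of "s * s * a8 * a9 * a10"] unfolding t1 t2 t4 c by Groebner_Basis.algebra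
    then consider "s = 0" | "c + s * (a8 * a9 * a10) = 0" by auto
    then show "t \<in> {0, (s0 * a10, s0 * a9, s0 * a8)}"
    proof cases
      case 1
      then show ?thesis by (simp add: tt t1 t2 t4 zero_prod_def)
    next
      case 2
      then have "s * (a8 * a9 * a10) = s0 * (a8 * a9 * a10)" unfolding s0 by Groebner_Basis.algebra
      then have "s = s0" using nz by simp
      then show ?thesis by (simp add: tt t1 t2 t4)
    qed
  next
    fix t assume "t \<in> {0, (s0 * a10, s0 * a9, s0 * a8)}"
    then consider "t = 0" | "t = (s0 * a10, s0 * a9, s0 * a8)" by blast
    then show "t \<in> Stab (a3, v, (a8, a9, a10), 0)"
    proof cases
      case 1
      then show ?thesis by (simp add: Stab_zero)
    next
      case 2
      have "s0 * a10 * a5 + s0 * a9 * a6 + s0 * a10 * (s0 * a9) * a8 + s0 * a10 * (s0 * a8) * a9 +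
          s0 * a9 * (s0 * a8) * a10 = s0 * a8 * a7"
        using s0 two[of "s0 * s0 * a8 * a9 * a10"] unfolding c by Groebner_Basis.algebra
      moreover have "s0 * a9 * a8 + s0 * a8 * a9 = 0" "s0 * a10 * a8 + s0 * a8 * a10 = 0" "s0 * a10 * a9 + s0 * a9 * a10 = 0"
        using two[of "s0 * a9 * a8"] two[of "s0 * a10 * a8"] two[of "s0 * a10 * a9"] by (simp_all add: ac_simps)
      ultimately show ?thesis unfolding 2 v mem_Stab by simp
    qed
  qed
  then show ?thesis using nz by (auto simp: c_def[symmetric] s0_def zero_prod_def)
qed

lemma Stab_8_9:
  assumes nz: "a8 \<noteq> 0" "a9 \<noteq> 0"
  shows "card (Stab (a3, v, (a8, a9, 0), 0)) = (if lin (0, a9, a8) v = 0 then q else 1)"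
proof -
  obtain a5 a6 a7 where v: "v = (a5, a6, a7)" by (cases v)
  show ?thesis
    unfolding v
  proof (rule Stab_lineI[where f = "\<lambda>s. (0, s * a9, - (s * a8))"])
    fix t1 t2 t4 assume "(t1, t2, t4) \<in> Stab (a3, (a5, a6, a7), (a8, a9, 0), 0)"
    then have 0: "t1 = 0" and e: "t2 * a8 + t4 * a9 = 0" using nz by (simp_all add: mem_Stab)
    have "(t4 + t2 / a9 * a8) * a9 = 0" using e nz by (simp add: distrib_right add.commute)
    then have "t4 = - (t2 / a9 * a8)" using nz by (simp add: eq_neg_iff_add_eq_0)
    then show "\<exists>s. (t1, t2, t4) = (0, s * a9, - (s * a8))" using 0 nz by (intro exI[of _ "t2 / a9"]) simp
  next
    fix s
    have eq: "s * lin (0, a9, a8) (a5, a6, a7) = s * a9 * a6 + s * a8 * a7" by (simp add: lin_def algebra_simps)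
    show "(0, s * a9, - (s * a8)) \<in> Stab (a3, (a5, a6, a7), (a8, a9, 0), 0) \<longleftrightarrow> s * lin (0, a9, a8) (a5, a6, a7) = 0"
      unfolding eq by (simp add: mem_Stab eq_neg_iff_add_eq_0 mult.commute)
  qed (use nz in \<open>auto intro!: injI\<close>)
qed

lemma Stab_8_10:
  assumes nz: "a8 \<noteq> 0" "a10 \<noteq> 0"
  shows "card (Stab (a3, v, (a8, 0, a10), 0)) = (if lin (a10, 0, a8) v = 0 then q else 1)"
proof -
  obtain a5 a6 a7 where v: "v = (a5, a6, a7)" by (cases v)
  show ?thesis
    unfolding v
  proof (rule Stab_lineI[where f = "\<lambda>s. (s * a10, 0, - (s * a8))"])
    fix t1 t2 t4 assume "(t1, t2, t4) \<in> Stab (a3, (a5, a6, a7), (a8, 0, a10), 0)"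
    then have 0: "t2 = 0" and e: "t1 * a8 + t4 * a10 = 0" using nz by (simp_all add: mem_Stab)
    have "(t4 + t1 / a10 * a8) * a10 = 0" using e nz by (simp add: distrib_right add.commute)
    then have "t4 = - (t1 / a10 * a8)" using nz by (simp add: eq_neg_iff_add_eq_0)
    then show "\<exists>s. (t1, t2, t4) = (s * a10, 0, - (s * a8))" using 0 nz by (intro exI[of _ "t1 / a10"]) simp
  next
    fix s
    have eq: "s * lin (a10, 0, a8) (a5, a6, a7) = s * a10 * a5 + s * a8 * a7" by (simp add: lin_def algebra_simps)
    show "(s * a10, 0, - (s * a8)) \<in> Stab (a3, (a5, a6, a7), (a8, 0, a10), 0) \<longleftrightarrow> s * lin (a10, 0, a8) (a5, a6, a7) = 0"
      unfolding eq by (simp add: mem_Stab eq_neg_iff_add_eq_0 mult.commute)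
  qed (use nz in \<open>auto intro!: injI\<close>)
qed

lemma Stab_9_10:
  assumes nz: "a9 \<noteq> 0" "a10 \<noteq> 0"
  shows "card (Stab (a3, v, (0, a9, a10), 0)) = (if lin (a10, - a9, 0) v = 0 then q else 1)"
proof -
  obtain a5 a6 a7 where v: "v = (a5, a6, a7)" by (cases v)
  show ?thesis
    unfolding v
  proof (rule Stab_lineI[where f = "\<lambda>s. (s * a10, - (s * a9), 0)"])
    fix t1 t2 t4 assume "(t1, t2, t4) \<in> Stab (a3, (a5, a6, a7), (0, a9, a10), 0)"
    then have 0: "t4 = 0" and e: "t1 * a9 + t2 * a10 = 0" using nz by (simp_all add: mem_Stab)
    have "(t2 + t1 / a10 * a9) * a10 = 0" using e nz by (simp add: distrib_right add.commute)
    then have "t2 = - (t1 / a10 * a9)" using nz by (simp add: eq_neg_iff_add_eq_0)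
    then show "\<exists>s. (t1, t2, t4) = (s * a10, - (s * a9), 0)" using 0 nz by (intro exI[of _ "t1 / a10"]) simp
  next
    fix s
    have eq: "s * lin (a10, - a9, 0) (a5, a6, a7) = s * a10 * a5 - s * a9 * a6" by (simp add: lin_def algebra_simps)
    show "(s * a10, - (s * a9), 0) \<in> Stab (a3, (a5, a6, a7), (0, a9, a10), 0) \<longleftrightarrow> s * lin (a10, - a9, 0) (a5, a6, a7) = 0"
      unfolding eq by (simp add: mem_Stab eq_neg_iff_add_eq_0 mult.commute)
  qed (use nz in \<open>auto intro!: injI\<close>)
qed

lemma Stab_8: "a8 \<noteq> 0 \<Longrightarrow> card (Stab (a3, v, (a8, 0, 0), 0)) = (if lin (0, 0, 1) v = 0 then q else 1)"
  by (cases v, simp only:, rule Stab_lineI[where f = "\<lambda>s. (0, 0, s)"]) (auto simp: mem_Stab lin_def intro!: injI)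

lemma Stab_9: "a9 \<noteq> 0 \<Longrightarrow> card (Stab (a3, v, (0, a9, 0), 0)) = (if lin (0, 1, 0) v = 0 then q else 1)"
  by (cases v, simp only:, rule Stab_lineI[where f = "\<lambda>s. (0, s, 0)"]) (auto simp: mem_Stab lin_def intro!: injI)

lemma Stab_10: "a10 \<noteq> 0 \<Longrightarrow> card (Stab (a3, v, (0, 0, a10), 0)) = (if lin (1, 0, 0) v = 0 then q else 1)"
  by (cases v, simp only:, rule Stab_lineI[where f = "\<lambda>s. (s, 0, 0)"]) (auto simp: mem_Stab lin_def intro!: injI)

lemma Stab_567:
  assumes "v \<noteq> 0"
  shows "card (Stab (a3, v, 0, 0)) = q ^ 2"
proof -
  obtain a5 a6 a7 where v: "v = (a5, a6, a7)" by (cases v)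
  have "Stab (a3, v, 0, 0) = {t. lin (a5, a6, - a7) t = 0}"
    by (auto simp: v mem_Stab lin_def zero_prod_def mult.commute)
  moreover have "(a5, a6, - a7) \<noteq> 0" using assms by (auto simp: v zero_prod_def)
  ultimately show ?thesis using card_lin by (simp add: q_def)
qed

lemma Stab_3: "card (Stab (a3, 0, 0, 0)) = q ^ 3"
proof -
  have "Stab (a3, 0, 0, 0) = UNIV" by (auto simp: mem_Stab zero_prod_def)
  then show ?thesis by (simp add: card_tri)
qed

end

section \<open>Counting\<close>

lemma card_uminus_set: "card (- S :: 'a::finite set) = card (UNIV :: 'a set) - card S"
  by (simp add: Compl_eq_Diff_UNIV card_Diff_subset)

text \<open>If 2 = 0 and q were odd, then q = 0 in the field would read 1 = 0. Conversely, negation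
  permutes the nonzero elements, and comparing their products gives (-1)^(q-1) = 1, so -1 = 1 when q
  is even.\<close>

lemma two_eq_0_iff_even_card:
  "(2 :: 'f::{field, finite}) = 0 \<longleftrightarrow> even (card (UNIV :: 'f set))"
proof
  assume 2: "(2 :: 'f) = 0"
  have 0: "of_nat (card (UNIV :: 'f set)) = (0 :: 'f)" by (rule of_nat_card_UNIV)
  show "even (card (UNIV :: 'f set))"
  proof (rule ccontr)
    assume "odd (card (UNIV :: 'f set))"
    then obtain k where "card (UNIV :: 'f set) = 2 * k + 1" by (elim oddE)
    then show False using 0 2 by simp
  qed
next
  assume even: "even (card (UNIV :: 'f set))"
  have "(\<Prod>y\<in>- {0 :: 'f}. - y) = (\<Prod>y\<in>- {0}. y)"
    by (rule prod.reindex_bij_betw[of uminus "- {0}" "- {0}" "\<lambda>y. y"])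
      (rule bij_betw_byWitness[where f' = uminus], auto)
  moreover have "(\<Prod>y\<in>- {0 :: 'f}. - y) = (- 1) ^ card (- {0 :: 'f}) * (\<Prod>y\<in>- {0}. y)"
    using prod.distrib[of "\<lambda>_. - 1 :: 'f" "\<lambda>y. y" "- {0}"] by simp
  moreover have "(\<Prod>y\<in>- {0 :: 'f}. y) \<noteq> 0" by simp
  ultimately have 1: "(- 1 :: 'f) ^ card (- {0 :: 'f}) = 1" by simp
  have "card (UNIV :: 'f set) > 0" by (simp add: finite_UNIV_card_ge_0)
  then have "odd (card (- {0 :: 'f}))" using even by (simp add: card_uminus_set)
  then have "(- 1 :: 'f) = 1" using 1 by simp
  then show "(2 :: 'f) = 0" by (metis add.right_inverse one_add_one)
qed

context UD4_char
begin

lemma card_Stab_pos: "card (Stab a) > 0"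
proof -
  have "Stab a \<noteq> {}" using Stab_zero[of a] by blast
  then show ?thesis by (simp add: card_gt_0_iff)
qed

lemma LG_char_deg: "char_deg G (ind_char G (LG a b)) = of_nat (q ^ 3) / of_nat (card (Stab a))"
proof -
  have "of_nat (card (Stab a)) \<noteq> (0 :: complex)" using card_Stab_pos[of a] by (simp only: of_nat_eq_0_iff)
  then show ?thesis using LG_degree[of a b] unfolding card_tri char_deg_def
    by (metis nonzero_mult_div_cancel_left)
qed

lemma ind_char_LG_act: "ind_char G (LG (dualM t a) b) = ind_char G (LG a b)"
proof -
  obtain s where s: "s \<in> carrier G" "tc s = t" using coords_surj by blast
  have "ind_char G (LG a b) = ind_char G (\<lambda>g. LG (dualM t a) b (s \<otimes> g \<otimes> inv s))"
    using LG_conj[OF s(1), of _ a b] s(2) by (intro ind_char_cong is_group) simp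
  also have "\<dots> = ind_char G (LG (dualM t a) b)"
    by (rule mono_datum.ind_char_conj[OF LG_datum s(1)])
  finally show ?thesis by simp
qed

text \<open>The set described by \<open>C\<close> is automatically a union of orbits, because a and
  its translates under \<open>dualM\<close> induce the same characters.\<close>

lemma count_chars:
  assumes B: "\<And>a b. P (ind_char G (LG a b)) \<longleftrightarrow> C a"
    and A: "\<And>a b. a \<noteq> 0 \<Longrightarrow> \<not> P (ind_char G (LA a b))"
    and m: "\<And>a. C a \<Longrightarrow> card (Stab a) = m"
    and N: "card {a. C a} * m\<^sup>2 = N * q ^ 3"
  shows "card {\<chi> \<in> Irr G. P \<chi>} = N"
proof -
  have "{\<chi> \<in> Irr G. P \<chi>} = {ind_char G (LG a b) | a b. a \<in> {a. C a}}"
  proof (intro equalityI subsetI)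
    fix \<chi> assume "\<chi> \<in> {\<chi> \<in> Irr G. P \<chi>}"
    then have \<chi>: "\<chi> \<in> Irr G" "P \<chi>" by auto
    from \<chi>(1) show "\<chi> \<in> {ind_char G (LG a b) | a b. a \<in> {a. C a}}"
    proof (cases rule: Irr_cases)
      case (A a b)
      then show ?thesis using \<chi>(2) assms(2) by blast
    next
      case (B a b)
      then have "C a" using \<chi>(2) assms(1) by simp
      then show ?thesis using B by blast
    qed
  qed (use B LG_Irr in auto)
  moreover have "card {ind_char G (LG a b) | a b. a \<in> {a. C a}} * card (UNIV :: 'f tri set) = card {a. C a} * m\<^sup>2"
  proof (rule card_little_group_chars)
    show "dualM t a \<in> {a. C a}" if "a \<in> {a. C a}" for a t
      using that B ind_char_LG_act by (metis mem_Collect_eq)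
  qed (use m in auto)
  ultimately have "card {\<chi> \<in> Irr G. P \<chi>} * q ^ 3 = N * q ^ 3" using N by (simp add: card_tri)
  then show ?thesis using q_pos by simp
qed

lemma degree_chars:
  assumes B: "\<And>a b. P (ind_char G (LG a b)) \<longleftrightarrow> C a"
    and A: "\<And>a b. a \<noteq> 0 \<Longrightarrow> \<not> P (ind_char G (LA a b))"
    and D: "\<And>a. C a \<Longrightarrow> D (of_nat (q ^ 3) / of_nat (card (Stab a)))"
  shows "\<forall>\<chi>\<in>Irr G. P \<chi> \<longrightarrow> D (char_deg G \<chi>)"
proof (intro ballI impI)
  fix \<chi> assume \<chi>: "\<chi> \<in> Irr G" "P \<chi>"
  from \<chi>(1) show "D (char_deg G \<chi>)"
  proof (cases rule: Irr_cases)
    case (A a b)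
    then show ?thesis using \<chi>(2) assms(2) by blast
  next
    case (B a b)
    then have "C a" using \<chi>(2) assms(1) by simp
    then show ?thesis using D LG_char_deg B by simp
  qed
qed

lemma of_nat_div_eq_iff:
  assumes "m > 0" "n > 0"
  shows "of_nat (q ^ 3) / of_nat m = (of_nat (q ^ 3) / of_nat n :: complex) \<longleftrightarrow> m = n"
proof -
  have "of_nat (q ^ 3) \<noteq> (0 :: complex)" using q_pos by simp
  then show ?thesis using assms by (auto simp: divide_eq_eq eq_divide_eq)
qed

text \<open>\<open>Wt\<close> holds the triples (a8, a9, a10), and a linear form in (a5, a6, a7)
  decides the stabiliser. It vanishes on q^2 of the q^3 triples; together with q choices of a3 this
  gives q^3 |Wt| and q^3 (q - 1) |Wt| values of a. Distinct orders m0 and m1 let the degree tell the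
  two sets apart.\<close>

lemma count_chars_split:
  assumes B: "\<And>a3 v w a11 b. P (ind_char G (LG (a3, v, w, a11) b)) \<longleftrightarrow> a11 = 0 \<and> w \<in> Wt"
    and A: "\<And>a b. a \<noteq> 0 \<Longrightarrow> \<not> P (ind_char G (LA a b))"
    and l: "\<And>w. w \<in> Wt \<Longrightarrow> l w \<noteq> 0"
    and st: "\<And>a3 v w. w \<in> Wt \<Longrightarrow> card (Stab (a3, v, w, 0)) = (if lin (l w) v = 0 then m0 else m1)"
    and m: "m0 > 0" "m1 > 0" "m0 \<noteq> m1"
  shows "card {\<chi> \<in> Irr G. P \<chi> \<and> char_deg G \<chi> = of_nat (q ^ 3) / of_nat m0} = card Wt * m0\<^sup>2"
    and "card {\<chi> \<in> Irr G. P \<chi> \<and> char_deg G \<chi> = of_nat (q ^ 3) / of_nat m1} = card Wt * (q - 1) * m1\<^sup>2"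
    and "\<forall>\<chi>\<in>Irr G. P \<chi> \<longrightarrow> char_deg G \<chi> = of_nat (q ^ 3) / of_nat m0 \<or> char_deg G \<chi> = of_nat (q ^ 3) / of_nat m1"
proof -
  let ?C = "\<lambda>a :: 'f vec8. snd (snd (snd a)) = 0 \<and> fst (snd (snd a)) \<in> Wt"
  have B': "P (ind_char G (LG a b)) \<longleftrightarrow> ?C a" for a b using B by (cases a) auto
  have st': "card (Stab a) = (if lin (l (fst (snd (snd a)))) (fst (snd a)) = 0 then m0 else m1)" if "?C a" for a
    using that st by (cases a) auto
  have cardC: "card {a. ?C a \<and> lin (l (fst (snd (snd a)))) (fst (snd a)) \<in> T} = q * card Wt * k"
    if k: "\<And>w. w \<in> Wt \<Longrightarrow> card {v. lin (l w) v \<in> T} = k" for T k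
  proof -
    have "bij_betw (\<lambda>(a3, w, v). (a3, v, w, 0)) (UNIV \<times> (SIGMA w:Wt. {v. lin (l w) v \<in> T}))
        {a. ?C a \<and> lin (l (fst (snd (snd a)))) (fst (snd a)) \<in> T}"
      by (rule bij_betw_byWitness[where f' = "\<lambda>(a3, v, w, a11). (a3, w, v)"]) auto
    from bij_betw_same_card[OF this, symmetric] show ?thesis
      using k by (simp add: card_cartesian_product card_SigmaI q_def mult.assoc)
  qed
  have k0: "card {v. lin (l w) v \<in> {0}} = q\<^sup>2" if "w \<in> Wt" for w
    using card_lin[OF l[OF that]] by (simp add: q_def)
  have k1: "card {v. lin (l w) v \<in> - {0}} = q\<^sup>2 * (q - 1)" if "w \<in> Wt" for w
  proof -
    have "{v. lin (l w) v \<in> - {0}} = - {v. lin (l w) v = 0}" by auto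
    then have "card {v. lin (l w) v \<in> - {0}} = q ^ 3 - q\<^sup>2"
      using card_lin[OF l[OF that]] by (simp add: card_uminus_set card_tri q_def[symmetric])
    then show ?thesis by (simp add: diff_mult_distrib2 power2_eq_square power3_eq_cube)
  qed
  have deg: "char_deg G (ind_char G (LG a b)) = of_nat (q ^ 3) / of_nat k \<longleftrightarrow> card (Stab a) = k" if "k > 0" for a b k
    unfolding LG_char_deg by (rule of_nat_div_eq_iff[OF card_Stab_pos that])
  show "card {\<chi> \<in> Irr G. P \<chi> \<and> char_deg G \<chi> = of_nat (q ^ 3) / of_nat m0} = card Wt * m0\<^sup>2"
  proof (rule count_chars[where m = m0 and C = "\<lambda>a. ?C a \<and> lin (l (fst (snd (snd a)))) (fst (snd a)) \<in> {0}"])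
    show "(P (ind_char G (LG a b)) \<and> char_deg G (ind_char G (LG a b)) = of_nat (q ^ 3) / of_nat m0) \<longleftrightarrow>
        ?C a \<and> lin (l (fst (snd (snd a)))) (fst (snd a)) \<in> {0}" for a b
      using B'[of a b] deg[OF m(1), of a b] st'[of a] m(3) by (auto split: if_splits)
    show "card {a. ?C a \<and> lin (l (fst (snd (snd a)))) (fst (snd a)) \<in> {0}} * m0\<^sup>2 = card Wt * m0\<^sup>2 * q ^ 3"
      using cardC[OF k0] by (simp add: power2_eq_square power3_eq_cube)
  qed (use A st' in auto)
  show "card {\<chi> \<in> Irr G. P \<chi> \<and> char_deg G \<chi> = of_nat (q ^ 3) / of_nat m1} = card Wt * (q - 1) * m1\<^sup>2"
  proof (rule count_chars[where m = m1 and C = "\<lambda>a. ?C a \<and> lin (l (fst (snd (snd a)))) (fst (snd a)) \<in> - {0}"])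
    show "(P (ind_char G (LG a b)) \<and> char_deg G (ind_char G (LG a b)) = of_nat (q ^ 3) / of_nat m1) \<longleftrightarrow>
        ?C a \<and> lin (l (fst (snd (snd a)))) (fst (snd a)) \<in> - {0}" for a b
      using B'[of a b] deg[OF m(2), of a b] st'[of a] m(3) by (auto split: if_splits)
    show "card {a. ?C a \<and> lin (l (fst (snd (snd a)))) (fst (snd a)) \<in> - {0}} * m1\<^sup>2 = card Wt * (q - 1) * m1\<^sup>2 * q ^ 3"
      using cardC[OF k1] by (simp add: power2_eq_square power3_eq_cube)
  qed (use A st' in auto)
  show "\<forall>\<chi>\<in>Irr G. P \<chi> \<longrightarrow> char_deg G \<chi> = of_nat (q ^ 3) / of_nat m0 \<or> char_deg G \<chi> = of_nat (q ^ 3) / of_nat m1"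
    by (rule degree_chars[where C = ?C]) (use A B' st' in auto)
qed

lemma Irr_kernel_set_mult:
  assumes "\<chi> \<in> Irr G" "B \<subseteq> carrier G" "C \<subseteq> carrier G" "\<one> \<in> B" "\<one> \<in> C"
  shows "B <#> C \<subseteq> char_ker G \<chi> \<longleftrightarrow> B \<subseteq> char_ker G \<chi> \<and> C \<subseteq> char_ker G \<chi>"
  using assms(1)
proof (cases rule: Irr_cases)
  case (A a b)
  then show ?thesis using mono_datum.ind_char_kernel_set_mult[OF LA_datum[OF A(1)] assms(2-5)] by simp
next
  case (B a b)
  then show ?thesis using mono_datum.ind_char_kernel_set_mult[OF LG_datum assms(2-5)] by simp
qed

lemma Xr_subgroup: "\<lbrakk>1 \<le> j; j \<le> 12\<rbrakk> \<Longrightarrow> Xr x j \<subseteq> carrier G" "\<lbrakk>1 \<le> j; j \<le> 12\<rbrakk> \<Longrightarrow> \<one> \<in> Xr x j"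
  using x_closed x_zero[of j] by (auto simp: Xr_def image_iff intro: exI[of _ 0])

lemma Xr_mult_in_ker:
  assumes \<chi>: "\<chi> \<in> Irr G" and j: "1 \<le> j" "j \<le> 12" and k: "1 \<le> k" "k \<le> 12"
  shows "Xr x j <#> Xr x k \<subseteq> char_ker G \<chi> \<longleftrightarrow> in_ker G x \<chi> j \<and> in_ker G x \<chi> k"
  unfolding in_ker_def using Irr_kernel_set_mult[OF \<chi>] Xr_subgroup j k by simp

lemma Xr_mult3_in_ker:
  assumes \<chi>: "\<chi> \<in> Irr G" and j: "1 \<le> j" "j \<le> 12"
  shows "Xr x j <#> Xr x 11 <#> Xr x 12 \<subseteq> char_ker G \<chi> \<longleftrightarrow> in_ker G x \<chi> j \<and> in_ker G x \<chi> 11 \<and> in_ker G x \<chi> 12"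
proof -
  have c: "Xr x j <#> Xr x 11 \<subseteq> carrier G" using Xr_subgroup[of j] Xr_subgroup[of 11] j by (simp add: set_mult_closed)
  have "\<one> \<otimes> \<one> \<in> Xr x j <#> Xr x 11"
    unfolding set_mult_def using Xr_subgroup(2)[of j] Xr_subgroup(2)[of 11] j by (intro UN_I) auto
  then have o: "\<one> \<in> Xr x j <#> Xr x 11" by simp
  show ?thesis
    using Irr_kernel_set_mult[OF \<chi> c _ o] Xr_subgroup[of 12] Xr_mult_in_ker[OF \<chi> j, of 11] by (auto simp: in_ker_def)
qed

lemma atLeastAtMost_5_12: "{5..12 :: nat} = {5, 6, 7, 8, 9, 10, 11, 12}" "{8..12 :: nat} = {8, 9, 10, 11, 12}"
  by auto

lemma cls_iff:
  assumes "\<chi> \<in> Irr G"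
  defines "ker \<equiv> in_ker G x \<chi>"
  shows "cls1 G x \<chi> \<longleftrightarrow> \<not> ker 12" "cls2 G x \<chi> \<longleftrightarrow> ker 12 \<and> \<not> ker 11"
    "cls3 G x \<chi> \<longleftrightarrow> ker 11 \<and> ker 12 \<and> \<not> ker 8 \<and> \<not> ker 9 \<and> \<not> ker 10"
    "cls4 G x \<chi> 8 9 10 \<longleftrightarrow> ker 10 \<and> ker 11 \<and> ker 12 \<and> \<not> ker 8 \<and> \<not> ker 9"
    "cls4 G x \<chi> 8 10 9 \<longleftrightarrow> ker 9 \<and> ker 11 \<and> ker 12 \<and> \<not> ker 8 \<and> \<not> ker 10"
    "cls4 G x \<chi> 9 10 8 \<longleftrightarrow> ker 8 \<and> ker 11 \<and> ker 12 \<and> \<not> ker 9 \<and> \<not> ker 10"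
    "cls5 G x \<chi> 8 \<longleftrightarrow> ker 9 \<and> ker 10 \<and> ker 11 \<and> ker 12 \<and> \<not> ker 8"
    "cls5 G x \<chi> 9 \<longleftrightarrow> ker 8 \<and> ker 10 \<and> ker 11 \<and> ker 12 \<and> \<not> ker 9"
    "cls5 G x \<chi> 10 \<longleftrightarrow> ker 8 \<and> ker 9 \<and> ker 11 \<and> ker 12 \<and> \<not> ker 10"
    "cls6 G x \<chi> \<longleftrightarrow> ker 8 \<and> ker 9 \<and> ker 10 \<and> ker 11 \<and> ker 12 \<and> \<not> ker 5 \<and> \<not> ker 6 \<and> \<not> ker 7"
    "cls7 G x \<chi> i j k \<longleftrightarrow> ker k \<and> ker 8 \<and> ker 9 \<and> ker 10 \<and> ker 11 \<and> ker 12 \<and> \<not> ker i \<and> \<not> ker j"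
    "cls8 G x \<chi> 5 \<longleftrightarrow> ker 6 \<and> ker 7 \<and> ker 8 \<and> ker 9 \<and> ker 10 \<and> ker 11 \<and> ker 12 \<and> \<not> ker 5"
    "cls8 G x \<chi> 6 \<longleftrightarrow> ker 5 \<and> ker 7 \<and> ker 8 \<and> ker 9 \<and> ker 10 \<and> ker 11 \<and> ker 12 \<and> \<not> ker 6"
    "cls8 G x \<chi> 7 \<longleftrightarrow> ker 5 \<and> ker 6 \<and> ker 8 \<and> ker 9 \<and> ker 10 \<and> ker 11 \<and> ker 12 \<and> \<not> ker 7"
    "cls9 G x \<chi> \<longleftrightarrow> ker 5 \<and> ker 6 \<and> ker 7 \<and> ker 8 \<and> ker 9 \<and> ker 10 \<and> ker 11 \<and> ker 12"
  unfolding ker_def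
  by (simp_all add: cls1_def cls2_def cls3_def cls4_def cls5_def cls6_def cls7_def cls8_def cls9_def atLeastAtMost_5_12
      insert_Diff_if Xr_mult_in_ker[OF assms(1)] Xr_mult3_in_ker[OF assms(1)])

lemma cls_LA:
  assumes a: "a \<noteq> 0"
  defines "\<chi> \<equiv> \<lambda>b. ind_char G (LA a b)"
  shows "cls1 G x (\<chi> b)" "\<not> cls2 G x (\<chi> b)" "\<not> cls3 G x (\<chi> b)"
    "\<not> cls4 G x (\<chi> b) 8 9 10" "\<not> cls4 G x (\<chi> b) 8 10 9" "\<not> cls4 G x (\<chi> b) 9 10 8"
    "\<not> cls5 G x (\<chi> b) 8" "\<not> cls5 G x (\<chi> b) 9" "\<not> cls5 G x (\<chi> b) 10" "\<not> cls6 G x (\<chi> b)"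
    "\<not> cls7 G x (\<chi> b) i j k"
    "\<not> cls8 G x (\<chi> b) 5" "\<not> cls8 G x (\<chi> b) 6" "\<not> cls8 G x (\<chi> b) 7" "\<not> cls9 G x (\<chi> b)"
  unfolding \<chi>_def cls_iff[OF LA_Irr[OF a]] using LA_not_in_ker[OF a] by simp_all

lemma cls_LG:
  fixes a3 a5 a6 a7 a8 a9 a10 a11 :: 'f
  defines "\<chi> \<equiv> \<lambda>b. ind_char G (LG (a3, (a5, a6, a7), (a8, a9, a10), a11) b)"
  shows "\<not> cls1 G x (\<chi> b)" "cls2 G x (\<chi> b) \<longleftrightarrow> a11 \<noteq> 0"
    "cls3 G x (\<chi> b) \<longleftrightarrow> a11 = 0 \<and> a8 \<noteq> 0 \<and> a9 \<noteq> 0 \<and> a10 \<noteq> 0"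
    "cls4 G x (\<chi> b) 8 9 10 \<longleftrightarrow> a11 = 0 \<and> a8 \<noteq> 0 \<and> a9 \<noteq> 0 \<and> a10 = 0"
    "cls4 G x (\<chi> b) 8 10 9 \<longleftrightarrow> a11 = 0 \<and> a8 \<noteq> 0 \<and> a9 = 0 \<and> a10 \<noteq> 0"
    "cls4 G x (\<chi> b) 9 10 8 \<longleftrightarrow> a11 = 0 \<and> a8 = 0 \<and> a9 \<noteq> 0 \<and> a10 \<noteq> 0"
    "cls5 G x (\<chi> b) 8 \<longleftrightarrow> a11 = 0 \<and> a8 \<noteq> 0 \<and> a9 = 0 \<and> a10 = 0"
    "cls5 G x (\<chi> b) 9 \<longleftrightarrow> a11 = 0 \<and> a8 = 0 \<and> a9 \<noteq> 0 \<and> a10 = 0"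
    "cls5 G x (\<chi> b) 10 \<longleftrightarrow> a11 = 0 \<and> a8 = 0 \<and> a9 = 0 \<and> a10 \<noteq> 0"
    "cls6 G x (\<chi> b) \<longleftrightarrow> a11 = 0 \<and> a8 = 0 \<and> a9 = 0 \<and> a10 = 0 \<and> a5 \<noteq> 0 \<and> a6 \<noteq> 0 \<and> a7 \<noteq> 0"
    "cls7 G x (\<chi> b) 5 6 7 \<longleftrightarrow> a11 = 0 \<and> a8 = 0 \<and> a9 = 0 \<and> a10 = 0 \<and> a5 \<noteq> 0 \<and> a6 \<noteq> 0 \<and> a7 = 0"
    "cls7 G x (\<chi> b) 5 7 6 \<longleftrightarrow> a11 = 0 \<and> a8 = 0 \<and> a9 = 0 \<and> a10 = 0 \<and> a5 \<noteq> 0 \<and> a6 = 0 \<and> a7 \<noteq> 0"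
    "cls7 G x (\<chi> b) 6 7 5 \<longleftrightarrow> a11 = 0 \<and> a8 = 0 \<and> a9 = 0 \<and> a10 = 0 \<and> a5 = 0 \<and> a6 \<noteq> 0 \<and> a7 \<noteq> 0"
    "cls8 G x (\<chi> b) 5 \<longleftrightarrow> a11 = 0 \<and> a8 = 0 \<and> a9 = 0 \<and> a10 = 0 \<and> a5 \<noteq> 0 \<and> a6 = 0 \<and> a7 = 0"
    "cls8 G x (\<chi> b) 6 \<longleftrightarrow> a11 = 0 \<and> a8 = 0 \<and> a9 = 0 \<and> a10 = 0 \<and> a5 = 0 \<and> a6 \<noteq> 0 \<and> a7 = 0"
    "cls8 G x (\<chi> b) 7 \<longleftrightarrow> a11 = 0 \<and> a8 = 0 \<and> a9 = 0 \<and> a10 = 0 \<and> a5 = 0 \<and> a6 = 0 \<and> a7 \<noteq> 0"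
    "cls9 G x (\<chi> b) \<longleftrightarrow> a11 = 0 \<and> a8 = 0 \<and> a9 = 0 \<and> a10 = 0 \<and> a5 = 0 \<and> a6 = 0 \<and> a7 = 0"
  unfolding \<chi>_def cls_iff[OF LG_Irr] LG_in_ker_simps by (auto simp: LG_in_ker_simps(1))

lemma exactly_one_class:
  assumes "\<chi> \<in> Irr G"
  shows "card {c. c < length (thm41_classes G x) \<and> (thm41_classes G x ! c) \<chi>} = 1"
proof -
  have eq: "card {c. c < length (thm41_classes G x) \<and> (thm41_classes G x ! c) \<chi>} =
      length (filter (\<lambda>p. p \<chi>) (thm41_classes G x))"
    by (rule length_filter_conv_card[symmetric])
  show ?thesis
    using assms
  proof (cases rule: Irr_cases)
    case (A a b)
    then show ?thesis unfolding eq by (simp add: thm41_classes_def cls_LA)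
  next
    case (B a b)
    obtain a3 a5 a6 a7 a8 a9 a10 a11 where a: "a = (a3, (a5, a6, a7), (a8, a9, a10), a11)"
      by (cases a) auto
    \<comment> \<open>The class depends only on which of a5, ..., a11 vanish, so seven case splits
      decide it.\<close>
    show ?thesis unfolding eq unfolding B a
      by (cases "a11 = 0"; cases "a8 = 0"; cases "a9 = 0"; cases "a10 = 0"; cases "a5 = 0"; cases "a6 = 0"; cases "a7 = 0")
        (simp_all add: thm41_classes_def cls_LG)
  qed
qed

end

section \<open>The counts, class by class\<close>

context UD4_char
begin

lemma q_ne_1: "q \<noteq> 1"
proof
  assume "q = 1"
  then obtain c where "(UNIV :: 'f set) = {c}" unfolding q_def by (rule card_1_singletonE)
  then have "(0 :: 'f) = 1" by (metis UNIV_I singletonD)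
  then show False by simp
qed

lemma card_nonzero: "card (- {0 :: 'f}) = q - 1"
  by (simp add: card_uminus_set q_def)

lemma count_chars_uniform:
  assumes B: "\<And>a b. P (ind_char G (LG a b)) \<longleftrightarrow> a \<in> Q"
    and A: "\<And>a b. a \<noteq> 0 \<Longrightarrow> \<not> P (ind_char G (LA a b))"
    and m: "\<And>a. a \<in> Q \<Longrightarrow> card (Stab a) = m"
    and d: "d * m = q ^ 3" and N: "card Q * m\<^sup>2 = N * q ^ 3"
  shows "card {\<chi> \<in> Irr G. P \<chi>} = N \<and> (\<forall>\<chi>\<in>Irr G. P \<chi> \<longrightarrow> char_deg G \<chi> = of_nat d)"
proof
  show "card {\<chi> \<in> Irr G. P \<chi>} = N"
    by (rule count_chars[where C = "\<lambda>a. a \<in> Q" and m = m]) (use assms in auto)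
  have "of_nat (q ^ 3) / of_nat m = (of_nat d :: complex)"
  proof -
    have "m \<noteq> 0" using d q_pos by (metis mult_0_right power_not_zero less_numeral_extra(3))
    then show ?thesis unfolding d[symmetric] by simp
  qed
  then show "\<forall>\<chi>\<in>Irr G. P \<chi> \<longrightarrow> char_deg G \<chi> = of_nat d"
    by (intro degree_chars[where C = "\<lambda>a. a \<in> Q"]) (use B A m in auto)
qed

text \<open>Stabilisers of order q and 1 give the degrees q^2 and q^3; these are different because q
  is not 1.\<close>

lemma count_chars_split_q:
  assumes B: "\<And>a3 v w a11 b. P (ind_char G (LG (a3, v, w, a11) b)) \<longleftrightarrow> a11 = 0 \<and> w \<in> Wt"
    and A: "\<And>a b. a \<noteq> 0 \<Longrightarrow> \<not> P (ind_char G (LA a b))"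
    and l: "\<And>w. w \<in> Wt \<Longrightarrow> l w \<noteq> 0"
    and st: "\<And>a3 v w. w \<in> Wt \<Longrightarrow> card (Stab (a3, v, w, 0)) = (if lin (l w) v = 0 then q else 1)"
    and N: "card Wt * (q - 1) = N1" "q ^ 2 * card Wt = N2"
  shows "card {\<chi> \<in> Irr G. P \<chi> \<and> char_deg G \<chi> = of_nat (q ^ 3)} = N1 \<and>
    card {\<chi> \<in> Irr G. P \<chi> \<and> char_deg G \<chi> = of_nat (q ^ 2)} = N2 \<and>
    (\<forall>\<chi>\<in>Irr G. P \<chi> \<longrightarrow> char_deg G \<chi> = of_nat (q ^ 3) \<or> char_deg G \<chi> = of_nat (q ^ 2))"
proof -
  have 1: "of_nat (q ^ 3) / of_nat 1 = (of_nat (q ^ 3) :: complex)" by simp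
  have 2: "of_nat (q ^ 3) / of_nat q = (of_nat (q ^ 2) :: complex)"
    using q_pos by (simp add: power2_eq_square power3_eq_cube)
  note c = count_chars_split[where P = P and Wt = Wt and l = l and ?m0.0 = q and ?m1.0 = 1,
      OF B A l st, unfolded 1 2]
  show ?thesis using c q_pos q_ne_1 N by (simp add: mult.commute) blast
qed

text \<open>By \<open>LA_inj\<close> the characters correspond to pairs of a nonzero a and a triple
  b, so no division by orbit lengths occurs.\<close>

lemma cls1_counts:
  "card {\<chi> \<in> Irr G. cls1 G x \<chi>} = q ^ 3 * (q - 1)"
  "\<forall>\<chi>\<in>Irr G. cls1 G x \<chi> \<longrightarrow> char_deg G \<chi> = of_nat (q ^ 4)"
proof -
  have not1: "\<not> cls1 G x (ind_char G (LG a b))" for a b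
  proof -
    obtain a3 a5 a6 a7 a8 a9 a10 a11 where a: "a = (a3, (a5, a6, a7), (a8, a9, a10), a11)"
      by (cases a) auto
    show ?thesis unfolding a by (rule cls_LG(1))
  qed
  have eq: "{\<chi> \<in> Irr G. cls1 G x \<chi>} = (\<lambda>(a, b). ind_char G (LA a b)) ` ((- {0}) \<times> UNIV)"
  proof (intro equalityI subsetI)
    fix \<chi> assume "\<chi> \<in> {\<chi> \<in> Irr G. cls1 G x \<chi>}"
    then have \<chi>: "\<chi> \<in> Irr G" "cls1 G x \<chi>" by auto
    from \<chi>(1) show "\<chi> \<in> (\<lambda>(a, b). ind_char G (LA a b)) ` ((- {0}) \<times> UNIV)"
    proof (cases rule: Irr_cases)
      case (A a b)
      then show ?thesis by (intro image_eqI[of _ _ "(a, b)"]) auto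
    next
      case (B a b)
      then show ?thesis using \<chi>(2) not1 by blast
    qed
  next
    fix \<chi> assume "\<chi> \<in> (\<lambda>(a, b). ind_char G (LA a b)) ` ((- {0}) \<times> UNIV)"
    then obtain a b where "a \<noteq> 0" "\<chi> = ind_char G (LA a b)" by force
    then show "\<chi> \<in> {\<chi> \<in> Irr G. cls1 G x \<chi>}" using LA_Irr cls_LA(1) by simp
  qed
  have "inj_on (\<lambda>(a, b). ind_char G (LA a b)) ((- {0}) \<times> UNIV)"
  proof (rule inj_onI)
    fix p p' assume p: "p \<in> (- {0}) \<times> (UNIV :: 'f tri set)" "p' \<in> (- {0}) \<times> (UNIV :: 'f tri set)"
      and e: "(case p of (a, b) \<Rightarrow> ind_char G (LA a b)) = (case p' of (a, b) \<Rightarrow> ind_char G (LA a b))"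
    obtain a b a' b' where ab: "p = (a, b)" "p' = (a', b')" by (cases p; cases p')
    then show "p = p'" using LA_inj[of a a' b b'] p e by simp
  qed
  then show "card {\<chi> \<in> Irr G. cls1 G x \<chi>} = q ^ 3 * (q - 1)"
    unfolding eq by (simp add: card_image card_cartesian_product card_nonzero card_tri mult.commute)
  show "\<forall>\<chi>\<in>Irr G. cls1 G x \<chi> \<longrightarrow> char_deg G \<chi> = of_nat (q ^ 4)"
  proof (intro ballI impI)
    fix \<chi> assume \<chi>: "\<chi> \<in> Irr G" "cls1 G x \<chi>"
    from \<chi>(1) show "char_deg G \<chi> = of_nat (q ^ 4)"
    proof (cases rule: Irr_cases)
      case (A a b)
      then show ?thesis using LA_degree by simp
    next
      case (B a b)
      then show ?thesis using \<chi>(2) not1 by blast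
    qed
  qed
qed

lemma cls2_counts:
  "card {\<chi> \<in> Irr G. cls2 G x \<chi>} = q ^ 4 * (q - 1) \<and>
    (\<forall>\<chi>\<in>Irr G. cls2 G x \<chi> \<longrightarrow> char_deg G \<chi> = of_nat (q ^ 3))"
proof (rule count_chars_uniform[where m = 1 and Q = "UNIV \<times> UNIV \<times> UNIV \<times> (- {0})"])
  show "card ((UNIV :: 'f set) \<times> (UNIV :: 'f tri set) \<times> (UNIV :: 'f tri set) \<times> (- {0 :: 'f})) * 1\<^sup>2 = q ^ 4 * (q - 1) * q ^ 3"
    by (simp add: card_cartesian_product card_nonzero card_tri q_def[symmetric] eval_nat_numeral)
  show "card (Stab a) = 1" if "a \<in> UNIV \<times> UNIV \<times> UNIV \<times> (- {0})" for a
  proof -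
    obtain a3 v w a11 where a: "a = (a3, v, w, a11)" by (cases a)
    show ?thesis using that Stab_11 unfolding a by simp
  qed
qed (auto simp: cls_LG cls_LA)

lemma cls3_odd_counts:
  assumes "odd q"
  shows "card {\<chi> \<in> Irr G. cls3 G x \<chi>} = q * (q - 1) ^ 3 \<and>
    (\<forall>\<chi>\<in>Irr G. cls3 G x \<chi> \<longrightarrow> char_deg G \<chi> = of_nat (q ^ 3))"
proof (rule count_chars_uniform[where m = 1 and Q = "UNIV \<times> UNIV \<times> ((- {0}) \<times> (- {0}) \<times> (- {0})) \<times> {0}"])
  have "(2 :: 'f) \<noteq> 0" using assms by (simp add: two_eq_0_iff_even_card q_def)
  then have odd: "card (Stab (a3, v, (a8, a9, a10), 0)) = 1" if "a8 \<noteq> 0" "a9 \<noteq> 0" "a10 \<noteq> 0" for a3 v a8 a9 a10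
    using that by (rule Stab_odd)
  show "card (Stab a) = 1" if "a \<in> UNIV \<times> UNIV \<times> ((- {0}) \<times> (- {0}) \<times> (- {0})) \<times> {0}" for a
  proof -
    obtain a3 v a8 a9 a10 a11 where a: "a = (a3, v, (a8, a9, a10), a11)" by (cases a) auto
    show ?thesis using that odd unfolding a by simp
  qed
  show "card ((UNIV :: 'f set) \<times> (UNIV :: 'f tri set) \<times> ((- {0 :: 'f}) \<times> (- {0 :: 'f}) \<times> (- {0 :: 'f})) \<times> {0 :: 'f}) * 1\<^sup>2 =
      q * (q - 1) ^ 3 * q ^ 3"
    by (simp add: card_cartesian_product card_nonzero card_tri q_def[symmetric] eval_nat_numeral)
qed (auto simp: cls_LG cls_LA)

lemma cls3_even_counts:
  assumes "even q"
  shows "card {\<chi> \<in> Irr G. cls3 G x \<chi> \<and> char_deg G \<chi> = of_nat (q ^ 3)} = (q - 1) ^ 3 \<and>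
    card {\<chi> \<in> Irr G. cls3 G x \<chi> \<and> char_deg G \<chi> = of_nat (q ^ 3) / 2} = 4 * (q - 1) ^ 4 \<and>
    (\<forall>\<chi>\<in>Irr G. cls3 G x \<chi> \<longrightarrow> char_deg G \<chi> = of_nat (q ^ 3) \<or> char_deg G \<chi> = of_nat (q ^ 3) / 2)"
proof -
  let ?W = "(- {0 :: 'f}) \<times> (- {0 :: 'f}) \<times> (- {0 :: 'f})" and ?l = "\<lambda>w :: 'f tri. (snd (snd w), fst (snd w), - fst w)"
  have 2: "(2 :: 'f) = 0" using assms by (simp add: two_eq_0_iff_even_card q_def)
  have n: "of_nat (q ^ 3) / of_nat 1 = (of_nat (q ^ 3) :: complex)" "of_nat (q ^ 3) / of_nat 2 = (of_nat (q ^ 3) / 2 :: complex)"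
    by simp_all
  have B: "cls3 G x (ind_char G (LG (a3, v, w, a11) b)) \<longleftrightarrow> a11 = 0 \<and> w \<in> ?W" for a3 v w a11 b
    by (cases v; cases w) (simp add: cls_LG)
  have l: "?l w \<noteq> 0" if "w \<in> ?W" for w using that by (auto simp: zero_prod_def)
  have st: "card (Stab (a3, v, w, 0)) = (if lin (?l w) v = 0 then 1 else 2)" if "w \<in> ?W" for a3 v w
    using that Stab_even[OF 2] by (cases w) simp
  have W: "card ?W = (q - 1) ^ 3" by (simp add: card_cartesian_product card_nonzero power3_eq_cube)
  \<comment> \<open>The factor 4 in the count is the square of the stabiliser order 2.\<close>
  note c = count_chars_split[where P = "cls3 G x" and Wt = ?W and l = ?l and ?m0.0 = 1 and ?m1.0 = 2, OF B cls_LA(3) l st, unfolded n W]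
  have "(q - 1) ^ 3 * (q - 1) * 2\<^sup>2 = 4 * (q - 1) ^ 4" by (simp add: eval_nat_numeral)
  then show ?thesis using c by simp
qed

lemmas card_simps = card_cartesian_product card_nonzero power2_eq_square power3_eq_cube

lemma cls4_8_9_counts:
  "card {\<chi> \<in> Irr G. cls4 G x \<chi> 8 9 10 \<and> char_deg G \<chi> = of_nat (q ^ 3)} = (q - 1) ^ 3 \<and>
    card {\<chi> \<in> Irr G. cls4 G x \<chi> 8 9 10 \<and> char_deg G \<chi> = of_nat (q ^ 2)} = q ^ 2 * (q - 1) ^ 2 \<and>
    (\<forall>\<chi>\<in>Irr G. cls4 G x \<chi> 8 9 10 \<longrightarrow> char_deg G \<chi> = of_nat (q ^ 3) \<or> char_deg G \<chi> = of_nat (q ^ 2))"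
  by (rule count_chars_split_q[where Wt = "(- {0 :: 'f}) \<times> (- {0 :: 'f}) \<times> {0 :: 'f}" and l = "\<lambda>w. (0, fst (snd w), fst w)"])
    (simp_all add: split_paired_all cls_LG cls_LA Stab_8_9 zero_prod_def card_simps)

lemma cls4_8_10_counts:
  "card {\<chi> \<in> Irr G. cls4 G x \<chi> 8 10 9 \<and> char_deg G \<chi> = of_nat (q ^ 3)} = (q - 1) ^ 3 \<and>
    card {\<chi> \<in> Irr G. cls4 G x \<chi> 8 10 9 \<and> char_deg G \<chi> = of_nat (q ^ 2)} = q ^ 2 * (q - 1) ^ 2 \<and>
    (\<forall>\<chi>\<in>Irr G. cls4 G x \<chi> 8 10 9 \<longrightarrow> char_deg G \<chi> = of_nat (q ^ 3) \<or> char_deg G \<chi> = of_nat (q ^ 2))"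
  by (rule count_chars_split_q[where Wt = "(- {0 :: 'f}) \<times> {0 :: 'f} \<times> (- {0 :: 'f})" and l = "\<lambda>w. (snd (snd w), 0, fst w)"])
    (simp_all add: split_paired_all cls_LG cls_LA Stab_8_10 zero_prod_def card_simps)

lemma cls4_9_10_counts:
  "card {\<chi> \<in> Irr G. cls4 G x \<chi> 9 10 8 \<and> char_deg G \<chi> = of_nat (q ^ 3)} = (q - 1) ^ 3 \<and>
    card {\<chi> \<in> Irr G. cls4 G x \<chi> 9 10 8 \<and> char_deg G \<chi> = of_nat (q ^ 2)} = q ^ 2 * (q - 1) ^ 2 \<and>
    (\<forall>\<chi>\<in>Irr G. cls4 G x \<chi> 9 10 8 \<longrightarrow> char_deg G \<chi> = of_nat (q ^ 3) \<or> char_deg G \<chi> = of_nat (q ^ 2))"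
  by (rule count_chars_split_q[where Wt = "{0 :: 'f} \<times> (- {0 :: 'f}) \<times> (- {0 :: 'f})" and l = "\<lambda>w. (snd (snd w), - fst (snd w), 0)"])
    (simp_all add: split_paired_all cls_LG cls_LA Stab_9_10 zero_prod_def card_simps)

lemma cls5_8_counts:
  "card {\<chi> \<in> Irr G. cls5 G x \<chi> 8 \<and> char_deg G \<chi> = of_nat (q ^ 3)} = (q - 1) ^ 2 \<and>
    card {\<chi> \<in> Irr G. cls5 G x \<chi> 8 \<and> char_deg G \<chi> = of_nat (q ^ 2)} = q ^ 2 * (q - 1) \<and>
    (\<forall>\<chi>\<in>Irr G. cls5 G x \<chi> 8 \<longrightarrow> char_deg G \<chi> = of_nat (q ^ 3) \<or> char_deg G \<chi> = of_nat (q ^ 2))"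
  by (rule count_chars_split_q[where Wt = "(- {0 :: 'f}) \<times> {0 :: 'f} \<times> {0 :: 'f}" and l = "\<lambda>w. (0, 0, 1)"])
    (simp_all add: split_paired_all cls_LG cls_LA Stab_8 zero_prod_def card_simps)

lemma cls5_9_counts:
  "card {\<chi> \<in> Irr G. cls5 G x \<chi> 9 \<and> char_deg G \<chi> = of_nat (q ^ 3)} = (q - 1) ^ 2 \<and>
    card {\<chi> \<in> Irr G. cls5 G x \<chi> 9 \<and> char_deg G \<chi> = of_nat (q ^ 2)} = q ^ 2 * (q - 1) \<and>
    (\<forall>\<chi>\<in>Irr G. cls5 G x \<chi> 9 \<longrightarrow> char_deg G \<chi> = of_nat (q ^ 3) \<or> char_deg G \<chi> = of_nat (q ^ 2))"
  by (rule count_chars_split_q[where Wt = "{0 :: 'f} \<times> (- {0 :: 'f}) \<times> {0 :: 'f}" and l = "\<lambda>w. (0, 1, 0)"])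
    (simp_all add: split_paired_all cls_LG cls_LA Stab_9 zero_prod_def card_simps)

lemma cls5_10_counts:
  "card {\<chi> \<in> Irr G. cls5 G x \<chi> 10 \<and> char_deg G \<chi> = of_nat (q ^ 3)} = (q - 1) ^ 2 \<and>
    card {\<chi> \<in> Irr G. cls5 G x \<chi> 10 \<and> char_deg G \<chi> = of_nat (q ^ 2)} = q ^ 2 * (q - 1) \<and>
    (\<forall>\<chi>\<in>Irr G. cls5 G x \<chi> 10 \<longrightarrow> char_deg G \<chi> = of_nat (q ^ 3) \<or> char_deg G \<chi> = of_nat (q ^ 2))"
  by (rule count_chars_split_q[where Wt = "{0 :: 'f} \<times> {0 :: 'f} \<times> (- {0 :: 'f})" and l = "\<lambda>w. (1, 0, 0)"])
    (simp_all add: split_paired_all cls_LG cls_LA Stab_10 zero_prod_def card_simps)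

text \<open>Once a8, ..., a11 vanish, the stabiliser is the plane of \<open>Stab_567\<close>, of
  order q^2. With q choices of a3 the number of characters is q |Vt| q^4 / q^3.\<close>

lemma count_chars_567:
  assumes B: "\<And>a3 v w a11 b. P (ind_char G (LG (a3, v, w, a11) b)) \<longleftrightarrow> a11 = 0 \<and> w = 0 \<and> v \<in> Vt"
    and A: "\<And>a b. a \<noteq> 0 \<Longrightarrow> \<not> P (ind_char G (LA a b))"
    and 0: "0 \<notin> Vt" and N: "q ^ 2 * card Vt = N"
  shows "card {\<chi> \<in> Irr G. P \<chi>} = N \<and> (\<forall>\<chi>\<in>Irr G. P \<chi> \<longrightarrow> char_deg G \<chi> = of_nat q)"
proof (rule count_chars_uniform[where m = "q ^ 2" and Q = "UNIV \<times> Vt \<times> {0} \<times> {0}"])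
  show "P (ind_char G (LG a b)) \<longleftrightarrow> a \<in> UNIV \<times> Vt \<times> {0} \<times> {0}" for a b
    using B by (cases a) auto
  show "card (Stab a) = q ^ 2" if "a \<in> UNIV \<times> Vt \<times> {0} \<times> {0}" for a
  proof -
    obtain a3 v w a11 where a: "a = (a3, v, w, a11)" by (cases a)
    then have "w = 0" "a11 = 0" "v \<noteq> 0" using that 0 by auto
    then show ?thesis unfolding a by (simp add: Stab_567)
  qed
  show "card ((UNIV :: 'f set) \<times> Vt \<times> {0 :: 'f tri} \<times> {0 :: 'f}) * (q ^ 2)\<^sup>2 = N * q ^ 3"
    unfolding N[symmetric] by (simp add: card_cartesian_product q_def[symmetric] eval_nat_numeral)
qed (use A in \<open>auto simp: power2_eq_square power3_eq_cube\<close>)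

lemma cls6_counts:
  "card {\<chi> \<in> Irr G. cls6 G x \<chi>} = q ^ 2 * (q - 1) ^ 3 \<and> (\<forall>\<chi>\<in>Irr G. cls6 G x \<chi> \<longrightarrow> char_deg G \<chi> = of_nat q)"
  by (rule count_chars_567[where Vt = "(- {0 :: 'f}) \<times> (- {0 :: 'f}) \<times> (- {0 :: 'f})"]) (auto simp: cls_LG cls_LA zero_prod_def card_simps)

lemma cls7_5_6_counts:
  "card {\<chi> \<in> Irr G. cls7 G x \<chi> 5 6 7} = q ^ 2 * (q - 1) ^ 2 \<and> (\<forall>\<chi>\<in>Irr G. cls7 G x \<chi> 5 6 7 \<longrightarrow> char_deg G \<chi> = of_nat q)"
  by (rule count_chars_567[where Vt = "(- {0 :: 'f}) \<times> (- {0 :: 'f}) \<times> {0 :: 'f}"]) (auto simp: cls_LG cls_LA zero_prod_def card_simps)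

lemma cls7_5_7_counts:
  "card {\<chi> \<in> Irr G. cls7 G x \<chi> 5 7 6} = q ^ 2 * (q - 1) ^ 2 \<and> (\<forall>\<chi>\<in>Irr G. cls7 G x \<chi> 5 7 6 \<longrightarrow> char_deg G \<chi> = of_nat q)"
  by (rule count_chars_567[where Vt = "(- {0 :: 'f}) \<times> {0 :: 'f} \<times> (- {0 :: 'f})"]) (auto simp: cls_LG cls_LA zero_prod_def card_simps)

lemma cls7_6_7_counts:
  "card {\<chi> \<in> Irr G. cls7 G x \<chi> 6 7 5} = q ^ 2 * (q - 1) ^ 2 \<and> (\<forall>\<chi>\<in>Irr G. cls7 G x \<chi> 6 7 5 \<longrightarrow> char_deg G \<chi> = of_nat q)"
  by (rule count_chars_567[where Vt = "{0 :: 'f} \<times> (- {0 :: 'f}) \<times> (- {0 :: 'f})"]) (auto simp: cls_LG cls_LA zero_prod_def card_simps)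

lemma cls8_5_counts:
  "card {\<chi> \<in> Irr G. cls8 G x \<chi> 5} = q ^ 2 * (q - 1) \<and> (\<forall>\<chi>\<in>Irr G. cls8 G x \<chi> 5 \<longrightarrow> char_deg G \<chi> = of_nat q)"
  by (rule count_chars_567[where Vt = "(- {0 :: 'f}) \<times> {0 :: 'f} \<times> {0 :: 'f}"]) (auto simp: cls_LG cls_LA zero_prod_def card_simps)

lemma cls8_6_counts:
  "card {\<chi> \<in> Irr G. cls8 G x \<chi> 6} = q ^ 2 * (q - 1) \<and> (\<forall>\<chi>\<in>Irr G. cls8 G x \<chi> 6 \<longrightarrow> char_deg G \<chi> = of_nat q)"
  by (rule count_chars_567[where Vt = "{0 :: 'f} \<times> (- {0 :: 'f}) \<times> {0 :: 'f}"]) (auto simp: cls_LG cls_LA zero_prod_def card_simps)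

lemma cls8_7_counts:
  "card {\<chi> \<in> Irr G. cls8 G x \<chi> 7} = q ^ 2 * (q - 1) \<and> (\<forall>\<chi>\<in>Irr G. cls8 G x \<chi> 7 \<longrightarrow> char_deg G \<chi> = of_nat q)"
  by (rule count_chars_567[where Vt = "{0 :: 'f} \<times> {0 :: 'f} \<times> (- {0 :: 'f})"]) (auto simp: cls_LG cls_LA zero_prod_def card_simps)

text \<open>Only a3 is left and every t stabilises, so the count is q * q^6 / q^3. These are the
  characters trivial on X_5, ..., X_12.\<close>

lemma cls9_counts:
  "card {\<chi> \<in> Irr G. cls9 G x \<chi>} = q ^ 4 \<and> (\<forall>\<chi>\<in>Irr G. cls9 G x \<chi> \<longrightarrow> char_deg G \<chi> = of_nat 1)"
proof (rule count_chars_uniform[where m = "q ^ 3" and Q = "UNIV \<times> {0} \<times> {0} \<times> {0}"])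
  show "card ((UNIV :: 'f set) \<times> {0 :: 'f tri} \<times> {0 :: 'f tri} \<times> {0 :: 'f}) * (q ^ 3)\<^sup>2 = q ^ 4 * q ^ 3"
    by (simp add: card_cartesian_product q_def[symmetric] eval_nat_numeral)
  show "card (Stab a) = q ^ 3" if "a \<in> UNIV \<times> {0} \<times> {0} \<times> {0}" for a using that Stab_3 by auto
qed (auto simp: cls_LG cls_LA zero_prod_def)

end

theorem theorem4p1:
  fixes G :: "('g, 'b) monoid_scheme" and x :: "nat \<Rightarrow> 'f::{field, finite} \<Rightarrow> 'g"
  assumes U: "is_UD4 G x"
  defines "q \<equiv> card (UNIV :: 'f set)"
  shows
    \<comment> \<open>every irreducible character lies in exactly one class\<close>
    "(\<forall>\<chi>\<in>Irr G. card {c. c < length (thm41_classes G x) \<and> (thm41_classes G x ! c) \<chi>} = 1)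
   \<comment> \<open>(1)\<close>
   \<and> card {\<chi>\<in>Irr G. cls1 G x \<chi>} = q^3 * (q - 1)
   \<and> (\<forall>\<chi>\<in>Irr G. cls1 G x \<chi> \<longrightarrow> char_deg G \<chi> = of_nat (q^4))
   \<comment> \<open>(2)\<close>
   \<and> card {\<chi>\<in>Irr G. cls2 G x \<chi>} = q^4 * (q - 1)
   \<and> (\<forall>\<chi>\<in>Irr G. cls2 G x \<chi> \<longrightarrow> char_deg G \<chi> = of_nat (q^3))
   \<comment> \<open>(3)\<close>
   \<and> (odd q \<longrightarrow>
        card {\<chi>\<in>Irr G. cls3 G x \<chi>} = q * (q - 1)^3
      \<and> (\<forall>\<chi>\<in>Irr G. cls3 G x \<chi> \<longrightarrow> char_deg G \<chi> = of_nat (q^3)))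
   \<and> (even q \<longrightarrow>
        card {\<chi>\<in>Irr G. cls3 G x \<chi> \<and> char_deg G \<chi> = of_nat (q^3)} = (q - 1)^3
      \<and> card {\<chi>\<in>Irr G. cls3 G x \<chi> \<and> char_deg G \<chi> = of_nat (q^3) / 2} = 4 * (q - 1)^4
      \<and> (\<forall>\<chi>\<in>Irr G. cls3 G x \<chi> \<longrightarrow>
            char_deg G \<chi> = of_nat (q^3) \<or> char_deg G \<chi> = of_nat (q^3) / 2))
   \<comment> \<open>(4)\<close>
   \<and> (\<forall>(i, j, k) \<in> {(8, 9, 10), (8, 10, 9), (9, 10, 8)}.
        card {\<chi>\<in>Irr G. cls4 G x \<chi> i j k \<and> char_deg G \<chi> = of_nat (q^3)} = (q - 1)^3
      \<and> card {\<chi>\<in>Irr G. cls4 G x \<chi> i j k \<and> char_deg G \<chi> = of_nat (q^2)} = q^2 * (q - 1)^2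
      \<and> (\<forall>\<chi>\<in>Irr G. cls4 G x \<chi> i j k \<longrightarrow>
            char_deg G \<chi> = of_nat (q^3) \<or> char_deg G \<chi> = of_nat (q^2)))
   \<comment> \<open>(5)\<close>
   \<and> (\<forall>i \<in> {8, 9, 10}.
        card {\<chi>\<in>Irr G. cls5 G x \<chi> i \<and> char_deg G \<chi> = of_nat (q^3)} = (q - 1)^2
      \<and> card {\<chi>\<in>Irr G. cls5 G x \<chi> i \<and> char_deg G \<chi> = of_nat (q^2)} = q^2 * (q - 1)
      \<and> (\<forall>\<chi>\<in>Irr G. cls5 G x \<chi> i \<longrightarrow>
            char_deg G \<chi> = of_nat (q^3) \<or> char_deg G \<chi> = of_nat (q^2)))
   \<comment> \<open>(6)\<close>
   \<and> card {\<chi>\<in>Irr G. cls6 G x \<chi>} = q^2 * (q - 1)^3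
   \<and> (\<forall>\<chi>\<in>Irr G. cls6 G x \<chi> \<longrightarrow> char_deg G \<chi> = of_nat q)
   \<comment> \<open>(7)\<close>
   \<and> (\<forall>(i, j, k) \<in> {(5, 6, 7), (5, 7, 6), (6, 7, 5)}.
        card {\<chi>\<in>Irr G. cls7 G x \<chi> i j k} = q^2 * (q - 1)^2
      \<and> (\<forall>\<chi>\<in>Irr G. cls7 G x \<chi> i j k \<longrightarrow> char_deg G \<chi> = of_nat q))
   \<comment> \<open>(8)\<close>
   \<and> (\<forall>i \<in> {5, 6, 7}.
        card {\<chi>\<in>Irr G. cls8 G x \<chi> i} = q^2 * (q - 1)
      \<and> (\<forall>\<chi>\<in>Irr G. cls8 G x \<chi> i \<longrightarrow> char_deg G \<chi> = of_nat q))
   \<comment> \<open>(9)\<close>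
   \<and> card {\<chi>\<in>Irr G. cls9 G x \<chi>} = q^4
   \<and> (\<forall>\<chi>\<in>Irr G. cls9 G x \<chi> \<longrightarrow> char_deg G \<chi> = 1)"
proof -
  obtain \<phi> :: "'f \<Rightarrow> complex" and w0 where \<phi>: "\<And>u v. \<phi> (u + v) = \<phi> u * \<phi> v" "\<And>u. \<phi> u * cnj (\<phi> u) = 1" "\<phi> w0 \<noteq> 1"
    using ex_additive_character[where 'f = 'f] by blast
  interpret UD4_char G x \<phi> w0 q
    by unfold_locales (use U \<phi> in \<open>auto simp: q_def\<close>)
  show ?thesis
    using exactly_one_class cls1_counts cls2_counts cls3_odd_counts cls3_even_counts
      cls4_8_9_counts cls4_8_10_counts cls4_9_10_counts cls5_8_counts cls5_9_counts cls5_10_counts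
      cls6_counts cls7_5_6_counts cls7_5_7_counts cls7_6_7_counts cls8_5_counts cls8_6_counts cls8_7_counts cls9_counts
    by (simp only: ball_simps prod.case of_nat_1 simp_thms) simp
qed

end
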